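(* Let $F_a, F_b, F_c \in S = k[x,y,z]$ be homogeneous polynomials of degrees $a \leq b \leq c$ such that $J=(F_a,F_b,F_c)$ is a quasi complete intersection ideal of type $(a,b,c)$, so that there is an exact sequence $$0 \to E \to \mathcal{O}(c-a) \oplus \mathcal{O}(c-b) \oplus \mathcal{O} \to \mathcal{I}_T(c) \to 0$$ on $\mathbb{P}^2$, where $T \subset \mathbb{P}^2$ is a closed subscheme of codimension two and $E$ is a rank two vector bundle. Set $t = h^0(\mathcal{O}_T)$ and $r := \min\{m \in \mathbb{Z} \mid h^0(E(m)) \neq 0\}$. Then: (i) $c(a+b-c-r) \leq t \leq r^2 + r(c-a-b) + ab$. (ii) If $2r > a+b-c$, then $$t \leq r(c-a-b) + ab + r^2 - \frac{(c-a-b+2r+1)(c-a-b+2r)}{2}.$$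
   Context: $k$ is an algebraically closed field, $\mathbb{P}^2=\mathbb{P}^2_k$, $\mathcal{O}=\mathcal{O}_{\mathbb{P}^2}$, and $h^i = \dim_k H^i$. Given nonzero homogeneous polynomials $F_a,F_b,F_c\in S=k[x,y,z]$ of degrees $a,b,c$, the ideal $J=(F_a,F_b,F_c)$ is a quasi complete intersection (q.c.i.) of type $(a,b,c)$ if the image of the morphism $\mathcal{O}(-a)\oplus\mathcal{O}(-b)\oplus\mathcal{O}(-c)\to\mathcal{O}$ given by $(F_a,F_b,F_c)$ is the ideal sheaf $\mathcal{I}_T$ of a (nonempty) closed subscheme $T\subset\mathbb{P}^2$ of codimension two. The exact sequence in the claim is the one obtained from this morphism by twisting by $c$; thus $E$ is the kernel twisted by $c$ (it is locally free of rank two since the kernel is reflexive on a smooth surface). $t$ is the degree of $T$. *)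

theory Defs
  imports
    Complex_Main
    "HOL-Library.Poly_Mapping"
    "HOL-Library.Numeral_Type"
    "HOL-Library.Function_Algebras"
    "HOL-Library.Product_Plus"
    "HOL-Library.Extended_Nat"
    "HOL-Computational_Algebra.Polynomial"
    "HOL-Computational_Algebra.Fraction_Field"
begin

section \<open>The graded ring k[x,y,z]\<close>

text \<open>Monomials in three variables are exponent functions on the three-element type 3.\<close>

type_synonym 'k poly3 = "(3 \<Rightarrow>\<^sub>0 nat) \<Rightarrow>\<^sub>0 'k"

definition var :: "3 \<Rightarrow> 'k::field poly3" where
  "var i = Poly_Mapping.single (Poly_Mapping.single i 1) 1"

definition const :: "'k::field \<Rightarrow> 'k poly3" where
  "const c = Poly_Mapping.single 0 c"

definition mdeg :: "(3 \<Rightarrow>\<^sub>0 nat) \<Rightarrow> nat" where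
  "mdeg m = (\<Sum>i\<in>UNIV. Poly_Mapping.lookup m i)"

text \<open>\<open>form d f\<close>: \<open>f\<close> lies in the graded piece of degree \<open>d\<close>; it contains \<open>0\<close> for every \<open>d\<close>
  and nothing else if \<open>d < 0\<close>.\<close>

definition form :: "int \<Rightarrow> 'k::field poly3 \<Rightarrow> bool" where
  "form d f \<longleftrightarrow> (\<forall>m\<in>Poly_Mapping.keys f. int (mdeg m) = d)"

definition hom_part :: "nat \<Rightarrow> 'k::field poly3 \<Rightarrow> 'k poly3" where
  "hom_part d f =
    (\<Sum>m\<in>{m \<in> Poly_Mapping.keys f. mdeg m = d}. Poly_Mapping.single m (Poly_Mapping.lookup f m))"


section \<open>The projective plane Proj k[x,y,z]\<close>

text \<open>The last conjunct says that the ideal does not contain the irrelevant ideal \<open>(x,y,z)\<close>.\<close>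

definition proj_prime :: "'k::field poly3 set \<Rightarrow> bool" where
  "proj_prime p \<longleftrightarrow>
     0 \<in> p \<and> (\<forall>f\<in>p. \<forall>g\<in>p. f + g \<in> p) \<and> (\<forall>f. \<forall>g\<in>p. f * g \<in> p) \<and>
     1 \<notin> p \<and> (\<forall>f g. f * g \<in> p \<longrightarrow> f \<in> p \<or> g \<in> p) \<and>
     (\<forall>f\<in>p. \<forall>d. hom_part d f \<in> p) \<and>
     (\<exists>i. var i \<notin> p)"

lemma proj_prime_zero: "proj_prime ({0} :: 'k::field poly3 set)"
proof -
  have "var i \<noteq> (0 :: 'k poly3)" for i
    unfolding var_def by (metis lookup_single_eq lookup_zero zero_neq_one)
  then show ?thesis by (simp add: proj_prime_def hom_part_def)
qed

typedef (overloaded) 'k proj_plane = "{p :: 'k::field poly3 set. proj_prime p}"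
  morphisms prime_of Point
  using proj_prime_zero by blast

lemma proj_prime_prime_of: "proj_prime (prime_of p)"
  using prime_of by simp

lemma form_mult: "form d f \<Longrightarrow> form e g \<Longrightarrow> form (d + e) (f * g)"
proof -
  assume f: "form d f" and g: "form e g"
  have add: "mdeg (m + n) = mdeg m + mdeg n" for m n
    by (simp add: mdeg_def lookup_add sum.distrib)
  show ?thesis
    unfolding form_def
  proof
    fix m assume "m \<in> Poly_Mapping.keys (f * g)"
    then obtain u v where "u \<in> Poly_Mapping.keys f" "v \<in> Poly_Mapping.keys g" "m = u + v"
      using keys_mult[of f g] by auto
    with f g show "int (mdeg m) = d + e" by (simp add: form_def add)
  qed
qed

text \<open>The Zariski topology: the closed sets are the zero sets of sets of homogeneous elements.\<close>

instantiation proj_plane :: (field) topological_space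
begin

definition open_proj_plane :: "'a proj_plane set \<Rightarrow> bool" where
  "open_proj_plane U \<longleftrightarrow>
     (\<exists>A. (\<forall>f\<in>A. \<exists>d. form d f) \<and> U = {p. \<not> A \<subseteq> prime_of p})"

instance
proof
  have "(\<forall>f\<in>{1::'a poly3}. \<exists>d. form d f) \<and> UNIV = {p::'a proj_plane. \<not> {1} \<subseteq> prime_of p}"
    using proj_prime_prime_of by (auto simp: proj_prime_def form_def)
  then show "open (UNIV :: 'a proj_plane set)"
    unfolding open_proj_plane_def by blast
next
  fix U V :: "'a proj_plane set"
  assume "open U" "open V"
  then obtain A B where A: "\<forall>f\<in>A. \<exists>d. form d f" "U = {p. \<not> A \<subseteq> prime_of p}"
    and B: "\<forall>f\<in>B. \<exists>d. form d f" "V = {p. \<not> B \<subseteq> prime_of p}"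
    unfolding open_proj_plane_def by blast
  let ?C = "{f * g | f g. f \<in> A \<and> g \<in> B}"
  have "\<forall>f\<in>?C. \<exists>d. form d f"
    using A(1) B(1) form_mult by blast
  moreover have "(\<not> ?C \<subseteq> prime_of p) = (\<not> A \<subseteq> prime_of p \<and> \<not> B \<subseteq> prime_of p)" for p :: "'a proj_plane"
  proof -
    have ml: "f * g \<in> prime_of p" if "g \<in> prime_of p" for f g
      using proj_prime_prime_of[of p] that unfolding proj_prime_def by blast
    have mr: "f * g \<in> prime_of p" if "f \<in> prime_of p" for f g
      using ml[OF that, of g] by (simp add: mult.commute)
    have pr: "f \<in> prime_of p \<or> g \<in> prime_of p" if "f * g \<in> prime_of p" for f g
      using proj_prime_prime_of[of p] that unfolding proj_prime_def by blast
    show ?thesis using ml mr pr by blast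
  qed
  ultimately show "open (U \<inter> V)"
    unfolding open_proj_plane_def A(2) B(2) by (intro exI[of _ ?C]) auto
next
  fix K :: "'a proj_plane set set"
  assume "\<forall>U\<in>K. open U"
  then obtain A where A: "\<And>U. U \<in> K \<Longrightarrow> (\<forall>f\<in>A U. \<exists>d. form d f) \<and> U = {p. \<not> A U \<subseteq> prime_of p}"
    unfolding open_proj_plane_def by metis
  have "\<forall>f\<in>\<Union>(A ` K). \<exists>d. form d f" using A by blast
  moreover have "\<Union>K = {p. \<not> \<Union>(A ` K) \<subseteq> prime_of p}"
  proof -
    have "p \<in> U \<longleftrightarrow> \<not> A U \<subseteq> prime_of p" if "U \<in> K" for p U
      using A[OF that] by (metis (mono_tags, lifting) mem_Collect_eq)
    then show ?thesis by auto
  qed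
  ultimately show "open (\<Union>K)" unfolding open_proj_plane_def by blast
qed

end


section \<open>Codimension in a topological space\<close>

definition irreducible_set :: "'x::topological_space set \<Rightarrow> bool" where
  "irreducible_set Z \<longleftrightarrow>
     Z \<noteq> {} \<and> (\<forall>A B. closed A \<and> closed B \<and> Z \<subseteq> A \<union> B \<longrightarrow> Z \<subseteq> A \<or> Z \<subseteq> B)"

definition irr_codim :: "'x::topological_space set \<Rightarrow> enat" where
  "irr_codim Z =
     Sup {enat n | n. \<exists>Y. Y 0 = Z \<and> (\<forall>i\<le>n. closed (Y i) \<and> irreducible_set (Y i)) \<and>
                          (\<forall>i<n. Y i \<subset> Y (Suc i))}"

text \<open>The codimension of the empty set is \<open>\<infinity>\<close>.\<close>

definition codim :: "'x::topological_space set \<Rightarrow> enat" where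
  "codim T = (INF Z\<in>{Z. closed Z \<and> irreducible_set Z \<and> Z \<subseteq> T}. irr_codim Z)"


section \<open>The sheaves O(n)\<close>

text \<open>All stalks of \<open>O(n)\<close> are realised inside the fraction field of \<open>k[x,y,z]\<close>. As usual for Proj, a
  section over \<open>U\<close> is a family of germs that is locally given by a single homogeneous fraction of
  degree \<open>n\<close>; it is extended by \<open>0\<close> outside \<open>U\<close>.\<close>

definition O_stalk :: "int \<Rightarrow> 'k::field proj_plane \<Rightarrow> 'k poly3 fract set" where
  "O_stalk n p = {Fract f g | f g d. form (n + d) f \<and> form d g \<and> g \<notin> prime_of p}"

definition O_sections ::
  "int \<Rightarrow> 'k::field proj_plane set \<Rightarrow> ('k proj_plane \<Rightarrow> 'k poly3 fract) set" where
  "O_sections n U =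
     {s. (\<forall>p\<in>U. \<exists>V f g d. open V \<and> p \<in> V \<and> V \<subseteq> U \<and> form (n + d) f \<and> form d g \<and>
                            (\<forall>q\<in>V. g \<notin> prime_of q \<and> s q = Fract f g)) \<and>
         (\<forall>p. p \<notin> U \<longrightarrow> s p = 0)}"

abbreviation emb :: "'k::field poly3 \<Rightarrow> 'k poly3 fract" where
  "emb f \<equiv> Fract f 1"


section \<open>Dimension of spaces of sections\<close>

definition scale_sec ::
  "'k::field \<Rightarrow> ('k proj_plane \<Rightarrow> 'k poly3 fract) \<Rightarrow> ('k proj_plane \<Rightarrow> 'k poly3 fract)" where
  "scale_sec c s = (\<lambda>p. emb (const c) * s p)"

type_synonym 'k sec3 =
  "('k proj_plane \<Rightarrow> 'k poly3 fract) \<times> ('k proj_plane \<Rightarrow> 'k poly3 fract) \<times>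
   ('k proj_plane \<Rightarrow> 'k poly3 fract)"

definition scale_sec3 :: "'k::field \<Rightarrow> 'k sec3 \<Rightarrow> 'k sec3" where
  "scale_sec3 c = (\<lambda>(u, v, w). (scale_sec c u, scale_sec c v, scale_sec c w))"

lemma vector_space_scale_sec: "vector_space (scale_sec :: 'k::field \<Rightarrow> _)"
proof -
  have a: "emb (const (c + d)) * x = emb (const c) * x + emb (const d) * x" for c d :: 'k and x
    by (simp add: const_def single_add flip: distrib_right)
  have m: "emb (const (c * d)) * x = emb (const c) * (emb (const d) * x)" for c d :: 'k and x
    by (simp add: const_def mult_single flip: mult.assoc)
  have o: "emb (const (1::'k)) = 1"
    by (simp add: const_def One_fract_def)
  show ?thesis
    by unfold_locales (simp_all add: scale_sec_def fun_eq_iff a m o distrib_left)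
qed

lemma vector_space_scale_sec3: "vector_space (scale_sec3 :: 'k::field \<Rightarrow> _)"
proof -
  interpret vector_space "scale_sec :: 'k \<Rightarrow> _" by (rule vector_space_scale_sec)
  show ?thesis
    by unfold_locales
      (auto simp: scale_sec3_def scale_right_distrib scale_left_distrib)
qed

text \<open>The dimension of the quotient space \<open>A / B\<close> (for subspaces \<open>B \<subseteq> A\<close>), read off from a
  complement of \<open>B\<close> in \<open>A\<close>, which maps isomorphically onto \<open>A / B\<close>.\<close>

definition dim_quot :: "('k::field \<Rightarrow> 'v::ab_group_add \<Rightarrow> 'v) \<Rightarrow> 'v set \<Rightarrow> 'v set \<Rightarrow> nat" where
  "dim_quot sc A B =
     vector_space.dim sc
       (SOME C. module.subspace sc C \<and> C \<inter> B = {0} \<and> {x + y | x y. x \<in> C \<and> y \<in> B} = A)"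


section \<open>The sheaves attached to three forms\<close>

text \<open>The kernel of \<open>(Fa, Fb, Fc) : O(c-a+m) \<oplus> O(c-b+m) \<oplus> O(m) \<rightarrow> O(c+m)\<close>, that is, \<open>E(m)\<close>.\<close>

definition E_sections ::
  "nat \<Rightarrow> nat \<Rightarrow> nat \<Rightarrow> 'k::field poly3 \<Rightarrow> 'k poly3 \<Rightarrow> 'k poly3 \<Rightarrow> int \<Rightarrow>
   'k proj_plane set \<Rightarrow> 'k sec3 set" where
  "E_sections a b c Fa Fb Fc m U =
     {(u, v, w). u \<in> O_sections (int c - int a + m) U \<and> v \<in> O_sections (int c - int b + m) U \<and>
        w \<in> O_sections m U \<and>
        (\<forall>p\<in>U. emb Fa * u p + emb Fb * v p + emb Fc * w p = 0)}"

definition h0_E ::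
  "nat \<Rightarrow> nat \<Rightarrow> nat \<Rightarrow> 'k::field poly3 \<Rightarrow> 'k poly3 \<Rightarrow> 'k poly3 \<Rightarrow> int \<Rightarrow> nat" where
  "h0_E a b c Fa Fb Fc m = vector_space.dim scale_sec3 (E_sections a b c Fa Fb Fc m UNIV)"

text \<open>The stalk at \<open>p\<close> of the image of \<open>(Fa, Fb, Fc) : O(-a) \<oplus> O(-b) \<oplus> O(-c) \<rightarrow> O\<close>.\<close>

definition I_stalk ::
  "nat \<Rightarrow> nat \<Rightarrow> nat \<Rightarrow> 'k::field poly3 \<Rightarrow> 'k poly3 \<Rightarrow> 'k poly3 \<Rightarrow>
   'k proj_plane \<Rightarrow> 'k poly3 fract set" where
  "I_stalk a b c Fa Fb Fc p =
     {emb Fa * u + emb Fb * v + emb Fc * w | u v w.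
        u \<in> O_stalk (- int a) p \<and> v \<in> O_stalk (- int b) p \<and> w \<in> O_stalk (- int c) p}"

text \<open>The set underlying the closed subscheme \<open>T\<close>, i.e. the support of \<open>O / I\<close>.\<close>

definition T_support ::
  "nat \<Rightarrow> nat \<Rightarrow> nat \<Rightarrow> 'k::field poly3 \<Rightarrow> 'k poly3 \<Rightarrow> 'k poly3 \<Rightarrow> 'k proj_plane set" where
  "T_support a b c Fa Fb Fc = {p. I_stalk a b c Fa Fb Fc p \<noteq> O_stalk 0 p}"

definition qci ::
  "nat \<Rightarrow> nat \<Rightarrow> nat \<Rightarrow> 'k::field poly3 \<Rightarrow> 'k poly3 \<Rightarrow> 'k poly3 \<Rightarrow> bool" where
  "qci a b c Fa Fb Fc \<longleftrightarrow>
     Fa \<noteq> 0 \<and> Fb \<noteq> 0 \<and> Fc \<noteq> 0 \<and> form (int a) Fa \<and> form (int b) Fb \<and> form (int c) Fc \<and>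
     T_support a b c Fa Fb Fc \<noteq> {} \<and> codim (T_support a b c Fa Fb Fc) = 2"

text \<open>A global section of the quotient sheaf \<open>O / I\<close> is a family of elements of the stalks
  \<open>O_p / I_p\<close> that is locally induced by sections of \<open>O\<close>. Such families are represented by
  families of lifts, two of which agree iff their difference lies in \<open>I_p\<close> at every \<open>p\<close>.\<close>

definition OT_lifts ::
  "nat \<Rightarrow> nat \<Rightarrow> nat \<Rightarrow> 'k::field poly3 \<Rightarrow> 'k poly3 \<Rightarrow> 'k poly3 \<Rightarrow>
   ('k proj_plane \<Rightarrow> 'k poly3 fract) set" where
  "OT_lifts a b c Fa Fb Fc =
     {s. \<forall>p. \<exists>V \<sigma>. open V \<and> p \<in> V \<and> \<sigma> \<in> O_sections 0 V \<and>
                    (\<forall>q\<in>V. s q - \<sigma> q \<in> I_stalk a b c Fa Fb Fc q)}"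

definition OT_null ::
  "nat \<Rightarrow> nat \<Rightarrow> nat \<Rightarrow> 'k::field poly3 \<Rightarrow> 'k poly3 \<Rightarrow> 'k poly3 \<Rightarrow>
   ('k proj_plane \<Rightarrow> 'k poly3 fract) set" where
  "OT_null a b c Fa Fb Fc = {s. \<forall>p. s p \<in> I_stalk a b c Fa Fb Fc p}"

definition h0_OT ::
  "nat \<Rightarrow> nat \<Rightarrow> nat \<Rightarrow> 'k::field poly3 \<Rightarrow> 'k poly3 \<Rightarrow> 'k poly3 \<Rightarrow> nat" where
  "h0_OT a b c Fa Fb Fc =
     dim_quot scale_sec (OT_lifts a b c Fa Fb Fc) (OT_null a b c Fa Fb Fc)"

end

theory Submission
  imports Defs "Berlekamp_Zassenhaus.Unique_Factorization_Poly"
begin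

text \<open>
  Let \<open>J = (Fa, Fb, Fc)\<close>, of degrees \<open>d1 = a\<close>, \<open>d2 = b\<close>, \<open>d3 = c\<close>, let \<open>s = (u, v, w)\<close> be a nonzero syzygy of
  least total degree \<open>e = r + c\<close>, and put \<open>sigma = a + b + c\<close>. The proof replaces the bundle \<open>E\<close> and its Chern
  classes by dimensions of spaces of forms.

  Since \<open>T\<close> has codimension two, the three forms have no common factor (\<open>qci_primitive\<close>); since \<open>s\<close> is
  minimal, neither do its entries (\<open>least_syzygy_primitive\<close>). Hence for every syzygy \<open>s'\<close> the cross product
  \<open>s \<times> s'\<close>, being orthogonal to both, is \<open>g\<close> times \<open>(Fa, Fb, Fc)\<close> for a form \<open>g\<close>. These \<open>g\<close> form a homogeneous
  ideal \<open>K\<close>, the ideal of the zero scheme \<open>Z\<close> of the section of \<open>E(r)\<close> given by \<open>s\<close>, and \<open>g = 0\<close> only if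
  \<open>s'\<close> is a multiple of \<open>s\<close>. Counting dimensions in a large degree gives
  \<open>codim J + codim K = e\<^sup>2 - e sigma + ab + ac + bc = r\<^sup>2 + r (c - a - b) + ab\<close> (\<open>codim_J_K\<close>). Here
  the codimension of \<open>J\<close> is \<open>t\<close> (\<open>h0_OT_eq_codim\<close>) and that of \<open>K\<close> is the degree of \<open>Z\<close>, so that this is the
  formula \<open>deg Z = c\<^sub>2(E(r))\<close> with \<open>c\<^sub>2(E) = ab - t\<close>.

  The upper bound in (i) says that \<open>codim K\<close> is not negative. The lower bound in (i) says that
  \<open>codim K \<le> (e - a) (e - b)\<close>, which holds because \<open>K\<close> contains \<open>u\<close>, \<open>v\<close> and \<open>w\<close>, and with them two forms
  of degrees \<open>e - a\<close> and \<open>e - b\<close> without common factor (\<open>codim_J_lower\<close>). For (ii), \<open>K\<close> has no nonzero element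
  of degree less than \<open>2 e - sigma = 2 r + c - a - b\<close>, because there are no syzygies of total degree less than
  \<open>e\<close>. As \<open>K\<close> is saturated (\<open>K_saturated\<close>), its codimension does not decrease with the degree, and it is thus
  at least the dimension of the space of forms of degree \<open>2 e - sigma - 1\<close> (\<open>codim_J_upper\<close>).

  Two constructions connect this with the sheaves. First, there is a line that misses the zero locus
  (\<open>missing_line_exists\<close>), so that \<open>O_T\<close> lives on the affine complement of the line and its sections are forms
  divided by powers of the linear form. Second, a section of \<open>O(n)\<close> on the plane is a form of degree \<open>n\<close>
  (\<open>O_sections_UNIV\<close>), so that \<open>E(m)\<close> has the syzygies of total degree \<open>m + c\<close> as its sections. Both rest
  on homogeneous primes that avoid a given form (\<open>homogeneous_prime_avoiding\<close>), which take the place of the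
  Nullstellensatz; the statements on common factors rest on unique factorisation in \<open>k[x,y,z]\<close>.
\<close>

section \<open>Unique factorisation in k[x,y,z]\<close>

abbreviation lookup :: "('m \<Rightarrow>\<^sub>0 'v::zero) \<Rightarrow> 'm \<Rightarrow> 'v" where
  "lookup \<equiv> Poly_Mapping.lookup"

abbreviation keys :: "('m \<Rightarrow>\<^sub>0 'v::zero) \<Rightarrow> 'm set" where
  "keys \<equiv> Poly_Mapping.keys"

abbreviation single :: "'m \<Rightarrow> 'v \<Rightarrow> 'm \<Rightarrow>\<^sub>0 'v::zero" where
  "single \<equiv> Poly_Mapping.single"

lemma exhaust3: "i = 0 \<or> i = 1 \<or> i = 2" for i :: 3
proof (induct i)
  case (of_int z)
  then have "z = 0 \<or> z = 1 \<or> z = 2" by auto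
  then show ?case by auto
qed

text \<open>The ring \<open>k[x,y,z]\<close> is factorial because it is isomorphic to the iterated polynomial ring in
  three variables. The coefficients of the latter are taken in the fraction field of \<open>k\<close>, a copy of
  \<open>k\<close> that carries the gcd operations from which those of polynomial rings are built.\<close>

definition monom3 :: "(3 \<Rightarrow>\<^sub>0 nat) \<Rightarrow> 'k::field \<Rightarrow> 'k fract poly poly poly" where
  "monom3 m c = monom (monom (monom (Fract c 1) (lookup m 0)) (lookup m 1)) (lookup m 2)"

definition iter_poly :: "'k::field poly3 \<Rightarrow> 'k fract poly poly poly" where
  "iter_poly f = (\<Sum>m\<in>keys f. monom3 m (lookup f m))"

lemma monom3_0 [simp]: "monom3 m 0 = 0"
  by (simp add: monom3_def Zero_fract_def[symmetric])

lemma monom3_add: "monom3 m (c + d) = monom3 m c + monom3 m d"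
proof -
  have "Fract (c + d) 1 = Fract c 1 + Fract d (1::'a)" by simp
  then show ?thesis by (simp add: monom3_def add_monom del: add_fract)
qed

lemma monom3_mult: "monom3 m c * monom3 n d = monom3 (m + n) (c * d)"
  by (simp add: monom3_def mult_monom lookup_add)

lemma iter_poly_superset:
  assumes "finite A" "keys f \<subseteq> A"
  shows "iter_poly f = (\<Sum>m\<in>A. monom3 m (lookup f m))"
  unfolding iter_poly_def
  by (rule sum.mono_neutral_left) (use assms in \<open>auto simp: in_keys_iff\<close>)

lemma iter_poly_add: "iter_poly (f + g) = iter_poly f + iter_poly g"
proof -
  let ?A = "keys f \<union> keys g"
  have "iter_poly (f + g) = (\<Sum>m\<in>?A. monom3 m (lookup (f + g) m))"
    using keys_add[of f g] by (intro iter_poly_superset) auto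
  also have "\<dots> = (\<Sum>m\<in>?A. monom3 m (lookup f m)) + (\<Sum>m\<in>?A. monom3 m (lookup g m))"
    by (simp add: lookup_add monom3_add sum.distrib)
  also have "\<dots> = iter_poly f + iter_poly g"
    using iter_poly_superset[of ?A f] iter_poly_superset[of ?A g] by simp
  finally show ?thesis .
qed

lemma iter_poly_0 [simp]: "iter_poly 0 = 0"
  by (simp add: iter_poly_def)

lemma iter_poly_sum: "iter_poly (\<Sum>i\<in>A. f i) = (\<Sum>i\<in>A. iter_poly (f i))"
  by (induction A rule: infinite_finite_induct) (auto simp: iter_poly_add)

lemma iter_poly_single: "iter_poly (single m c) = monom3 m c"
  by (subst iter_poly_superset[of "{m}"]) auto

lemma sum_of_singles: "f = (\<Sum>m\<in>keys f. single m (lookup f m))"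
  by (rule poly_mapping_eqI)
     (auto simp: lookup_sum lookup_single when_def in_keys_iff)

lemma iter_poly_mult: "iter_poly (f * g) = iter_poly f * iter_poly g"
proof -
  have "f * g = (\<Sum>m\<in>keys f. \<Sum>n\<in>keys g. single (m + n) (lookup f m * lookup g n))"
    by (subst (1) sum_of_singles[of f], subst (1) sum_of_singles[of g])
       (simp add: sum_product mult_single)
  then have "iter_poly (f * g) = (\<Sum>m\<in>keys f. \<Sum>n\<in>keys g.
      monom3 m (lookup f m) * monom3 n (lookup g n))"
    by (simp add: iter_poly_sum iter_poly_single monom3_mult)
  then show ?thesis by (simp add: sum_product iter_poly_def)
qed

lemma coeff_iter_poly:
  fixes f :: "'k::field poly3"
  shows "coeff (coeff (coeff (iter_poly f) (lookup n 2)) (lookup n 1)) (lookup n 0)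
    = Fract (lookup f n) 1"
proof -
  have eq: "m = n \<longleftrightarrow> lookup m 2 = lookup n 2 \<and> lookup m 1 = lookup n 1 \<and> lookup m 0 = lookup n 0"
    for m :: "3 \<Rightarrow>\<^sub>0 nat"
  proof
    assume *: "lookup m 2 = lookup n 2 \<and> lookup m 1 = lookup n 1 \<and> lookup m 0 = lookup n 0"
    show "m = n"
    proof (rule poly_mapping_eqI)
      fix k :: 3
      show "lookup m k = lookup n k" using * exhaust3[of k] by auto
    qed
  qed auto
  have c: "coeff (coeff (coeff (monom3 m c) (lookup n 2)) (lookup n 1)) (lookup n 0)
     = (if m = n then Fract c 1 else 0)" for m and c :: 'k
    by (auto simp: monom3_def eq)
  have "coeff (coeff (coeff (iter_poly f) (lookup n 2)) (lookup n 1)) (lookup n 0)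
     = (\<Sum>m\<in>keys f. if m = n then Fract (lookup f m) 1 else 0)"
    by (simp add: iter_poly_def coeff_sum c)
  also have "\<dots> = Fract (lookup f n) 1"
    by (auto simp: in_keys_iff Zero_fract_def[symmetric])
  finally show ?thesis .
qed

lemma iter_poly_eq_0_iff [simp]: "iter_poly f = 0 \<longleftrightarrow> f = 0"
proof
  assume "iter_poly f = 0"
  then have "Fract (lookup f n) 1 = 0" for n using coeff_iter_poly[of f n] by simp
  then have "lookup f n = 0" for n
    by (simp add: Zero_fract_def eq_fract)
  then show "f = 0" by (intro poly_mapping_eqI) auto
qed auto

lemma iter_poly_uminus: "iter_poly (- f) = - iter_poly f"
  using iter_poly_add[of f "- f"] by (simp add: eq_neg_iff_add_eq_0 add.commute)

lemma iter_poly_diff: "iter_poly (f - g) = iter_poly f - iter_poly g"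
  using iter_poly_add[of f "- g"] by (simp add: iter_poly_uminus)

lemma iter_poly_inject [simp]: "iter_poly f = iter_poly g \<longleftrightarrow> f = g"
  using iter_poly_eq_0_iff[of "f - g"] by (simp add: iter_poly_diff)

text \<open>The image is a subring that contains the constants and the three variables.\<close>

lemma iter_poly_surj: "\<exists>f. iter_poly f = (p :: 'k::field fract poly poly poly)"
proof -
  let ?R = "range (iter_poly :: 'k poly3 \<Rightarrow> _)"
  have add: "p + q \<in> ?R" if "p \<in> ?R" "q \<in> ?R" for p q
    using that by (auto simp flip: iter_poly_add)
  have mult: "p * q \<in> ?R" if "p \<in> ?R" "q \<in> ?R" for p q
    using that by (auto simp flip: iter_poly_mult)
  let ?e = "\<lambda>i. single (i::3) (1::nat)"
  have C: "[:[:[:c:]:]:] \<in> ?R" for c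
  proof (cases c)
    case (Fract x y)
    have "iter_poly (single 0 (x / y)) = [:[:[:c:]:]:]"
      using Fract by (simp add: iter_poly_single monom3_def monom_0 eq_fract)
    then show ?thesis by (metis rangeI)
  qed
  have X: "monom3 (?e i) 1 \<in> ?R" for i
    by (metis iter_poly_single rangeI)
  have x0: "monom3 (?e 0) 1 = [:[:monom 1 1:]:]" and x1: "monom3 (?e 1) 1 = [:monom 1 1:]"
    and x2: "monom3 (?e 2) 1 = monom 1 1"
    by (simp_all add: monom3_def lookup_single when_def One_fract_def[symmetric] monom_0)
  have A: "[:[:p:]:] \<in> ?R" for p :: "'k fract poly"
  proof (induction p)
    case 0 show ?case by (auto intro!: image_eqI[of _ _ 0])
  next
    case (pCons c p)
    have "[:[:pCons c p:]:] = [:[:[:c:]:]:] + [:[:monom 1 1:]:] * [:[:p:]:]"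
      by (simp add: monom_altdef)
    then show ?case using add[OF C mult[OF X[of 0, unfolded x0] pCons.IH]] by simp
  qed
  have B: "[:p:] \<in> ?R" for p :: "'k fract poly poly"
  proof (induction p)
    case 0 show ?case by (auto intro!: image_eqI[of _ _ 0])
  next
    case (pCons c p)
    have "[:pCons c p:] = [:[:c:]:] + [:monom 1 1:] * [:p:]"
      by (simp add: monom_altdef)
    then show ?case using add[OF A mult[OF X[of 1, unfolded x1] pCons.IH]] by simp
  qed
  have "p \<in> ?R"
  proof (induction p)
    case 0 show ?case by (auto intro!: image_eqI[of _ _ 0])
  next
    case (pCons c p)
    have "pCons c p = [:c:] + monom 1 1 * p"
      by (simp add: monom_altdef)
    then show ?case using add[OF B mult[OF X[of 2, unfolded x2] pCons.IH]] by simp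
  qed
  then show ?thesis by auto
qed

lemma iter_poly_dvd_iff [simp]: "iter_poly f dvd iter_poly g \<longleftrightarrow> f dvd g"
proof
  assume "iter_poly f dvd iter_poly g"
  then obtain q where "iter_poly g = iter_poly f * q" by (rule dvdE)
  moreover obtain h where "q = iter_poly h" using iter_poly_surj by metis
  ultimately have "g = f * h" by (simp flip: iter_poly_mult)
  then show "f dvd g" by simp
qed (auto simp: iter_poly_mult)

lemma iter_poly_1 [simp]: "iter_poly 1 = 1"
proof -
  have "iter_poly 1 * iter_poly 1 = iter_poly (1::'a poly3)" by (simp flip: iter_poly_mult)
  moreover have "iter_poly (1::'a poly3) \<noteq> 0" by simp
  ultimately show ?thesis by (metis mult_cancel_right1)
qed

lemma iter_poly_prime_elem [simp]: "prime_elem (iter_poly p) \<longleftrightarrow> prime_elem p"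
proof -
  have "iter_poly p dvd 1 \<longleftrightarrow> p dvd 1"
    using iter_poly_dvd_iff[of p 1] by simp
  moreover have "(\<forall>a b. iter_poly p dvd a * b \<longrightarrow> iter_poly p dvd a \<or> iter_poly p dvd b)
    \<longleftrightarrow> (\<forall>a b. p dvd a * b \<longrightarrow> p dvd a \<or> p dvd b)"
  proof (intro iffI allI impI)
    fix a b
    assume *: "\<forall>a b. iter_poly p dvd a * b \<longrightarrow> iter_poly p dvd a \<or> iter_poly p dvd b" and "p dvd a * b"
    then have "iter_poly p dvd iter_poly a * iter_poly b"
      by (simp flip: iter_poly_mult)
    then have "iter_poly p dvd iter_poly a \<or> iter_poly p dvd iter_poly b" using * by blast
    then show "p dvd a \<or> p dvd b" by simp
  next
    fix a b
    assume *: "\<forall>a b. p dvd a * b \<longrightarrow> p dvd a \<or> p dvd b" and d: "iter_poly p dvd a * b"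
    obtain x y where xy: "a = iter_poly x" "b = iter_poly y" using iter_poly_surj by metis
    then have "p dvd x * y" using d by (simp flip: iter_poly_mult)
    then show "iter_poly p dvd a \<or> iter_poly p dvd b" using * xy by simp
  qed
  ultimately show ?thesis unfolding prime_elem_def by simp
qed

text \<open>The three elements have no common factor; this form of the condition needs no gcd operation.\<close>

definition primitive3 :: "'a::comm_semiring_1 \<Rightarrow> 'a \<Rightarrow> 'a \<Rightarrow> bool" where
  "primitive3 f g h \<longleftrightarrow> (\<forall>p. p dvd f \<and> p dvd g \<and> p dvd h \<longrightarrow> p dvd 1)"

text \<open>As \<open>q\<close> divides \<open>x * gcd f g h\<close> and the gcd is a unit.\<close>

lemma primitive3_cancel:
  fixes f g h q x :: "'k::field poly3"
  assumes "primitive3 f g h" "q dvd x * f" "q dvd x * g" "q dvd x * h"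
  shows "q dvd x"
proof -
  let ?d = "gcd (iter_poly f) (gcd (iter_poly g) (iter_poly h))"
  obtain d where d: "iter_poly d = ?d" using iter_poly_surj by metis
  have "iter_poly d dvd iter_poly f" "iter_poly d dvd iter_poly g" "iter_poly d dvd iter_poly h"
    unfolding d by (auto intro: dvd_trans)
  then have "d dvd 1" using assms(1) by (auto simp: primitive3_def)
  then have u: "is_unit ?d" using iter_poly_dvd_iff[of d 1] d by simp
  have "iter_poly q dvd gcd (iter_poly x * iter_poly f)
      (gcd (iter_poly x * iter_poly g) (iter_poly x * iter_poly h))"
    using assms(2-4) by (simp flip: iter_poly_mult)
  also have "\<dots> dvd iter_poly x * ?d"
    by (simp add: gcd_mult_left)
  finally show ?thesis using u by simp
qed

text \<open>A vector that is parallel to \<open>(F, G, H)\<close> over the field of fractions is a multiple of it over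
  the ring: if, say, \<open>F \<noteq> 0\<close>, then \<open>F\<close> divides \<open>X * F\<close>, \<open>X * G = Y * F\<close> and \<open>X * H = Z * F\<close>, hence \<open>X\<close>.\<close>

lemma primitive3_parallel:
  fixes F G H X Y Z :: "'k::field poly3"
  assumes prim: "primitive3 F G H"
    and "X * G = Y * F" "X * H = Z * F" "Y * H = Z * G"
  shows "\<exists>g. X = g * F \<and> Y = g * G \<and> Z = g * H"
proof -
  have "F \<noteq> 0 \<or> G \<noteq> 0 \<or> H \<noteq> 0"
    using prim unfolding primitive3_def by (metis dvd_0_left_iff dvd_0_right zero_neq_one)
  then show ?thesis
  proof (elim disjE)
    assume n: "F \<noteq> 0"
    have "F dvd X" by (rule primitive3_cancel[OF prim]) (auto simp: assms)
    then obtain g where "X = F * g" by (rule dvdE)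
    then show ?thesis using n assms by (intro exI[of _ g]) auto
  next
    assume n: "G \<noteq> 0"
    have "G dvd Y" by (rule primitive3_cancel[OF prim]) (auto simp: assms simp flip: assms(2))
    then obtain g where "Y = G * g" by (rule dvdE)
    then show ?thesis using n assms by (intro exI[of _ g]) auto
  next
    assume n: "H \<noteq> 0"
    have "H dvd Z" by (rule primitive3_cancel[OF prim]) (auto simp flip: assms(2-4))
    then obtain g where "Z = H * g" by (rule dvdE)
    then show ?thesis using n assms by (intro exI[of _ g]) auto
  qed
qed

text \<open>Up to associates; generic choices below have to avoid only finitely many primes.\<close>

lemma finitely_many_primes_dividing:
  fixes x :: "'k::field poly3"
  assumes "x \<noteq> 0"
  shows "\<exists>P. finite P \<and> (\<forall>p\<in>P. prime_elem p \<and> p dvd x) \<and>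
     (\<forall>q. prime_elem q \<and> q dvd x \<longrightarrow> (\<exists>p\<in>P. p dvd q \<and> q dvd p))"
proof -
  let ?P = "Hilbert_Choice.inv iter_poly ` prime_factors (iter_poly x)"
  have inv: "iter_poly (Hilbert_Choice.inv iter_poly p) = (p :: 'k fract poly poly poly)" for p
    using iter_poly_surj[of p] by (metis f_inv_into_f rangeI)
  have "prime_elem p \<and> p dvd x" if pP: "p \<in> ?P" for p
  proof -
    obtain r where r: "r \<in> prime_factors (iter_poly x)" "p = Hilbert_Choice.inv iter_poly r"
      using pP unfolding image_iff by blast
    have "iter_poly p = r" using inv r by simp
    then show ?thesis using r
      by (metis iter_poly_dvd_iff iter_poly_prime_elem in_prime_factors_iff prime_imp_prime_elem)
  qed
  moreover have "\<exists>p\<in>?P. p dvd q \<and> q dvd p" if "prime_elem q" "q dvd x" for q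
  proof -
    let ?n = "normalize (iter_poly q)"
    have "irreducible (iter_poly q)"
      using that(1) by (metis iter_poly_prime_elem prime_elem_imp_irreducible)
    then have "?n \<in> prime_factors (iter_poly x)"
      using that assms by (auto simp: in_prime_factors_iff)
    then have "Hilbert_Choice.inv iter_poly ?n \<in> ?P" by simp
    moreover have "iter_poly (Hilbert_Choice.inv iter_poly ?n) dvd iter_poly q" 
      "iter_poly q dvd iter_poly (Hilbert_Choice.inv iter_poly ?n)"
      unfolding inv by auto
    ultimately show ?thesis by (meson iter_poly_dvd_iff)
  qed
  ultimately show ?thesis by (intro exI[of _ ?P]) auto
qed

lemma prime_divisor_exists3:
  fixes x :: "'k::field poly3"
  assumes "x \<noteq> 0" "\<not> x dvd 1"
  shows "\<exists>p. prime_elem p \<and> p dvd x"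
proof -
  have "\<not> is_unit (iter_poly x)" using assms iter_poly_dvd_iff[of x 1] by simp
  then obtain r where r: "prime r" "r dvd iter_poly x"
    using assms prime_divisor_exists[of "iter_poly x"] by auto
  obtain p where "r = iter_poly p" using iter_poly_surj by metis
  then show ?thesis using r
    by (metis iter_poly_dvd_iff iter_poly_prime_elem prime_imp_prime_elem)
qed

section \<open>Dimensions of finitely spanned subspaces\<close>

text \<open>The spaces of all polynomials and of all families of germs have infinite dimension, and \<open>dim\<close>
  is informative only for subspaces that are finitely spanned.\<close>

definition fin_span :: "('k::field \<Rightarrow> 'v::ab_group_add \<Rightarrow> 'v) \<Rightarrow> 'v set \<Rightarrow> bool" where
  "fin_span sc V \<longleftrightarrow> (\<exists>W. finite W \<and> V \<subseteq> module.span sc W)"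

text \<open>The qualifier separates the facts below from their instances for real vector spaces, which
  otherwise take over the short names.\<close>

locale vsp = vs: vector_space sc for sc :: "'k::field \<Rightarrow> 'v::ab_group_add \<Rightarrow> 'v"
begin

lemma fin_span_mono: "fin_span sc V \<Longrightarrow> U \<subseteq> V \<Longrightarrow> fin_span sc U"
  unfolding fin_span_def by blast

lemma fin_span_basis:
  assumes "fin_span sc V"
  obtains B where "finite B" "vs.independent B" "B \<subseteq> V" "V \<subseteq> vs.span B" "card B = vs.dim V"
proof -
  obtain B where B: "B \<subseteq> V" "vs.independent B" "V \<subseteq> vs.span B" "card B = vs.dim V"
    using vs.basis_exists by blast
  obtain W where "finite W" "V \<subseteq> vs.span W" using assms by (auto simp: fin_span_def)
  then have "finite B" using B vs.independent_span_bound[of W B] by auto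
  then show thesis using B that by blast
qed

lemma independent_card_le_dim_span:
  assumes "fin_span sc V" "vs.independent B" "B \<subseteq> V"
  shows "finite B \<and> card B \<le> vs.dim V"
proof -
  obtain C where C: "finite C" "V \<subseteq> vs.span C" "card C = vs.dim V"
    using fin_span_basis[OF assms(1)] by metis
  then have "B \<subseteq> vs.span C" using assms by blast
  then show ?thesis using vs.independent_span_bound[OF C(1) assms(2)] C by auto
qed

lemma dim_mono_span:
  assumes "fin_span sc V" "U \<subseteq> V"
  shows "vs.dim U \<le> vs.dim V"
proof -
  obtain B where "finite B" "vs.independent B" "B \<subseteq> U" "card B = vs.dim U"
    using fin_span_basis[OF fin_span_mono[OF assms]] by metis
  then show ?thesis using independent_card_le_dim_span[OF assms(1), of B] assms(2) by auto
qed

lemma subspace_eq_if_dim_ge: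
  assumes "fin_span sc V" "vs.subspace U" "U \<subseteq> V" "vs.dim V \<le> vs.dim U"
  shows "U = V"
proof (rule ccontr)
  assume "U \<noteq> V"
  then obtain x where x: "x \<in> V" "x \<notin> U" using assms by blast
  obtain B where B: "finite B" "vs.independent B" "B \<subseteq> U" "U \<subseteq> vs.span B" "card B = vs.dim U"
    using fin_span_basis[OF fin_span_mono[OF assms(1,3)]] by metis
  have "vs.span B \<subseteq> U" using B assms(2) by (simp add: vs.span_minimal)
  then have "x \<notin> vs.span B" using x by blast
  then have "vs.independent (insert x B)" "x \<notin> B"
    using B vs.independent_insertI[of x B] vs.span_base by blast+
  then have "card (insert x B) \<le> vs.dim V"
    using independent_card_le_dim_span[OF assms(1)] B x assms(3) by blast
  then show False using B assms(4) \<open>x \<notin> B\<close> by simp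
qed

lemma dim_eq_0_iff_span:
  assumes "fin_span sc V"
  shows "vs.dim V = 0 \<longleftrightarrow> V \<subseteq> {0}"
proof -
  obtain B where B: "finite B" "vs.independent B" "B \<subseteq> V" "V \<subseteq> vs.span B" "card B = vs.dim V"
    using fin_span_basis[OF assms] by metis
  show ?thesis
  proof
    assume "vs.dim V = 0" then show "V \<subseteq> {0}" using B by simp
  next
    assume "V \<subseteq> {0}"
    then have "B = {}" using B vs.dependent_zero by blast
    then show "vs.dim V = 0" using B by simp
  qed
qed

lemma span_disjoint_independent:
  assumes "vs.independent (A \<union> B)" "A \<inter> B = {}" "x \<in> vs.span A" "x \<in> vs.span B"
  shows "x = 0"
proof -
  have A: "vs.representation (A \<union> B) x = vs.representation A x"
    and B: "vs.representation (A \<union> B) x = vs.representation B x"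
    using assms by (auto intro: vs.representation_extend)
  have "vs.representation (A \<union> B) x b = 0" for b
    using A B vs.representation_ne_zero[of A x b] vs.representation_ne_zero[of B x b] assms(2)
    by (metis disjoint_iff)
  moreover have "x \<in> vs.span (A \<union> B)" using assms(3) vs.span_mono[of A "A \<union> B"] by blast
  ultimately show ?thesis
    using vs.sum_nonzero_representation_eq[OF assms(1)] by fastforce
qed

lemma complement_exists:
  assumes "vs.subspace U" "vs.subspace V" "U \<subseteq> V"
  shows "\<exists>C. vs.subspace C \<and> C \<inter> U = {0} \<and> {x + y | x y. x \<in> C \<and> y \<in> U} = V"
proof -
  obtain B0 where B0: "B0 \<subseteq> U" "vs.independent B0" "U \<subseteq> vs.span B0"
    using vs.maximal_independent_subset by blast
  obtain B where B: "B0 \<subseteq> B" "B \<subseteq> V" "vs.independent B" "V \<subseteq> vs.span B"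
    using vs.maximal_independent_subset_extend[of B0 V] B0 assms(3) by blast
  let ?C = "vs.span (B - B0)"
  have U: "vs.span B0 = U" using B0 assms vs.span_minimal by blast
  have V: "vs.span B = V" using B assms vs.span_minimal by blast
  have un: "(B - B0) \<union> B0 = B" using B by blast
  have "?C \<inter> U = {0}"
    using span_disjoint_independent[of "B - B0" B0] B U un vs.span_zero by auto
  moreover have "{x + y | x y. x \<in> ?C \<and> y \<in> U} = V"
    using vs.span_Un[of "B - B0" B0] U V un by simp
  ultimately show ?thesis using vs.subspace_span by blast
qed

end

context vector_space_pair
begin

text \<open>Linearity is asked for on \<open>V\<close> only, since the maps used later have no linear meaning elsewhere:
  the factor \<open>g\<close> in \<open>s \<times> s' = g F\<close> exists for syzygies \<open>s'\<close> alone, and a projection to a complement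
  is defined on the sum alone. On \<open>V\<close> such a map agrees with a linear one that is prescribed on a basis
  extending a basis of the kernel.\<close>

lemma rank_nullity_on:
  assumes V: "vs1.subspace V" and fin: "fin_span s1 V"
    and add: "\<And>x y. x \<in> V \<Longrightarrow> y \<in> V \<Longrightarrow> f (x + y) = f x + f y"
    and scale: "\<And>c x. x \<in> V \<Longrightarrow> f (s1 c x) = s2 c (f x)"
  shows "vs1.dim V = vs2.dim (f ` V) + vs1.dim {x \<in> V. f x = 0} \<and> fin_span s2 (f ` V)"
proof -
  interpret V1: vsp s1 by unfold_locales
  let ?K = "{x \<in> V. f x = 0}"
  obtain B0 where B0: "B0 \<subseteq> ?K" "vs1.independent B0" "?K \<subseteq> vs1.span B0" "card B0 = vs1.dim ?K"
    using vs1.basis_exists[of ?K] by blast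
  obtain B where B: "B0 \<subseteq> B" "B \<subseteq> V" "vs1.independent B" "V \<subseteq> vs1.span B"
    using vs1.maximal_independent_subset_extend[of B0 V] B0 by auto
  have finB: "finite B" and cB: "card B = vs1.dim V"
    using V1.independent_card_le_dim_span[OF fin] B vs1.basis_card_eq_dim by auto
  obtain g where g: "Vector_Spaces.linear s1 s2 g" "\<And>x. x \<in> B \<Longrightarrow> g x = f x"
    using linear_independent_extend[OF B(3)] by metis
  interpret g: Vector_Spaces.linear s1 s2 g by fact
  have f0: "f 0 = 0" using scale[of 0 0] vs1.subspace_0[OF V] by simp
  have "vs1.subspace {x \<in> V. g x = f x}"
    using V f0 by (auto simp: vs1.subspace_def add scale g.add g.scale)
  then have "vs1.span B \<subseteq> {x \<in> V. g x = f x}"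
    using B g by (intro vs1.span_minimal) auto
  then have sB: "vs1.span B = V" and gf: "\<And>x. x \<in> V \<Longrightarrow> g x = f x"
    using B(4) by auto
  let ?D = "B - B0"
  have un: "?D \<union> B0 = B" using B by blast
  have "inj_on g (vs1.span ?D)"
  proof (rule inj_onI)
    fix x y assume xy: "x \<in> vs1.span ?D" "y \<in> vs1.span ?D" "g x = g y"
    have d: "x - y \<in> vs1.span ?D" using xy by (auto intro: vs1.span_diff)
    then have "x - y \<in> V" using sB vs1.span_mono[of ?D B] by blast
    moreover have "g (x - y) = 0" using xy by (simp add: g.diff)
    ultimately have "x - y \<in> ?K" using gf by force
    then have "x - y \<in> vs1.span B0" using B0 by blast
    then have "x - y = 0"
      using V1.span_disjoint_independent[of ?D B0 "x - y"] B(3) d un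
      by (simp only: un) blast
    then show "x = y" by simp
  qed
  then have ind: "vs2.independent (g ` ?D)" and inj: "inj_on g ?D"
    using g.independent_injective_image[OF vs1.independent_mono[OF B(3)], of ?D]
      inj_on_subset[of g "vs1.span ?D" ?D] vs1.span_superset[of ?D] by auto
  have sub: "g ` ?D \<subseteq> f ` V" using gf B by force
  have "f ` V \<subseteq> vs2.span (g ` ?D)"
  proof
    fix y assume "y \<in> f ` V"
    then obtain x where x: "x \<in> V" "y = g x" using gf by auto
    then obtain p q where pq: "x = p + q" "p \<in> vs1.span ?D" "q \<in> vs1.span B0"
      using sB vs1.span_Un[of ?D B0] un by auto
    have "vs1.subspace {x. g x = 0}" by (rule g.subspace_kernel)
    moreover have "g x = 0" if "x \<in> B0" for x
    proof -
      have "x \<in> ?K" "x \<in> B" using that B0(1) B(1) by blast+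
      then show ?thesis using g(2) by simp
    qed
    ultimately have "vs1.span B0 \<subseteq> {x. g x = 0}"
      by (intro vs1.span_minimal) auto
    then have "y = g p" using pq x by (auto simp: g.add)
    then show "y \<in> vs2.span (g ` ?D)" using pq g.span_image[of ?D] by blast
  qed
  then have "vs2.dim (f ` V) = card ?D" "fin_span s2 (f ` V)"
    using vs2.basis_card_eq_dim[OF sub _ ind] card_image[OF inj] finB
    by (auto simp: fin_span_def intro!: exI[of _ "g ` ?D"])
  then show ?thesis using cB B0 B finB card_Diff_subset[of B0 B] card_mono[of B B0]
    by (auto dest: finite_subset)
qed

text \<open>The quotient \<open>A / B\<close>, represented by a complement \<open>C\<close> of \<open>B\<close>, receives a surjection from \<open>V\<close>: send
  \<open>x\<close> to the component of \<open>f x\<close> in \<open>C\<close> and use the rank formula.\<close>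

lemma dim_complement_of_image:
  assumes V: "vs1.subspace V" and fin: "fin_span s1 V"
    and add: "\<And>x y. x \<in> V \<Longrightarrow> y \<in> V \<Longrightarrow> f (x + y) = f x + f y"
    and scale: "\<And>c x. x \<in> V \<Longrightarrow> f (s1 c x) = s2 c (f x)"
    and B: "vs2.subspace B" and C: "vs2.subspace C" and CB: "C \<inter> B = {0}"
    and A: "{x + y | x y. x \<in> C \<and> y \<in> B} = A"
    and into: "f ` V \<subseteq> A" and onto: "\<And>a. a \<in> A \<Longrightarrow> \<exists>x\<in>V. a - f x \<in> B"
  shows "vs1.dim V = vs2.dim C + vs1.dim {x \<in> V. f x \<in> B}"
proof -
  have "\<exists>c\<in>C. f x - c \<in> B" if "x \<in> V" for x
    using into A that by (force simp: algebra_simps)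
  then obtain g where g: "\<And>x. x \<in> V \<Longrightarrow> g x \<in> C \<and> f x - g x \<in> B" by metis
  have uniq: "c = d" if "c \<in> C" "d \<in> C" "y - c \<in> B" "y - d \<in> B" for c d y
  proof -
    have "c - d \<in> C" using C that vs2.subspace_diff by blast
    moreover have "(y - d) - (y - c) \<in> B" using B that vs2.subspace_diff by blast
    then have "c - d \<in> B" by simp
    ultimately have "c - d = 0" using CB by blast
    then show ?thesis by simp
  qed
  have gadd: "g (x + y) = g x + g y" if "x \<in> V" "y \<in> V" for x y
  proof (rule uniq[of _ _ "f (x + y)"])
    have "(f x - g x) + (f y - g y) \<in> B" using g that B vs2.subspace_add by blast
    then show "f (x + y) - (g x + g y) \<in> B" using add that by (simp add: algebra_simps)
  qed (use g that V C vs1.subspace_add vs2.subspace_add in blast)+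
  have gscale: "g (s1 c x) = s2 c (g x)" if "x \<in> V" for c x
  proof (rule uniq[of _ _ "f (s1 c x)"])
    have "s2 c (f x - g x) \<in> B" using g that B vs2.subspace_scale by blast
    then show "f (s1 c x) - s2 c (g x) \<in> B"
      using scale that by (simp add: vs2.scale_right_diff_distrib)
  qed (use g that V C vs1.subspace_scale vs2.subspace_scale in blast)+
  have "g ` V = C"
  proof
    show "C \<subseteq> g ` V"
    proof
      fix c assume c: "c \<in> C"
      then have "c \<in> A" using A vs2.subspace_0[OF B] by force
      then obtain x where x: "x \<in> V" "c - f x \<in> B" using onto by blast
      then have "f x - c \<in> B" using B vs2.subspace_neg by (metis minus_diff_eq)
      then have "g x = c" using uniq g x c by blast
      then show "c \<in> g ` V" using x by blast
    qed
  qed (use g in blast)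
  moreover have "{x \<in> V. g x = 0} = {x \<in> V. f x \<in> B}"
  proof (intro Collect_cong conj_cong refl)
    fix x assume x: "x \<in> V"
    show "g x = 0 \<longleftrightarrow> f x \<in> B"
      using g[OF x] uniq[of "g x" 0 "f x"] vs2.subspace_0[OF C] by auto
  qed
  ultimately show ?thesis using rank_nullity_on[OF V fin, of g] gadd gscale by auto
qed

end

context vsp
begin

lemma fin_span_sums:
  assumes "fin_span sc U" "fin_span sc V"
  shows "fin_span sc {x + y | x y. x \<in> U \<and> y \<in> V}"
proof -
  obtain A B where "finite A" "U \<subseteq> vs.span A" "finite B" "V \<subseteq> vs.span B"
    using assms by (auto simp: fin_span_def)
  moreover from this have "{x + y | x y. x \<in> U \<and> y \<in> V} \<subseteq> vs.span (A \<union> B)"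
    unfolding vs.span_Un by blast
  ultimately show ?thesis unfolding fin_span_def by (meson finite_UnI)
qed

lemma dim_complement:
  assumes "fin_span sc A" "vs.subspace A" "vs.subspace B" "vs.subspace C" "C \<inter> B = {0}"
    and "{x + y | x y. x \<in> C \<and> y \<in> B} = A"
  shows "vs.dim A = vs.dim C + vs.dim B"
proof -
  interpret vv: vector_space_pair sc sc ..
  have "B \<subseteq> A" using assms(4,6) vs.subspace_0 by force
  then have "{x \<in> A. x \<in> B} = B" by auto
  then show ?thesis
    using vv.dim_complement_of_image[of A "\<lambda>x. x" B C A] assms vs.subspace_0[OF assms(3)] by force
qed

end

context vector_space_pair
begin

lemma dim_injective_image:
  assumes "vs1.subspace V" "fin_span s1 V"
    and "\<And>x y. x \<in> V \<Longrightarrow> y \<in> V \<Longrightarrow> f (x + y) = f x + f y"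
    and "\<And>c x. x \<in> V \<Longrightarrow> f (s1 c x) = s2 c (f x)"
    and "\<And>x. x \<in> V \<Longrightarrow> f x = 0 \<Longrightarrow> x = 0"
  shows "vs2.dim (f ` V) = vs1.dim V \<and> fin_span s2 (f ` V)"
proof -
  interpret V1: vsp s1 ..
  have "vs1.dim {x \<in> V. f x = 0} = 0"
    using assms(5) by (subst V1.dim_eq_0_iff_span[OF V1.fin_span_mono[OF assms(2)]]) auto
  then show ?thesis using rank_nullity_on[OF assms(1-4)] by simp
qed

end

section \<open>Forms\<close>

lemma mdeg_0 [simp]: "mdeg 0 = 0"
  by (simp add: mdeg_def)

lemma form_lookup: "form d f \<longleftrightarrow> (\<forall>m. lookup f m \<noteq> 0 \<longrightarrow> int (mdeg m) = d)"
  by (auto simp: form_def in_keys_iff)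

lemma form_0 [simp]: "form d 0"
  by (simp add: form_def)

lemma form_add: "form d f \<Longrightarrow> form d g \<Longrightarrow> form d (f + g)"
  unfolding form_lookup lookup_add by (metis add.right_neutral add_0)

lemma form_uminus: "form d f \<Longrightarrow> form d (- f)"
  by (simp add: form_lookup)

lemma form_diff: "form d f \<Longrightarrow> form d g \<Longrightarrow> form d (f - g)"
  using form_add[of d f "- g"] form_uminus[of d g] by simp

lemma form_single: "int (mdeg m) = d \<Longrightarrow> form d (single m c)"
  by (auto simp: form_lookup lookup_single when_def)

lemma form_const [simp]: "form 0 (const c)"
  by (auto simp: const_def intro!: form_single)

lemma const_1 [simp]: "const 1 = 1"
  by (simp add: const_def)

lemma form_1 [simp]: "form 0 1"
  using form_const[of 1] by simp

lemma const_add: "const (c + d) = const c + const d"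
  and const_mult: "const (c * d) = const c * const d"
  by (simp_all add: const_def single_add mult_single)

lemma const_eq_0_iff [simp]: "const c = 0 \<longleftrightarrow> c = 0"
  unfolding const_def by (metis lookup_single_eq single_zero lookup_zero)

lemma const_dvd_1: "c \<noteq> 0 \<Longrightarrow> const c dvd 1"
  by (metis const_1 const_mult dvdI right_inverse)

lemma form_const_mult: "form d f \<Longrightarrow> form d (const c * f)"
  using form_mult[of 0 "const c" d f] by simp

lemma form_power: "form d f \<Longrightarrow> form (int n * d) (f ^ n)"
  by (induction n) (auto simp: algebra_simps dest: form_mult)

lemma form_var [simp]: "form 1 (var i)"
  by (auto simp: var_def mdeg_def lookup_single when_def intro!: form_single)

lemma var_neq_0 [simp]: "var i \<noteq> (0 :: 'k::field poly3)"
  unfolding var_def by (metis lookup_single_eq lookup_zero zero_neq_one)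

lemma form_prod: "finite A \<Longrightarrow> (\<And>i. i \<in> A \<Longrightarrow> form (d i) (f i)) \<Longrightarrow> form (\<Sum>i\<in>A. d i) (\<Prod>i\<in>A. f i)"
  by (induction A rule: finite_induct) (auto intro: form_mult)

lemma form_neg: "form d f \<Longrightarrow> d < 0 \<Longrightarrow> f = 0"
  by (rule poly_mapping_eqI) (force simp: form_lookup)

lemma form_unique: "form d f \<Longrightarrow> form e f \<Longrightarrow> f \<noteq> 0 \<Longrightarrow> d = e"
  unfolding form_lookup by (metis poly_mapping_eqI lookup_zero)

lemma mdeg_eq_0_iff: "mdeg m = 0 \<longleftrightarrow> m = 0"
proof
  assume "mdeg m = 0"
  then show "m = 0" by (intro poly_mapping_eqI) (simp add: mdeg_def)
qed simp

lemma form_degree_0_const: "form 0 f \<Longrightarrow> \<exists>c. f = const c"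
  by (rule exI[of _ "lookup f 0"], rule poly_mapping_eqI)
     (auto simp: form_lookup const_def lookup_single when_def mdeg_eq_0_iff)

lemma lookup_hom_part:
  "lookup (hom_part d f) m = (if mdeg m = d then lookup f m else 0)"
  by (auto simp: hom_part_def lookup_sum lookup_single when_def in_keys_iff
      intro!: sum.neutral)

lemma form_hom_part: "form (int d) (hom_part d f)"
  by (simp add: form_lookup lookup_hom_part)

lemma hom_part_add: "hom_part d (f + g) = hom_part d f + hom_part d g"
  by (rule poly_mapping_eqI) (simp add: lookup_hom_part lookup_add)

lemma hom_part_0 [simp]: "hom_part d 0 = 0"
  by (rule poly_mapping_eqI) (simp add: lookup_hom_part)

lemma hom_part_sum: "hom_part d (\<Sum>i\<in>A. f i) = (\<Sum>i\<in>A. hom_part d (f i))"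
  by (induction A rule: infinite_finite_induct) (auto simp: hom_part_add)

lemma hom_part_form: "form e f \<Longrightarrow> hom_part d f = (if e = int d then f else 0)"
  by (auto intro!: poly_mapping_eqI simp: lookup_hom_part form_lookup)

lemma sum_hom_parts:
  assumes "\<And>m. lookup f m \<noteq> 0 \<Longrightarrow> mdeg m \<le> N"
  shows "f = (\<Sum>d\<le>N. hom_part d f)"
  by (rule poly_mapping_eqI) (auto simp: lookup_sum lookup_hom_part intro: assms)

lemma degree_bound: "\<exists>N. \<forall>m. lookup f m \<noteq> 0 \<longrightarrow> mdeg m \<le> N"
proof -
  have "finite (mdeg ` keys f)" by simp
  then obtain N where "\<forall>d\<in>mdeg ` keys f. d \<le> N"
    using finite_nat_set_iff_bounded_le by blast
  then show ?thesis by (intro exI[of _ N]) (auto simp: in_keys_iff)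
qed

lemma hom_part_form_mult:
  assumes "form (int e) f"
  shows "hom_part n (f * g) = (if e \<le> n then f * hom_part (n - e) g else 0)"
proof -
  obtain N where N: "\<forall>m. lookup g m \<noteq> 0 \<longrightarrow> mdeg m \<le> N" using degree_bound by blast
  have g: "g = (\<Sum>d\<le>N+n. hom_part d g)" using N by (intro sum_hom_parts) (auto intro: trans_le_add1)
  have "f * g = (\<Sum>d\<le>N+n. f * hom_part d g)" by (subst g) (simp add: sum_distrib_left)
  then have "hom_part n (f * g) = (\<Sum>d\<le>N+n. hom_part n (f * hom_part d g))"
    by (simp add: hom_part_sum)
  also have "\<dots> = (\<Sum>d\<le>N+n. if d + e = n then f * hom_part d g else 0)"
  proof (rule sum.cong)
    fix d
    have "form (int (d + e)) (f * hom_part d g)"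
      using form_mult[OF assms form_hom_part[of d g]] by (simp add: add.commute)
    then show "hom_part n (f * hom_part d g) = (if d + e = n then f * hom_part d g else 0)"
      by (auto simp: hom_part_form)
  qed simp
  also have "\<dots> = (if e \<le> n then f * hom_part (n - e) g else 0)"
  proof (cases "e \<le> n")
    case True
    then have "d + e = n \<longleftrightarrow> d = n - e" for d by auto
    then show ?thesis using True by simp
  qed auto
  finally show ?thesis .
qed

lemma hom_part_mult: "hom_part n (f * g) = (\<Sum>i\<le>n. hom_part i f * hom_part (n - i) g)"
proof -
  obtain N where N: "\<forall>m. lookup f m \<noteq> 0 \<longrightarrow> mdeg m \<le> N" using degree_bound by blast
  have "f * g = (\<Sum>d\<le>N+n. hom_part d f * g)"
    by (subst sum_hom_parts[of f "N+n"]) (auto simp: N trans_le_add1 sum_distrib_right)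
  then have "hom_part n (f * g) = (\<Sum>d\<le>N+n. if d \<le> n then hom_part d f * hom_part (n - d) g else 0)"
    by (simp add: hom_part_sum hom_part_form_mult[OF form_hom_part])
  also have "\<dots> = (\<Sum>d\<le>n. hom_part d f * hom_part (n - d) g)"
    by (rule sum.mono_neutral_cong_right) auto
  finally show ?thesis .
qed

lemma hom_part_mult_extreme:
  assumes "\<And>i. i \<noteq> D \<Longrightarrow> i \<le> D + E \<Longrightarrow> hom_part i f = 0 \<or> hom_part (D + E - i) g = 0"
  shows "hom_part (D + E) (f * g) = hom_part D f * hom_part E g"
proof -
  have "hom_part (D + E) (f * g) = (\<Sum>i\<le>D + E. if i = D then hom_part D f * hom_part E g else 0)"
    unfolding hom_part_mult using assms by (intro sum.cong) auto
  then show ?thesis by simp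
qed

text \<open>The extreme homogeneous parts of a product are the products of the extreme homogeneous
  parts of its factors. If the two extremes of the product agree, so do those of each factor.\<close>

lemma form_factor:
  assumes "form d (f * g)" "f * g \<noteq> 0"
  shows "\<exists>e. form e f \<and> form (d - e) g"
proof -
  have fin: "finite (mdeg ` keys h)" "mdeg ` keys h \<noteq> {}" if "h \<noteq> 0" for h :: "'a poly3"
    using that by (auto simp: keys_eq_empty)
  define M where "M h = Max (mdeg ` keys h)" for h :: "'a poly3"
  define L where "L h = Min (mdeg ` keys h)" for h :: "'a poly3"
  have bounds: "L h \<le> mdeg m \<and> mdeg m \<le> M h" if "lookup h m \<noteq> 0" for h :: "'a poly3" and m
    unfolding M_def L_def using that by (auto intro!: Min_le Max_ge simp: in_keys_iff)
  have nz: "hom_part (M h) h \<noteq> 0 \<and> hom_part (L h) h \<noteq> 0" if hz: "h \<noteq> 0" for h :: "'a poly3"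
  proof -
    obtain m where "m \<in> keys h" "M h = mdeg m" 
      using Max_in[OF fin[OF hz]] by (auto simp: M_def)
    moreover obtain n where "n \<in> keys h" "L h = mdeg n" 
      using Min_in[OF fin[OF hz]] by (auto simp: L_def)
    ultimately show ?thesis by (metis lookup_hom_part in_keys_iff lookup_zero)
  qed
  have fg: "f \<noteq> 0" "g \<noteq> 0" using assms by auto
  have out: "hom_part d h = 0" if "d < L h \<or> M h < d" for h :: "'a poly3" and d
    using bounds[of h] that by (intro poly_mapping_eqI) (force simp: lookup_hom_part)
  have "hom_part (M f + M g) (f * g) = hom_part (M f) f * hom_part (M g) g"
  proof (rule hom_part_mult_extreme)
    fix i assume "i \<noteq> M f" "i \<le> M f + M g"
    then have "M f < i \<or> M g < M f + M g - i" by linarith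
    then show "hom_part i f = 0 \<or> hom_part (M f + M g - i) g = 0" using out by blast
  qed
  then have "hom_part (M f + M g) (f * g) \<noteq> 0" using nz fg by simp
  then have M: "d = int (M f + M g)" using hom_part_form[OF assms(1), of "M f + M g"] by presburger
  have "hom_part (L f + L g) (f * g) = hom_part (L f) f * hom_part (L g) g"
  proof (rule hom_part_mult_extreme)
    fix i assume "i \<noteq> L f" "i \<le> L f + L g"
    then have "i < L f \<or> L f + L g - i < L g" by linarith
    then show "hom_part i f = 0 \<or> hom_part (L f + L g - i) g = 0" using out by blast
  qed
  then have "hom_part (L f + L g) (f * g) \<noteq> 0" using nz fg by simp
  then have L: "d = int (L f + L g)" using hom_part_form[OF assms(1), of "L f + L g"] by presburger
  have "L h \<le> M h" if "h \<noteq> 0" for h :: "'a poly3"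
    using fin[OF that] by (simp add: L_def M_def)
  then have "L f \<le> M f" "L g \<le> M g" using fg by auto
  then have "L f = M f" "L g = M g" using L M by auto
  then have "form (int (M f)) f" "form (int (M g)) g"
    using bounds[of f] bounds[of g] by (auto simp: form_lookup intro: antisym)
  then show ?thesis using M by (intro exI[of _ "int (M f)"]) auto
qed

lemma form_dvd:
  assumes "form d f" "f \<noteq> 0" "g dvd f"
  shows "\<exists>e. form e g"
  using assms form_factor by (metis dvdE)

lemma form_quotient:
  assumes "form d (f * g)" "form e f" "f \<noteq> 0"
  shows "form (d - e) g"
proof (cases "g = 0")
  case False
  then obtain e' where "form e' f" "form (d - e') g" using form_factor[of d f g] assms by auto
  then show ?thesis using form_unique assms by blast
qed auto

text \<open>Homogeneous parts indexed by all integers, zero in negative degrees. Degrees of coefficients of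
  syzygies are differences of degrees and may be negative.\<close>

definition hpart :: "int \<Rightarrow> 'k::field poly3 \<Rightarrow> 'k poly3" where
  "hpart d f = (if d < 0 then 0 else hom_part (nat d) f)"

lemma form_hpart: "form d (hpart d f)"
  using form_hom_part[of "nat d" f] by (auto simp: hpart_def)

lemma hpart_add: "hpart d (f + g) = hpart d f + hpart d g"
  by (simp add: hpart_def hom_part_add)

lemma hpart_form: "form d f \<Longrightarrow> hpart d f = f"
  using form_neg[of d f] hom_part_form[of d f "nat d"] by (auto simp: hpart_def)

lemma hpart_uminus: "hpart d (- f) = - hpart d f"
proof -
  have "hpart d f + hpart d (- f) = 0"
    using hpart_add[of d f "- f"] hpart_form[of d "0 :: 'a poly3"] by simp
  then show ?thesis by (rule minus_unique[symmetric])
qed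

lemma hpart_diff: "hpart d (f - g) = hpart d f - hpart d g"
  using hpart_add[of d f "- g"] by (simp add: hpart_uminus)

lemma hpart_mult: "form d F \<Longrightarrow> hpart n (F * A) = F * hpart (n - d) A"
proof (cases "F = 0")
  case True then show ?thesis using hpart_form[of n 0] by simp
next
  case False
  assume F: "form d F"
  have "d \<ge> 0" using form_neg[OF F] False by fastforce
  then obtain k where k: "d = int k" by (metis nonneg_int_cases)
  show ?thesis
    using hom_part_form_mult[of k F "nat n" A] F k by (auto simp: hpart_def nat_diff_distrib)
qed

section \<open>Spaces of forms\<close>

definition pscale :: "'k::field \<Rightarrow> 'k poly3 \<Rightarrow> 'k poly3" where
  "pscale c f = const c * f"

definition pscale3 :: "'k::field \<Rightarrow> 'k poly3 \<times> 'k poly3 \<times> 'k poly3 \<Rightarrow> 'k poly3 \<times> 'k poly3 \<times> 'k poly3" where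
  "pscale3 c = (\<lambda>(A, B, C). (pscale c A, pscale c B, pscale c C))"

interpretation P: vector_space "pscale :: 'k::field \<Rightarrow> _"
  by unfold_locales (simp_all add: pscale_def const_add const_mult algebra_simps)

interpretation P: vsp "pscale :: 'k::field \<Rightarrow> _" ..

interpretation P3: vector_space "pscale3 :: 'k::field \<Rightarrow> _"
  by unfold_locales
     (auto simp: pscale3_def P.scale_right_distrib P.scale_left_distrib)

interpretation P3: vsp "pscale3 :: 'k::field \<Rightarrow> _" ..

interpretation PP: vector_space_pair "pscale :: 'k::field \<Rightarrow> _" "pscale :: 'k::field \<Rightarrow> _" ..
interpretation PP3: vector_space_pair "pscale :: 'k::field \<Rightarrow> _" "pscale3 :: 'k::field \<Rightarrow> _" ..
interpretation P3P: vector_space_pair "pscale3 :: 'k::field \<Rightarrow> _" "pscale :: 'k::field \<Rightarrow> _" ..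
interpretation P33: vector_space_pair "pscale3 :: 'k::field \<Rightarrow> _" "pscale3 :: 'k::field \<Rightarrow> _" ..

abbreviation forms :: "int \<Rightarrow> 'k::field poly3 set" where
  "forms d \<equiv> {f. form d f}"

lemma subspace_forms [simp]: "P.subspace (forms d)"
  by (auto simp: P.subspace_def pscale_def intro: form_add form_const_mult)

definition monomials :: "nat \<Rightarrow> (3 \<Rightarrow>\<^sub>0 nat) set" where
  "monomials d = {m. mdeg m = d}"

lemma univ_3: "(UNIV :: 3 set) = {0, 1, 2}"
  using exhaust3 by auto

lemma mdeg_explicit: "mdeg m = lookup m 0 + lookup m 1 + lookup m 2"
  unfolding mdeg_def univ_3 by (simp add: add.assoc)

lemma monomials_card: "finite (monomials d) \<and> 2 * card (monomials d) = (d + 1) * (d + 2)"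
proof -
  define mk :: "nat \<times> nat \<Rightarrow> 3 \<Rightarrow>\<^sub>0 nat" where
    "mk = (\<lambda>(i, j). single 0 i + single 1 j + single 2 (d - i - j))"
  have lk: "lookup (mk (i, j)) 0 = i" "lookup (mk (i, j)) 1 = j"
    "lookup (mk (i, j)) 2 = d - i - j" for i j
    by (simp_all add: mk_def lookup_add lookup_single when_def)
  let ?I = "SIGMA i:{..d}. {..d - i}"
  have "monomials d = mk ` ?I"
  proof (intro Set.set_eqI iffI)
    fix m assume "m \<in> monomials d"
    then have d: "lookup m 0 + lookup m 1 + lookup m 2 = d"
      by (simp add: monomials_def mdeg_explicit)
    have "m = mk (lookup m 0, lookup m 1)"
    proof (rule poly_mapping_eqI)
      fix k :: 3
      show "lookup m k = lookup (mk (lookup m 0, lookup m 1)) k"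
        using exhaust3[of k] d lk by auto
    qed
    then show "m \<in> mk ` ?I" using d by (auto intro!: image_eqI)
  next
    fix m assume "m \<in> mk ` ?I"
    then show "m \<in> monomials d" by (auto simp: monomials_def mdeg_explicit lk)
  qed
  moreover have "inj_on mk ?I" by (auto intro!: inj_onI) (metis lk)+
  ultimately have "card (monomials d) = card ?I" "finite (monomials d)" by (auto simp: card_image)
  moreover have "card ?I = (\<Sum>i\<le>d. d - i + 1)" by simp
  moreover have "(\<Sum>i\<le>d. d - i + 1) = (\<Sum>i\<le>d. i + 1)"
    by (rule sum.reindex_bij_witness[of _ "\<lambda>i. d - i" "\<lambda>i. d - i"]) auto
  moreover have "2 * (\<Sum>i\<le>d. i + 1) = (d + 1) * (d + 2)" by (induction d) auto
  ultimately show ?thesis by simp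
qed

lemma forms_basis:
  fixes d :: nat
  shows "fin_span pscale (forms (int d) :: 'k::field poly3 set) \<and>
    P.dim (forms (int d) :: 'k poly3 set) = card (monomials d)"
proof -
  let ?s = "\<lambda>m. single m (1::'k)"
  let ?B = "?s ` monomials d"
  have sc: "pscale c (single m x) = single m (c * x)" for c x :: 'k and m
    by (simp add: pscale_def const_def mult_single)
  have inj: "inj_on ?s (monomials d)"
    by (rule inj_onI) (metis lookup_single_eq lookup_single_not_eq one_neq_zero)
  have fin: "finite ?B" using monomials_card by simp
  have ind: "P.independent ?B"
  proof (rule P.independent_if_scalars_zero[OF fin])
    fix u x assume u: "(\<Sum>x\<in>?B. pscale (u x) x) = 0" and x: "x \<in> ?B"
    then obtain m where m: "m \<in> monomials d" "x = ?s m" by blast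
    have "(\<Sum>x\<in>?B. pscale (u x) x) = (\<Sum>m\<in>monomials d. single m (u (?s m)))"
      by (simp add: sum.reindex[OF inj] sc)
    then have "lookup (\<Sum>m\<in>monomials d. single m (u (?s m))) m = 0" using u by simp
    then show "u x = 0" using m monomials_card[of d] by (simp add: lookup_sum lookup_single when_def)
  qed
  have "forms (int d) \<subseteq> P.span ?B"
  proof
    fix f :: "'k poly3" assume "f \<in> forms (int d)"
    then have "keys f \<subseteq> monomials d" by (auto simp: form_def monomials_def)
    then have "(\<Sum>m\<in>keys f. pscale (lookup f m) (?s m)) \<in> P.span ?B"
      by (intro P.span_sum P.span_scale P.span_base) auto
    then show "f \<in> P.span ?B" using sum_of_singles[of f] by (simp add: sc)
  qed
  moreover have "?B \<subseteq> forms (int d)" by (auto simp: monomials_def intro: form_single)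
  ultimately show ?thesis
    using P.basis_card_eq_dim[of ?B "forms (int d)"] ind fin inj
    by (auto simp: fin_span_def card_image)
qed

lemma forms_neg: "d < 0 \<Longrightarrow> forms d = {0}"
  using form_neg by fastforce

lemma fin_span_forms [simp]: "fin_span pscale (forms d :: 'k::field poly3 set)"
proof (cases "d < 0")
  case True
  then show ?thesis by (auto simp: forms_neg fin_span_def intro: exI[of _ "{}"])
next
  case False
  then show ?thesis using forms_basis[where 'k='k, of "nat d"] by simp
qed

text \<open>For \<open>d = -1\<close> and \<open>d = -2\<close> both sides vanish; the range in which the polynomial is the dimension thus
  starts at \<open>-2\<close>.\<close>

lemma dim_forms: "d \<ge> -2 \<Longrightarrow> 2 * int (P.dim (forms d :: 'k::field poly3 set)) = (d + 1) * (d + 2)"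
proof (cases "d < 0")
  case True
  assume "d \<ge> -2"
  with True have "d = -1 \<or> d = -2" by auto
  then have "(d + 1) * (d + 2) = 0" by auto
  moreover have "P.dim (forms d :: 'k poly3 set) = 0"
    using P.dim_eq_0_iff_span[OF fin_span_forms] forms_neg[OF True] by blast
  ultimately show ?thesis by presburger
next
  case False
  then obtain n where d: "d = int n" by (metis nat_0_le linorder_not_less)
  have "int (2 * card (monomials n)) = int ((n + 1) * (n + 2))"
    using monomials_card[of n] by (simp only:)
  moreover have "P.dim (forms d :: 'k poly3 set) = card (monomials n)"
    using forms_basis[where 'k='k, of n] d by simp
  ultimately show ?thesis by (simp add: d algebra_simps)
qed

lemma dim_product3:
  fixes X Y Z :: "'k::field poly3 set"
  assumes X: "P.subspace X" "fin_span pscale X" and Y: "P.subspace Y" "fin_span pscale Y"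
    and Z: "P.subspace Z" "fin_span pscale Z"
  shows "P3.dim (X \<times> Y \<times> Z) = P.dim X + P.dim Y + P.dim Z \<and> fin_span pscale3 (X \<times> Y \<times> Z)
    \<and> P3.subspace (X \<times> Y \<times> Z)"
proof -
  have sub: "P3.subspace (X \<times> Y \<times> Z)"
    using X Y Z by (auto simp: P3.subspace_def P.subspace_def pscale3_def zero_prod_def)
  have sub1: "P3.subspace ({0::'k poly3} \<times> Y \<times> Z)" and sub2: "P3.subspace ({0} \<times> {0} \<times> Z)"
    using X Y Z by (auto simp: P3.subspace_def P.subspace_def pscale3_def zero_prod_def)
  let ?f = "\<lambda>A. (A, 0, 0)" and ?g = "\<lambda>B. (0, B, 0)" and ?h = "\<lambda>C. (0, 0, C)"
  have f: "fin_span pscale3 (?f ` X)" 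
    by (rule conjunct2[OF PP3.rank_nullity_on[OF X]]) (auto simp: pscale3_def)
  have g: "fin_span pscale3 (?g ` Y)"
    by (rule conjunct2[OF PP3.rank_nullity_on[OF Y]]) (auto simp: pscale3_def)
  have h: "P3.dim (?h ` Z) = P.dim Z \<and> fin_span pscale3 (?h ` Z)"
    by (rule PP3.dim_injective_image[OF Z]) (auto simp: pscale3_def zero_prod_def)
  have "X \<times> Y \<times> Z \<subseteq> {x + y | x y. x \<in> ?f ` X \<and> y \<in> {x + y | x y. x \<in> ?g ` Y \<and> y \<in> ?h ` Z}}"
  proof
    fix t assume "t \<in> X \<times> Y \<times> Z"
    then obtain A B C where t: "t = (A, B, C)" "A \<in> X" "B \<in> Y" "C \<in> Z" by auto
    then have "t = ?f A + (?g B + ?h C)" by simp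
    then show "t \<in> {x + y | x y. x \<in> ?f ` X \<and> y \<in> {x + y | x y. x \<in> ?g ` Y \<and> y \<in> ?h ` Z}}"
      using t by blast
  qed
  then have fin: "fin_span pscale3 (X \<times> Y \<times> Z)"
    using P3.fin_span_mono[OF P3.fin_span_sums[OF f P3.fin_span_sums[OF g]]] h by blast
  have 0: "0 \<in> X" "0 \<in> Y" "0 \<in> Z" using X Y Z P.subspace_0 by blast+
  have fin1: "fin_span pscale3 ({0::'k poly3} \<times> Y \<times> Z)"
    using P3.fin_span_mono[OF fin, of "{0::'k poly3} \<times> Y \<times> Z"] 0 by auto
  have "P3.dim (X \<times> Y \<times> Z) = P.dim (fst ` (X \<times> Y \<times> Z)) + P3.dim {t \<in> X \<times> Y \<times> Z. fst t = 0}"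
    by (rule conjunct1[OF P3P.rank_nullity_on[OF sub fin]]) (auto simp: pscale3_def)
  also have "fst ` (X \<times> Y \<times> Z) = X" using 0 by force
  also have "{t \<in> X \<times> Y \<times> Z. fst t = 0} = {0::'k poly3} \<times> Y \<times> Z" using 0 by auto
  also have "P3.dim ({0::'k poly3} \<times> Y \<times> Z) = P.dim ((\<lambda>t. fst (snd t)) ` ({0::'k poly3} \<times> Y \<times> Z)) +
      P3.dim {t \<in> {0::'k poly3} \<times> Y \<times> Z. fst (snd t) = 0}"
    by (rule conjunct1[OF P3P.rank_nullity_on[OF sub1 fin1, where f = "\<lambda>t. fst (snd t)"]])
      (auto simp: pscale3_def)
  also have "(\<lambda>t. fst (snd t)) ` ({0::'k poly3} \<times> Y \<times> Z) = Y" using 0 by force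
  also have "{t \<in> {0::'k poly3} \<times> Y \<times> Z. fst (snd t) = 0} = ?h ` Z" using 0 by force
  finally show ?thesis using h sub fin by simp
qed

section \<open>Three forms and their syzygies\<close>

locale form_triple =
  fixes F1 F2 F3 :: "'k::field poly3" and d1 d2 d3 :: int
  assumes form_F: "form d1 F1" "form d2 F2" "form d3 F3"
begin

text \<open>All spaces are indexed by total degree: a triple of coefficients in degree \<open>n\<close> has entries of
  degrees \<open>n - d1\<close>, \<open>n - d2\<close>, \<open>n - d3\<close>, so that the combination it defines has degree \<open>n\<close>.\<close>

definition J :: "int \<Rightarrow> 'k poly3 set" where
  "J n = {A * F1 + B * F2 + C * F3 | A B C. form (n - d1) A \<and> form (n - d2) B \<and> form (n - d3) C}"

definition coeffs3 :: "int \<Rightarrow> ('k poly3 \<times> 'k poly3 \<times> 'k poly3) set" where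
  "coeffs3 n = forms (n - d1) \<times> forms (n - d2) \<times> forms (n - d3)"

definition Syz :: "int \<Rightarrow> ('k poly3 \<times> 'k poly3 \<times> 'k poly3) set" where
  "Syz n = {(A, B, C). form (n - d1) A \<and> form (n - d2) B \<and> form (n - d3) C \<and>
     A * F1 + B * F2 + C * F3 = 0}"

lemma J_forms: "J n \<subseteq> forms n"
proof -
  have "form n (A * F1 + B * F2 + C * F3)"
    if "form (n - d1) A" "form (n - d2) B" "form (n - d3) C" for A B C
    using form_mult[OF that(1) form_F(1)] form_mult[OF that(2) form_F(2)] form_mult[OF that(3) form_F(3)]
    by (auto intro!: form_add)
  then show ?thesis by (auto simp: J_def)
qed

lemma J_mult:
  assumes "f \<in> J n" "form m g" shows "g * f \<in> J (m + n)"
proof -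
  obtain A B C where f: "f = A * F1 + B * F2 + C * F3" and
    "form (n - d1) A" "form (n - d2) B" "form (n - d3) C"
    using assms(1) by (auto simp: J_def)
  then have "form (m + n - d1) (g * A)" "form (m + n - d2) (g * B)" "form (m + n - d3) (g * C)"
    using form_mult[OF assms(2)] by (metis add_diff_eq)+
  moreover have "g * f = (g * A) * F1 + (g * B) * F2 + (g * C) * F3"
    by (simp add: f algebra_simps)
  ultimately show ?thesis unfolding J_def by blast
qed

lemma subspace_J [simp]: "P.subspace (J n)"
  unfolding P.subspace_def
proof (intro conjI ballI allI)
  show "0 \<in> J n" unfolding J_def by (rule CollectI, intro exI[of _ 0]) auto
next
  fix f g assume "f \<in> J n" "g \<in> J n"
  then obtain A B C A' B' C' where f: "f = A * F1 + B * F2 + C * F3" "form (n - d1) A" "form (n - d2) B" "form (n - d3) C"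
    and g: "g = A' * F1 + B' * F2 + C' * F3" "form (n - d1) A'" "form (n - d2) B'" "form (n - d3) C'"
    by (auto simp: J_def)
  have "f + g = (A + A') * F1 + (B + B') * F2 + (C + C') * F3"
    by (simp add: f g algebra_simps)
  then show "f + g \<in> J n" using f g form_add unfolding J_def by blast
next
  fix c f assume "f \<in> J n"
  then show "pscale c f \<in> J n" using J_mult[of f n 0 "const c"] by (simp add: pscale_def)
qed

lemma dim_J_le: "P.dim (J n) \<le> P.dim (forms n :: 'k poly3 set)"
  using P.dim_mono_span[OF fin_span_forms J_forms] .

lemma coeffs3_dim:
  "P3.dim (coeffs3 n) = P.dim (forms (n - d1) :: 'k poly3 set) + P.dim (forms (n - d2) :: 'k poly3 set)
     + P.dim (forms (n - d3) :: 'k poly3 set)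
   \<and> fin_span pscale3 (coeffs3 n) \<and> P3.subspace (coeffs3 n)"
  unfolding coeffs3_def by (rule dim_product3) auto

lemma Syz_coeffs3: "Syz n = {t \<in> coeffs3 n. (case t of (A, B, C) \<Rightarrow> A * F1 + B * F2 + C * F3) = 0}"
  by (auto simp: Syz_def coeffs3_def)

lemma fin_span_Syz: "fin_span pscale3 (Syz n)"
  using P3.fin_span_mono[of "coeffs3 n" "Syz n"] coeffs3_dim Syz_coeffs3 by blast

text \<open>\<open>J n\<close> is the image and \<open>Syz n\<close> the kernel of \<open>(A, B, C) \<mapsto> A * F1 + B * F2 + C * F3\<close>.\<close>

lemma dim_J_Syz:
  "P.dim (J n) + P3.dim (Syz n) = P.dim (forms (n - d1) :: 'k poly3 set)
     + P.dim (forms (n - d2) :: 'k poly3 set) + P.dim (forms (n - d3) :: 'k poly3 set)"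
proof -
  let ?f = "\<lambda>t. case t of (A, B, C) \<Rightarrow> A * F1 + B * F2 + C * F3"
  have "P3.dim (coeffs3 n) = P.dim (?f ` coeffs3 n) + P3.dim {t \<in> coeffs3 n. ?f t = 0}"
    using coeffs3_dim[of n]
    by (intro conjunct1[OF P3P.rank_nullity_on]) (auto simp: pscale3_def pscale_def algebra_simps)
  also have "?f ` coeffs3 n = J n"
    by (force simp: J_def coeffs3_def)
  also have "{t \<in> coeffs3 n. ?f t = 0} = Syz n" by (simp add: Syz_coeffs3)
  finally show ?thesis using coeffs3_dim[of n] by simp
qed

lemma subspace_Syz: "P3.subspace (Syz n)"
  unfolding P3.subspace_def
proof (intro conjI ballI allI)
  show "0 \<in> Syz n" by (simp add: Syz_def zero_prod_def)
next
  fix s t assume "s \<in> Syz n" "t \<in> Syz n"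
  then obtain A B C A' B' C' where s: "s = (A, B, C)" "form (n - d1) A" "form (n - d2) B"
      "form (n - d3) C" "A * F1 + B * F2 + C * F3 = 0"
    and t: "t = (A', B', C')" "form (n - d1) A'" "form (n - d2) B'" "form (n - d3) C'"
      "A' * F1 + B' * F2 + C' * F3 = 0"
    by (auto simp: Syz_def)
  have "(A + A') * F1 + (B + B') * F2 + (C + C') * F3 = 0"
    using s(5) t(5) by Groebner_Basis.algebra
  then show "s + t \<in> Syz n" using s t by (simp add: Syz_def form_add)
next
  fix c t assume "t \<in> Syz n"
  then obtain A B C where t: "t = (A, B, C)" "form (n - d1) A" "form (n - d2) B" "form (n - d3) C"
      "A * F1 + B * F2 + C * F3 = 0"
    by (auto simp: Syz_def)
  have "const c * A * F1 + const c * B * F2 + const c * C * F3 = 0"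
    using t(5) by Groebner_Basis.algebra
  then show "pscale3 c t \<in> Syz n"
    using t by (simp add: Syz_def pscale3_def pscale_def form_const_mult)
qed

end

text \<open>The conditions on \<open>F = (F1, F2, F3)\<close> and \<open>s = (u, v, w)\<close> are symmetric: \<open>F\<close> is a syzygy of \<open>s\<close> of the same
  total degree \<open>e\<close>. Facts about the ideal generated by the entries of \<open>s\<close> are obtained by exchanging the two.\<close>

locale syz_triple = form_triple F1 F2 F3 d1 d2 d3
  for F1 F2 F3 :: "'k::field poly3" and d1 d2 d3 :: int +
  fixes u v w :: "'k::field poly3" and e :: int
  assumes form_s: "form (e - d1) u" "form (e - d2) v" "form (e - d3) w"
    and rel: "u * F1 + v * F2 + w * F3 = 0"
    and prim_F: "primitive3 F1 F2 F3" and prim_s: "primitive3 u v w"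
begin

definition sigma :: int where "sigma = d1 + d2 + d3"

text \<open>The equation \<open>s \<times> (A, B, C) = g F\<close>.\<close>

definition cross_eq :: "'k poly3 \<Rightarrow> 'k poly3 \<Rightarrow> 'k poly3 \<Rightarrow> 'k poly3 \<Rightarrow> bool" where
  "cross_eq A B C g \<longleftrightarrow> v * C - w * B = g * F1 \<and> w * A - u * C = g * F2 \<and> u * B - v * A = g * F3"

text \<open>Regarded as a section of a twist of the syzygy bundle, \<open>s\<close> vanishes on a finite scheme \<open>Z\<close>; \<open>K\<close> is the
  homogeneous ideal of \<open>Z\<close>.\<close>

definition K :: "int \<Rightarrow> 'k poly3 set" where
  "K m = {g. form m g \<and> (\<exists>A B C. (A, B, C) \<in> Syz (m + sigma - e) \<and> cross_eq A B C g)}"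

lemma dual: "syz_triple u v w (e - d1) (e - d2) (e - d3) F1 F2 F3 e"
  using form_F form_s rel prim_F prim_s
  by unfold_locales (auto simp: mult.commute)

lemma F_nonzero: "F1 \<noteq> 0 \<or> F2 \<noteq> 0 \<or> F3 \<noteq> 0"
  using prim_F unfolding primitive3_def by (metis dvd_0_left_iff dvd_0_right zero_neq_one)

lemma s_nonzero: "u \<noteq> 0 \<or> v \<noteq> 0 \<or> w \<noteq> 0"
  using prim_s unfolding primitive3_def by (metis dvd_0_left_iff dvd_0_right zero_neq_one)

lemma cross_eq_unique: "cross_eq A B C g \<Longrightarrow> cross_eq A B C h \<Longrightarrow> g = h"
  using F_nonzero by (auto simp: cross_eq_def)

text \<open>Both \<open>s\<close> and a further syzygy are orthogonal to \<open>F\<close>, so their cross product is parallel to \<open>F\<close>, and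
  \<open>F\<close> has no common factor.\<close>

lemma cross_eq_exists:
  assumes "(A, B, C) \<in> Syz n"
  shows "\<exists>g. form (n + e - sigma) g \<and> cross_eq A B C g"
proof -
  have S: "form (n - d1) A" "form (n - d2) B" "form (n - d3) C" "A * F1 + B * F2 + C * F3 = 0"
    using assms by (auto simp: Syz_def)
  have "(v * C - w * B) * F2 = (w * A - u * C) * F1"
    "(v * C - w * B) * F3 = (u * B - v * A) * F1"
    "(w * A - u * C) * F3 = (u * B - v * A) * F2"
    using S(4) rel by Groebner_Basis.algebra+
  from primitive3_parallel[OF prim_F this] obtain g where g: "cross_eq A B C g"
    by (auto simp: cross_eq_def)
  have "form (n + e - sigma + d1) (v * C - w * B)"
    "form (n + e - sigma + d2) (w * A - u * C)" "form (n + e - sigma + d3) (u * B - v * A)"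
    using form_mult[OF form_s(2) S(3)] form_mult[OF form_s(3) S(2)]
      form_mult[OF form_s(3) S(1)] form_mult[OF form_s(1) S(3)]
      form_mult[OF form_s(1) S(2)] form_mult[OF form_s(2) S(1)]
    by (auto intro!: form_diff simp: sigma_def algebra_simps)
  then have "form (n + e - sigma + d1) (F1 * g)" "form (n + e - sigma + d2) (F2 * g)"
    "form (n + e - sigma + d3) (F3 * g)"
    using g by (auto simp: cross_eq_def mult.commute)
  then have "form (n + e - sigma) g"
    using F_nonzero form_F form_quotient[of _ F1 g d1] form_quotient[of _ F2 g d2]
      form_quotient[of _ F3 g d3] by (metis add_diff_cancel_right')
  then show ?thesis using g by blast
qed

lemma cross_eq_add: "cross_eq A B C g \<Longrightarrow> cross_eq A' B' C' g' \<Longrightarrow> cross_eq (A + A') (B + B') (C + C') (g + g')"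
  unfolding cross_eq_def by (auto simp: algebra_simps)

lemma cross_eq_mult: "cross_eq A B C g \<Longrightarrow> cross_eq (q * A) (q * B) (q * C) (q * g)"
  unfolding cross_eq_def by Groebner_Basis.algebra

lemma cross_eq_0: "cross_eq A B C 0 \<Longrightarrow> \<exists>q. A = q * u \<and> B = q * v \<and> C = q * w"
  using primitive3_parallel[OF prim_s, of A B C] by (auto simp: cross_eq_def algebra_simps)

lemma Syz_mult: "(A, B, C) \<in> Syz n \<Longrightarrow> form m q \<Longrightarrow> (q * A, q * B, q * C) \<in> Syz (m + n)"
proof -
  assume S: "(A, B, C) \<in> Syz n" and q: "form m q"
  have "q * A * F1 + q * B * F2 + q * C * F3 = q * (A * F1 + B * F2 + C * F3)"
    by (simp add: algebra_simps)
  then show ?thesis using S form_mult[OF q]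
    by (auto simp: Syz_def simp flip: add_diff_eq)
qed

lemma s_Syz: "(u, v, w) \<in> Syz e"
  using form_s rel by (simp add: Syz_def)

text \<open>The map \<open>s' \<mapsto> g\<close> with \<open>s \<times> s' = g F\<close> has image \<open>K\<close>. Its kernel consists of the triples parallel to \<open>s\<close>,
  which are multiples of \<open>s\<close> as \<open>s\<close> has no common factor.\<close>

lemma dim_Syz:
  "P3.dim (Syz n) = P.dim (forms (n - e) :: 'k poly3 set) + P.dim (K (n + e - sigma))"
proof -
  define G where "G t = (case t of (A, B, C) \<Rightarrow> SOME g. cross_eq A B C g)" for t
  have G: "cross_eq A B C (G (A, B, C))" if "(A, B, C) \<in> Syz n" for A B C
    unfolding G_def prod.case using cross_eq_exists[OF that] by (metis someI_ex)
  have Guniq: "G (A, B, C) = g" if "(A, B, C) \<in> Syz n" "cross_eq A B C g" for A B C g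
    using G that cross_eq_unique by blast
  have GS: "G t = g \<longleftrightarrow> cross_eq (fst t) (fst (snd t)) (snd (snd t)) g" if "t \<in> Syz n" for t g
    using that G Guniq by (cases t) auto
  have "P3.dim (Syz n) = P.dim (G ` Syz n) + P3.dim {t \<in> Syz n. G t = 0}"
  proof (rule conjunct1[OF P3P.rank_nullity_on[OF subspace_Syz fin_span_Syz]])
    fix s t assume st: "s \<in> Syz n" "t \<in> Syz n"
    then have "s + t \<in> Syz n" using subspace_Syz P3.subspace_add by blast
    moreover have "cross_eq (fst (s + t)) (fst (snd (s + t))) (snd (snd (s + t))) (G s + G t)"
      using st GS[of s "G s"] GS[of t "G t"] by (auto intro: cross_eq_add)
    ultimately show "G (s + t) = G s + G t" using GS by blast
  next
    fix c t assume t: "t \<in> Syz n"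
    then have "pscale3 c t \<in> Syz n" using subspace_Syz P3.subspace_scale by blast
    moreover have "cross_eq (fst (pscale3 c t)) (fst (snd (pscale3 c t))) (snd (snd (pscale3 c t))) (pscale c (G t))"
      using t GS[of t "G t"] by (cases t) (auto simp: pscale3_def pscale_def intro: cross_eq_mult)
    ultimately show "G (pscale3 c t) = pscale c (G t)" using GS by blast
  qed
  also have "G ` Syz n = K (n + e - sigma)"
  proof -
    have n: "n + e - sigma + sigma - e = n" by simp
    show ?thesis
    proof (intro Set.set_eqI iffI)
      fix g assume "g \<in> G ` Syz n"
      then obtain A B C where t: "(A, B, C) \<in> Syz n" "g = G (A, B, C)" by auto
      then have "form (n + e - sigma) g" using cross_eq_exists[OF t(1)] Guniq by blast
      then show "g \<in> K (n + e - sigma)" using t G unfolding K_def n by blast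
    next
      fix g assume "g \<in> K (n + e - sigma)"
      then obtain A B C where "(A, B, C) \<in> Syz n" "cross_eq A B C g" unfolding K_def n by blast
      then show "g \<in> G ` Syz n" using Guniq by (metis imageI)
    qed
  qed
  also have "{t \<in> Syz n. G t = 0} = (\<lambda>q. (q * u, q * v, q * w)) ` forms (n - e)"
  proof (intro Set.set_eqI iffI)
    fix t assume "t \<in> {t \<in> Syz n. G t = 0}"
    then obtain A B C where t: "t = (A, B, C)" "(A, B, C) \<in> Syz n" "cross_eq A B C 0"
      using G by (cases t) force
    obtain q where q: "A = q * u" "B = q * v" "C = q * w" using cross_eq_0[OF t(3)] by blast
    have "form (n - d1) (u * q)" "form (n - d2) (v * q)" "form (n - d3) (w * q)"
      using t q by (auto simp: Syz_def mult.commute)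
    then have "form (n - e) q"
      using s_nonzero form_s form_quotient[of "n - d1" u q "e - d1"] form_quotient[of "n - d2" v q "e - d2"]
        form_quotient[of "n - d3" w q "e - d3"] by auto
    then show "t \<in> (\<lambda>q. (q * u, q * v, q * w)) ` forms (n - e)" using t q by auto
  next
    fix t assume "t \<in> (\<lambda>q. (q * u, q * v, q * w)) ` forms (n - e)"
    then obtain q where q: "form (n - e) q" "t = (q * u, q * v, q * w)" by auto
    have "t \<in> Syz n" using Syz_mult[OF s_Syz q(1)] q by simp
    moreover have "cross_eq (q * u) (q * v) (q * w) 0" by (simp add: cross_eq_def algebra_simps)
    ultimately show "t \<in> {t \<in> Syz n. G t = 0}" using q Guniq by auto
  qed
  also have "P3.dim ((\<lambda>q. (q * u, q * v, q * w)) ` forms (n - e)) = P.dim (forms (n - e) :: 'k poly3 set)"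
    by (rule conjunct1[OF PP3.dim_injective_image])
      (use s_nonzero in \<open>auto simp: pscale3_def pscale_def algebra_simps zero_prod_def\<close>)
  finally show ?thesis by simp
qed

lemma K_forms: "K m \<subseteq> forms m"
  by (auto simp: K_def)

lemma K_mult:
  assumes "g \<in> K m" "form n q" shows "q * g \<in> K (n + m)"
proof -
  obtain A B C where A: "(A, B, C) \<in> Syz (m + sigma - e)" "cross_eq A B C g" "form m g"
    using assms by (auto simp: K_def)
  have "(q * A, q * B, q * C) \<in> Syz (n + m + sigma - e)"
    using Syz_mult[OF A(1) assms(2)] by (simp add: algebra_simps)
  then show ?thesis using A form_mult[OF assms(2) A(3)] cross_eq_mult
    unfolding K_def by blast
qed

lemma subspace_K [simp]: "P.subspace (K m)"
  unfolding P.subspace_def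
proof (intro conjI ballI allI)
  have "(0, 0, 0) \<in> Syz (m + sigma - e)" "cross_eq 0 0 0 0" by (auto simp: Syz_def cross_eq_def)
  then show "0 \<in> K m" by (auto simp: K_def)
next
  fix g h assume "g \<in> K m" "h \<in> K m"
  then obtain A B C A' B' C' where
    A: "(A, B, C) \<in> Syz (m + sigma - e)" "cross_eq A B C g" "form m g" and
    A': "(A', B', C') \<in> Syz (m + sigma - e)" "cross_eq A' B' C' h" "form m h"
    by (auto simp: K_def)
  have "(A + A', B + B', C + C') \<in> Syz (m + sigma - e)"
    using P3.subspace_add[OF subspace_Syz A(1) A'(1)] by simp
  then show "g + h \<in> K m" using cross_eq_add[OF A(2) A'(2)] form_add[OF A(3) A'(3)]
    unfolding K_def by blast
next
  fix c g assume "g \<in> K m"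
  then show "pscale c g \<in> K m" using K_mult[of g m 0 "const c"] by (simp add: pscale_def)
qed

lemma fin_span_K [simp]: "fin_span pscale (K m)"
  using P.fin_span_mono[OF fin_span_forms K_forms] .

lemma dim_K_le: "P.dim (K m) \<le> P.dim (forms m :: 'k poly3 set)"
  using P.dim_mono_span[OF fin_span_forms K_forms] .

text \<open>In large degrees the codimension of \<open>K\<close> is the degree of \<open>Z\<close>, a second Chern class. The two rank formulas express
  the sum through dimensions of spaces of forms, that is, through quadratic polynomials in \<open>n\<close>, whose
  nonconstant terms cancel.\<close>

lemma codim_J_plus_codim_K:
  assumes n: "n \<ge> -2" "n - d1 \<ge> -2" "n - d2 \<ge> -2" "n - d3 \<ge> -2" "n - e \<ge> -2" "n + e - sigma \<ge> -2"
  shows "(int (P.dim (forms n :: 'k poly3 set)) - int (P.dim (J n))) +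
     (int (P.dim (forms (n + e - sigma) :: 'k poly3 set)) - int (P.dim (K (n + e - sigma))))
     = e\<^sup>2 - e * sigma + d1 * d2 + d1 * d3 + d2 * d3"
proof -
  let ?h = "\<lambda>m. int (P.dim (forms m :: 'k poly3 set))"
  have "int (P.dim (J n)) = ?h (n - d1) + ?h (n - d2) + ?h (n - d3) - int (P3.dim (Syz n))"
    using dim_J_Syz[of n] by linarith
  moreover have "int (P3.dim (Syz n)) = ?h (n - e) + int (P.dim (K (n + e - sigma)))"
    using dim_Syz[of n] by simp
  ultimately have "2 * ((?h n - int (P.dim (J n))) + (?h (n + e - sigma) - int (P.dim (K (n + e - sigma)))))
    = 2 * ?h n - 2 * ?h (n - d1) - 2 * ?h (n - d2) - 2 * ?h (n - d3) + 2 * ?h (n - e) + 2 * ?h (n + e - sigma)"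
    by simp
  also have "\<dots> = 2 * (e\<^sup>2 - e * sigma + d1 * d2 + d1 * d3 + d2 * d3)"
    by (simp only: dim_forms[OF n(1)] dim_forms[OF n(2)] dim_forms[OF n(3)] dim_forms[OF n(4)]
        dim_forms[OF n(5)] dim_forms[OF n(6)]) (simp add: sigma_def power2_eq_square algebra_simps)
  finally show ?thesis by simp
qed

text \<open>The Koszul syzygies \<open>F \<times> e\<^sub>i\<close> satisfy \<open>s \<times> (F \<times> e\<^sub>i) = (s \<bullet> e\<^sub>i) F\<close>, because \<open>s \<bullet> F = 0\<close>.\<close>

lemma koszul_in_K: "u \<in> K (e - d1)" "v \<in> K (e - d2)" "w \<in> K (e - d3)"
proof -
  have "(0, F3, - F2) \<in> Syz (e - d1 + sigma - e)" "(- F3, 0, F1) \<in> Syz (e - d2 + sigma - e)"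
    "(F2, - F1, 0) \<in> Syz (e - d3 + sigma - e)"
    using form_F by (auto simp: Syz_def sigma_def algebra_simps intro: form_uminus)
  moreover have "cross_eq 0 F3 (- F2) u" "cross_eq (- F3) 0 F1 v" "cross_eq F2 (- F1) 0 w"
    unfolding cross_eq_def using rel by Groebner_Basis.algebra+
  ultimately show "u \<in> K (e - d1)" "v \<in> K (e - d2)" "w \<in> K (e - d3)"
    using form_s unfolding K_def by blast+
qed

end

section \<open>Homogeneous primes\<close>

definition hom_ideal :: "'k::field poly3 set \<Rightarrow> bool" where
  "hom_ideal A \<longleftrightarrow> 0 \<in> A \<and> (\<forall>f\<in>A. \<forall>g\<in>A. f + g \<in> A) \<and> (\<forall>f. \<forall>g\<in>A. f * g \<in> A) \<and>
     (\<forall>f\<in>A. \<forall>d. hom_part d f \<in> A)"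

lemma hom_ideal_sum: "hom_ideal A \<Longrightarrow> (\<And>i. i \<in> I \<Longrightarrow> f i \<in> A) \<Longrightarrow> (\<Sum>i\<in>I. f i) \<in> A"
  by (induction I rule: infinite_finite_induct) (auto simp: hom_ideal_def)

lemma hom_ideal_minus: "hom_ideal A \<Longrightarrow> f \<in> A \<Longrightarrow> g \<in> A \<Longrightarrow> f - g \<in> A"
proof -
  assume A: "hom_ideal A" "f \<in> A" "g \<in> A"
  then have "- 1 * g \<in> A" unfolding hom_ideal_def by blast
  then have "f + - 1 * g \<in> A" using A unfolding hom_ideal_def by blast
  then show ?thesis by simp
qed

lemma proj_prime_hom_ideal: "proj_prime p \<Longrightarrow> hom_ideal p"
  by (simp add: proj_prime_def hom_ideal_def)

lemma prime_add: "proj_prime p \<Longrightarrow> f \<in> p \<Longrightarrow> g \<in> p \<Longrightarrow> f + g \<in> p"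
  and prime_multL: "proj_prime p \<Longrightarrow> g \<in> p \<Longrightarrow> f * g \<in> p"
  and prime_zero: "proj_prime p \<Longrightarrow> 0 \<in> p"
  and prime_one: "proj_prime p \<Longrightarrow> 1 \<notin> p"
  and prime_cases: "proj_prime p \<Longrightarrow> f * g \<in> p \<Longrightarrow> f \<in> p \<or> g \<in> p"
  and prime_var: "proj_prime p \<Longrightarrow> \<exists>i. var i \<notin> p"
  by (auto simp: proj_prime_def)

lemma prime_multR: "proj_prime p \<Longrightarrow> f \<in> p \<Longrightarrow> f * g \<in> p"
  by (metis prime_multL mult.commute)

lemma prime_diff: "proj_prime p \<Longrightarrow> f \<in> p \<Longrightarrow> g \<in> p \<Longrightarrow> f - g \<in> p"
  using hom_ideal_minus proj_prime_hom_ideal by blast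

lemma prime_power: "proj_prime p \<Longrightarrow> f \<notin> p \<Longrightarrow> f ^ n \<notin> p"
  by (induction n) (auto dest: prime_one prime_cases)

lemma prime_prod:
  assumes "proj_prime p" "finite I" "\<And>i. i \<in> I \<Longrightarrow> f i \<notin> p"
  shows "(\<Prod>i\<in>I. f i) \<notin> p"
  using assms(2,3) by (induction I rule: finite_induct) (use prime_one[OF assms(1)] prime_cases[OF assms(1)] in auto)

lemma prime_const: "proj_prime p \<Longrightarrow> const c * f \<in> p \<Longrightarrow> c \<noteq> 0 \<Longrightarrow> f \<in> p"
proof -
  assume p: "proj_prime p" "const c * f \<in> p" "c \<noteq> 0"
  then have "const (inverse c) * (const c * f) \<in> p" using prime_multL by blast
  then show ?thesis using p(3) by (simp flip: mult.assoc const_mult)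
qed

lemma var_power: "var i ^ n = (single (single i n) 1 :: 'k::field poly3)"
  by (induction n) (auto simp: var_def mult_single simp flip: single_add)

lemma single_split:
  assumes "lookup m i \<ge> n"
  shows "\<exists>g. single m (c::'k::field) = g * var i ^ n"
proof -
  have "m = (m - single i n) + single i n"
    using assms by (intro poly_mapping_eqI) (auto simp: lookup_add lookup_minus lookup_single when_def)
  then show ?thesis unfolding var_power
    by (intro exI[of _ "single (m - single i n) c"]) (simp add: mult_single)
qed

text \<open>Pigeonhole: a monomial of degree at least \<open>3N\<close> has an exponent that is at least \<open>N\<close>.\<close>

lemma form_in_hom_ideal_of_powers:
  assumes A: "hom_ideal A" "\<And>i. var i ^ N \<in> A" and f: "form d f" "d \<ge> 3 * int N" "d > 0"
  shows "f \<in> A"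
proof -
  have "single m (lookup f m) \<in> A" if "m \<in> keys f" for m
  proof -
    have "int (mdeg m) = d" using f that by (simp add: form_def)
    then have "3 * N \<le> mdeg m" using f(2) by linarith
    then have "\<exists>i. N \<le> lookup m i"
    proof (rule contrapos_pp)
      assume "\<not> (\<exists>i. N \<le> lookup m i)"
      then have "lookup m 0 < N" "lookup m 1 < N" "lookup m 2 < N"
        by (auto simp: not_le)
      then show "\<not> 3 * N \<le> mdeg m" unfolding mdeg_explicit by linarith
    qed
    then obtain i where "N \<le> lookup m i" by blast
    then obtain g where "single m (lookup f m) = g * var i ^ N"
      using single_split by blast
    then show ?thesis using A by (simp add: hom_ideal_def)
  qed
  then show ?thesis by (subst sum_of_singles) (rule hom_ideal_sum[OF A(1)])
qed

lemma hom_ideal_add_form: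
  assumes p: "hom_ideal p" and f: "form (int d) f"
  shows "hom_ideal {a + h * f | a h. a \<in> p}"
  unfolding hom_ideal_def
proof (intro conjI ballI allI)
  show "0 \<in> {a + h * f | a h. a \<in> p}"
    using p by (intro CollectI exI[of _ 0]) (auto simp: hom_ideal_def)
next
  fix x y assume "x \<in> {a + h * f | a h. a \<in> p}" "y \<in> {a + h * f | a h. a \<in> p}"
  then obtain a h b k where "x = a + h * f" "y = b + k * f" "a \<in> p" "b \<in> p" by blast
  then show "x + y \<in> {a + h * f | a h. a \<in> p}"
    using p by (intro CollectI exI[of _ "a + b"] exI[of _ "h + k"]) (auto simp: hom_ideal_def algebra_simps)
next
  fix g x assume "x \<in> {a + h * f | a h. a \<in> p}"
  then obtain a h where "x = a + h * f" "a \<in> p" by blast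
  then have "g * x = g * a + (g * h) * f" "g * a \<in> p"
    using p by (auto simp: hom_ideal_def distrib_left mult.assoc)
  then show "g * x \<in> {a + h * f | a h. a \<in> p}" by blast
next
  fix x n assume "x \<in> {a + h * f | a h. a \<in> p}"
  then obtain a h where x: "x = a + h * f" "a \<in> p" by blast
  have "hom_part n x = hom_part n a + (if d \<le> n then hom_part (n - d) h else 0) * f"
    using hom_part_form_mult[OF f, of n h] x by (simp add: hom_part_add mult.commute)
  moreover have "hom_part n a \<in> p" using p x by (simp add: hom_ideal_def)
  ultimately show "hom_part n x \<in> {a + h * f | a h. a \<in> p}" by blast
qed

lemma subset_add_form: "p \<subseteq> {a + h * f | a h. a \<in> p}" for p :: "'a::comm_ring_1 set"
proof
  fix x assume "x \<in> p"
  then have "x = x + 0 * f \<and> x \<in> p" by simp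
  then show "x \<in> {a + h * f | a h. a \<in> p}" by blast
qed

lemma top_part_outside:
  assumes p: "hom_ideal p" and f: "f \<notin> p"
  shows "\<exists>d. hom_part d f \<notin> p \<and> (\<forall>i>d. hom_part i f \<in> p)"
proof -
  obtain N where N: "\<forall>m. lookup f m \<noteq> 0 \<longrightarrow> mdeg m \<le> N" using degree_bound by blast
  let ?D = "{d. hom_part d f \<notin> p}"
  have "hom_part d f = 0" if "d > N" for d
    using N that by (intro poly_mapping_eqI) (force simp: lookup_hom_part)
  then have "?D \<subseteq> {..N}" using p unfolding hom_ideal_def by (auto simp: not_less[symmetric])
  then have fin: "finite ?D" by (rule finite_subset) simp
  have "?D \<noteq> {}"
  proof
    assume "?D = {}"
    then have "(\<Sum>d\<le>N. hom_part d f) \<in> p" by (intro hom_ideal_sum[OF p]) auto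
    then show False using f sum_hom_parts[of f N] N by auto
  qed
  then have "Max ?D \<in> ?D" "\<forall>i>Max ?D. i \<notin> ?D"
    using Max_in[OF fin] Max_ge[OF fin] by (auto simp: not_le[symmetric])
  then show ?thesis by blast
qed

text \<open>A homogeneous ideal that is maximal among those without powers of \<open>l\<close> is prime. Given \<open>f * g\<close> in it,
  pass to the top homogeneous parts of \<open>f\<close> and \<open>g\<close> that lie outside; adjoining either of these produces
  a power of \<open>l\<close>, and so does the product of the two enlarged ideals. The positive degree of \<open>l\<close> makes the
  prime a point of the plane.\<close>

lemma homogeneous_prime_avoiding:
  assumes A: "hom_ideal A" and l: "form d l" "d > 0" and av: "\<And>n. l ^ n \<notin> A"
  shows "\<exists>p. proj_prime p \<and> A \<subseteq> p \<and> l \<notin> p"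
proof -
  let ?S = "{B. hom_ideal B \<and> A \<subseteq> B \<and> (\<forall>n. l ^ n \<notin> B)}"
  have "\<Union>C \<in> ?S" if C: "C \<noteq> {}" "subset.chain ?S C" for C
  proof -
    have CS: "C \<subseteq> ?S" and ch: "\<And>X Y. X \<in> C \<Longrightarrow> Y \<in> C \<Longrightarrow> X \<subseteq> Y \<or> Y \<subseteq> X"
      using C(2) by (auto simp: subset_chain_def)
    have "f + g \<in> \<Union>C" if "f \<in> \<Union>C" "g \<in> \<Union>C" for f g
    proof -
      obtain X Y where XY: "X \<in> C" "Y \<in> C" "f \<in> X" "g \<in> Y" using \<open>f \<in> \<Union>C\<close> \<open>g \<in> \<Union>C\<close> by blast
      then obtain Z where "Z \<in> C" "f \<in> Z" "g \<in> Z" using ch[OF XY(1,2)] by blast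
      moreover from this have "hom_ideal Z" using CS by blast
      ultimately have "f + g \<in> Z" by (simp add: hom_ideal_def)
      then show ?thesis using \<open>Z \<in> C\<close> by blast
    qed
    moreover have "0 \<in> \<Union>C" using C(1) CS by (auto simp: hom_ideal_def)
    moreover have "f * g \<in> \<Union>C" if "g \<in> \<Union>C" for f g
    proof -
      obtain X where X: "X \<in> C" "g \<in> X" using \<open>g \<in> \<Union>C\<close> by blast
      then have "hom_ideal X" using CS by blast
      then have "f * g \<in> X" using X(2) by (simp add: hom_ideal_def)
      then show ?thesis using X(1) by blast
    qed
    moreover have "hom_part d f \<in> \<Union>C" if "f \<in> \<Union>C" for d f
    proof -
      obtain X where X: "X \<in> C" "f \<in> X" using \<open>f \<in> \<Union>C\<close> by blast
      then have "hom_ideal X" using CS by blast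
      then have "hom_part d f \<in> X" using X(2) by (simp add: hom_ideal_def)
      then show ?thesis using X(1) by blast
    qed
    ultimately have "hom_ideal (\<Union>C)" unfolding hom_ideal_def by simp
    then show ?thesis using C(1) CS by blast
  qed
  moreover have "?S \<noteq> {}" using A av by blast
  ultimately have "\<exists>M\<in>?S. \<forall>X\<in>?S. M \<subseteq> X \<longrightarrow> X = M" by (intro subset_Zorn_nonempty)
  then obtain p where pS: "p \<in> ?S" and max: "\<And>X. X \<in> ?S \<Longrightarrow> p \<subseteq> X \<Longrightarrow> X = p"
    by meson
  have p: "hom_ideal p" "A \<subseteq> p" "\<And>n. l ^ n \<notin> p" using pS by auto
  have pm: "f * g \<in> p" if "g \<in> p" for f g using p(1) that by (auto simp: hom_ideal_def)
  have pm': "f * g \<in> p" if "f \<in> p" for f g using pm[OF that, of g] by (simp add: mult.commute)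
  have pa: "f + g \<in> p" if "f \<in> p" "g \<in> p" for f g using p(1) that by (auto simp: hom_ideal_def)
  have ext: "\<exists>m a h. a \<in> p \<and> l ^ m = a + h * f" if f: "form (int e) f" "f \<notin> p" for e f
  proof -
    let ?I = "{a + h * f | a h. a \<in> p}"
    have "p \<subseteq> ?I" by (rule subset_add_form)
    moreover have "f \<in> ?I" using p(1) by (intro CollectI exI[of _ 0] exI[of _ 1]) (auto simp: hom_ideal_def)
    ultimately have "?I \<notin> ?S" using max[of ?I] f(2) by blast
    then have "\<exists>n. l ^ n \<in> ?I"
      using hom_ideal_add_form[OF p(1) f(1)] \<open>p \<subseteq> ?I\<close> p(2) by blast
    then show ?thesis by blast
  qed
  have "f \<in> p \<or> g \<in> p" if fg: "f * g \<in> p" for f g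
  proof (rule ccontr)
    assume "\<not> (f \<in> p \<or> g \<in> p)"
    then obtain i j where i: "hom_part i f \<notin> p" "\<forall>k>i. hom_part k f \<in> p"
      and j: "hom_part j g \<notin> p" "\<forall>k>j. hom_part k g \<in> p"
      using top_part_outside[OF p(1)] by metis
    let ?f = "hom_part i f" and ?g = "hom_part j g"
    have "hom_part (i + j) (f * g) \<in> p" using fg p(1) by (auto simp: hom_ideal_def)
    then have "(\<Sum>k\<le>i+j. hom_part k f * hom_part (i + j - k) g) \<in> p" by (simp add: hom_part_mult)
    moreover have "(\<Sum>k\<le>i+j. hom_part k f * hom_part (i + j - k) g)
        = ?f * ?g + (\<Sum>k\<in>{..i+j}-{i}. hom_part k f * hom_part (i + j - k) g)"
      by (subst sum.remove[of _ i]) auto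
    moreover have "(\<Sum>k\<in>{..i+j}-{i}. hom_part k f * hom_part (i + j - k) g) \<in> p"
    proof (rule hom_ideal_sum[OF p(1)])
      fix k assume "k \<in> {..i+j}-{i}"
      then consider "k > i" | "i + j - k > j" by force
      then show "hom_part k f * hom_part (i + j - k) g \<in> p"
        using i j pm pm' by cases auto
    qed
    ultimately have "?f * ?g + (\<Sum>k\<in>{..i+j}-{i}. hom_part k f * hom_part (i + j - k) g)
        - (\<Sum>k\<in>{..i+j}-{i}. hom_part k f * hom_part (i + j - k) g) \<in> p"
      by (intro hom_ideal_minus[OF p(1)]) simp_all
    then have fg': "?f * ?g \<in> p" by simp
    obtain m a h where m: "a \<in> p" "l ^ m = a + h * ?f" using ext[OF form_hom_part i(1)] by blast
    obtain n b k where n: "b \<in> p" "l ^ n = b + k * ?g" using ext[OF form_hom_part j(1)] by blast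
    have "l ^ (m + n) = a * l ^ n + (h * ?f) * b + h * k * (?f * ?g)"
      unfolding power_add m(2) n(2) by (simp add: algebra_simps)
    also have "\<dots> \<in> p"
      by (rule pa[OF pa[OF pm'[OF m(1)] pm[OF n(1)]] pm[OF fg']])
    finally show False using p(3) by blast
  qed
  moreover have "\<exists>i. var i \<notin> p"
  proof (rule ccontr)
    assume "\<not> (\<exists>i. var i \<notin> p)"
    then have v: "var i ^ 1 \<in> p" for i by simp
    have "l ^ 3 \<in> p" using form_in_hom_ideal_of_powers[OF p(1) v form_power[OF l(1), of 3]] l(2) by simp
    then show False using p(3) by blast
  qed
  moreover have "1 \<notin> p" "l \<notin> p" using p(3)[of 0] p(3)[of 1] by auto
  ultimately have "proj_prime p" "l \<notin> p" using p(1) by (auto simp: proj_prime_def hom_ideal_def)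
  then show ?thesis using p(2) by blast
qed

section \<open>A line that misses the zero locus\<close>

text \<open>Points of a conic in the dual plane: any three of these lines are linearly independent.\<close>

definition line :: "'k::field \<Rightarrow> 'k poly3" where
  "line c = var 0 + const c * var 1 + const (c\<^sup>2) * var 2"

lemma form_line: "form 1 (line c)"
  unfolding line_def by (intro form_add form_const_mult form_var)

text \<open>By the Vandermonde determinant all three variables would lie in \<open>p\<close>.\<close>

lemma three_lines:
  assumes p: "proj_prime p" and "line a \<in> p" "line b \<in> p" "line c \<in> p"
    and ne: "a \<noteq> b" "a \<noteq> c" "b \<noteq> c"
  shows False
proof -
  have sub: "var 1 + const (x + y) * var 2 \<in> p" if "line x \<in> p" "line y \<in> p" "x \<noteq> y" for x y
  proof -
    have "line x - line y = const (x - y) * (var 1 + const (x + y) * var 2)"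
    proof -
      have "const (x\<^sup>2) = const (y\<^sup>2) + const (x - y) * const (x + y)"
        by (simp add: power2_eq_square algebra_simps flip: const_mult const_add)
      moreover have "const x = const (x - y) + const y" by (simp flip: const_add)
      ultimately show ?thesis by (simp add: line_def algebra_simps)
    qed
    then show ?thesis using prime_const[OF p] prime_diff[OF p that(1,2)] that(3) by (metis right_minus_eq)
  qed
  have "var 1 + const (a + b) * var 2 - (var 1 + const (a + c) * var 2) = const (b - c) * var 2"
  proof -
    have "const (a + b) = const (b - c) + const (a + c)" by (simp add: add.commute flip: const_add)
    then show ?thesis by (simp add: algebra_simps)
  qed
  then have 2: "var 2 \<in> p"
    using prime_diff[OF p sub[of a b] sub[of a c]] assms prime_const[OF p] by (metis right_minus_eq)
  have "var 1 + const (a + b) * var 2 - const (a + b) * var 2 \<in> p"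
    using sub[of a b] assms prime_diff[OF p] prime_multL[OF p 2] by blast
  then have 1: "var 1 \<in> p" by simp
  have "line a - (const a * var 1 + const (a\<^sup>2) * var 2) \<in> p"
    using assms prime_diff[OF p] prime_multL[OF p 2] prime_multL[OF p 1] prime_add[OF p] by blast
  then have 0: "var 0 \<in> p" by (simp add: line_def)
  obtain i where "var i \<notin> p" using prime_var[OF p] by blast
  then show False using 0 1 2 exhaust3[of i] by auto
qed

lemma finite_lines: "proj_prime p \<Longrightarrow> finite {c. line c \<in> p}"
proof (rule ccontr)
  assume p: "proj_prime p" and "infinite {c. line c \<in> p}"
  then obtain B where "B \<subseteq> {c. line c \<in> p}" "card B = 3"
    by (meson infinite_arbitrarily_large)
  then show False using three_lines[OF p] by (auto simp: card_3_iff)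
qed

lemma subspace_sums_forms:
  assumes l: "form e l" and W: "P.subspace W" "W \<subseteq> forms (n + e)"
  shows "P.subspace {l * f + g | f g. form n f \<and> g \<in> W}
    \<and> {l * f + g | f g. form n f \<and> g \<in> W} \<subseteq> forms (n + e)"
proof
  let ?U = "{l * f + g | f g. form n f \<and> g \<in> W}"
  show "P.subspace ?U"
    unfolding P.subspace_def
  proof (intro conjI ballI allI)
    have "0 = l * 0 + 0 \<and> form n 0 \<and> 0 \<in> W" using P.subspace_0[OF W(1)] by simp
    then show "0 \<in> ?U" by blast
  next
    fix x y assume "x \<in> ?U" "y \<in> ?U"
    then obtain f g f' g' where "x = l * f + g" "form n f" "g \<in> W" "y = l * f' + g'" "form n f'" "g' \<in> W"
      by blast
    then have "x + y = l * (f + f') + (g + g') \<and> form n (f + f') \<and> g + g' \<in> W"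
      using P.subspace_add[OF W(1)] form_add by (simp add: algebra_simps)
    then show "x + y \<in> ?U" by blast
  next
    fix c x assume "x \<in> ?U"
    then obtain f g where "x = l * f + g" "form n f" "g \<in> W" by blast
    then have "pscale c x = l * (const c * f) + pscale c g \<and> form n (const c * f) \<and> pscale c g \<in> W"
      using P.subspace_scale[OF W(1)] form_const_mult by (simp add: pscale_def algebra_simps)
    then show "pscale c x \<in> ?U" by blast
  qed
  show "?U \<subseteq> forms (n + e)"
  proof
    fix x assume "x \<in> ?U"
    then obtain f g where "x = l * f + g" "form n f" "g \<in> W" by blast
    then show "x \<in> forms (n + e)" using form_mult[OF l, of n f] W(2) by (auto simp: add.commute intro: form_add)
  qed
qed

text \<open>Both sides count the forms of degree \<open>n\<close> and the quotient of the sum by \<open>W\<close>, onto which \<open>f \<mapsto> l * f\<close>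
  maps.\<close>

lemma dim_multiplication:
  fixes l :: "'k::field poly3"
  assumes l: "form 1 l" and W: "P.subspace W" "W \<subseteq> forms (n + 1)"
  shows "P.dim (forms n :: 'k poly3 set) + P.dim W =
    P.dim {l * f + g | f g. form n f \<and> g \<in> W} + P.dim {f. form n f \<and> l * f \<in> W}"
proof -
  let ?U = "{l * f + g | f g. form n f \<and> g \<in> W}"
  have U: "P.subspace ?U" "?U \<subseteq> forms (n + 1)" using subspace_sums_forms[OF assms] by auto
  have WU: "W \<subseteq> ?U"
  proof
    fix g assume "g \<in> W"
    then have "g = l * 0 + g \<and> form n 0 \<and> g \<in> W" by simp
    then show "g \<in> ?U" by blast
  qed
  obtain C where C: "P.subspace C" "C \<inter> W = {0}" "{x + y | x y. x \<in> C \<and> y \<in> W} = ?U"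
    using P.complement_exists[OF W(1) U(1) WU] by (elim exE conjE)
  have "P.dim ?U = P.dim C + P.dim W"
    by (rule P.dim_complement) (use C U W P.fin_span_mono[OF fin_span_forms U(2)] in auto)
  moreover have "P.dim (forms n :: 'k poly3 set) = P.dim C + P.dim {f \<in> forms n. l * f \<in> W}"
  proof (rule PP.dim_complement_of_image[where B = W and C = C and A = ?U])
    show "(\<lambda>f. l * f) ` forms n \<subseteq> ?U"
    proof
      fix x assume "x \<in> (\<lambda>f. l * f) ` forms n"
      then obtain f where "x = l * f + 0 \<and> form n f \<and> 0 \<in> W" using P.subspace_0[OF W(1)] by auto
      then show "x \<in> ?U" by blast
    qed
    fix a assume "a \<in> ?U"
    then obtain f g where "a = l * f + g" "form n f" "g \<in> W" by blast
    then show "\<exists>x\<in>forms n. a - l * x \<in> W" by (intro bexI[of _ f]) auto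
  qed (use C W in \<open>auto simp: pscale_def algebra_simps\<close>)
  ultimately show ?thesis by simp
qed

context form_triple
begin

text \<open>The ideal generated in the whole ring; its elements of degree \<open>n\<close> form \<open>J n\<close>.\<close>

definition J_all :: "'k poly3 set" where
  "J_all = {A * F1 + B * F2 + C * F3 | A B C. True}"

lemma hom_part_J_all:
  assumes "f \<in> J_all" shows "hom_part n f \<in> J (int n)"
proof -
  obtain A B C where f: "f = A * F1 + B * F2 + C * F3" using assms by (auto simp: J_all_def)
  have "hom_part n f = hpart (int n) (F1 * A + F2 * B + F3 * C)"
    by (simp add: f hpart_def mult.commute[of F1] mult.commute[of F2] mult.commute[of F3])
  also have "\<dots> = F1 * hpart (int n - d1) A + F2 * hpart (int n - d2) B + F3 * hpart (int n - d3) C"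
    by (simp only: hpart_add hpart_mult[OF form_F(1)] hpart_mult[OF form_F(2)] hpart_mult[OF form_F(3)])
  also have "\<dots> = hpart (int n - d1) A * F1 + hpart (int n - d2) B * F2 + hpart (int n - d3) C * F3"
    by (simp only: mult.commute)
  finally show ?thesis unfolding J_def using form_hpart by blast
qed

lemma J_sub_J_all: "J n \<subseteq> J_all"
  by (auto simp: J_def J_all_def)

lemma form_J_all: "form n f \<Longrightarrow> f \<in> J_all \<Longrightarrow> f \<in> J n"
proof (cases "f = 0")
  case True
  then show "f \<in> J n" using P.subspace_0[OF subspace_J] by simp
next
  case False
  assume f: "form n f" "f \<in> J_all"
  then have "n \<ge> 0" using form_neg False by fastforce
  then obtain k where k: "n = int k" by (metis nonneg_int_cases)
  then show "f \<in> J n" using hom_part_J_all[OF f(2), of k] hom_part_form[OF f(1), of k] by simp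
qed

lemma hom_ideal_J_all: "hom_ideal J_all"
  unfolding hom_ideal_def
proof (intro conjI ballI allI)
  show "0 \<in> J_all" unfolding J_all_def by (intro CollectI exI[of _ 0]) simp
next
  fix f g assume "f \<in> J_all" "g \<in> J_all"
  then obtain A B C A' B' C' where "f = A * F1 + B * F2 + C * F3" "g = A' * F1 + B' * F2 + C' * F3"
    by (auto simp: J_all_def)
  then have "f + g = (A + A') * F1 + (B + B') * F2 + (C + C') * F3" by (simp add: algebra_simps)
  then show "f + g \<in> J_all" unfolding J_all_def by blast
next
  fix f g assume "g \<in> J_all"
  then obtain A B C where "g = A * F1 + B * F2 + C * F3" by (auto simp: J_all_def)
  then have "f * g = (f * A) * F1 + (f * B) * F2 + (f * C) * F3" by (simp add: algebra_simps)
  then show "f * g \<in> J_all" unfolding J_all_def by blast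
next
  fix f d assume "f \<in> J_all"
  then show "hom_part d f \<in> J_all" using hom_part_J_all J_sub_J_all by blast
qed

lemma J_all_subset: "hom_ideal p \<Longrightarrow> F1 \<in> p \<Longrightarrow> F2 \<in> p \<Longrightarrow> F3 \<in> p \<Longrightarrow> J_all \<subseteq> p"
  unfolding J_all_def hom_ideal_def by blast

text \<open>The line \<open>l = 0\<close> is disjoint from the common zero locus of the three forms: the forms and \<open>l\<close> generate
  every form of large degree.\<close>

definition misses :: "'k poly3 \<Rightarrow> int \<Rightarrow> bool" where
  "misses l n0 \<longleftrightarrow> (\<forall>n\<ge>n0. \<forall>f. form n f \<longrightarrow> (\<exists>q. form (n - 1) q \<and> f - l * q \<in> J n))"

text \<open>Either the ideal generated by \<open>J\<close> and \<open>l\<close> contains a power of each variable, hence all forms of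
  large degree, or it lies in a prime that avoids some variable.\<close>

lemma misses_or_prime:
  assumes l: "form 1 l"
  shows "(\<exists>n0. misses l n0) \<or> (\<exists>p. proj_prime p \<and> J_all \<subseteq> p \<and> l \<in> p)"
proof -
  let ?I = "{a + h * l | a h. a \<in> J_all}"
  have I: "hom_ideal ?I" using hom_ideal_add_form[OF hom_ideal_J_all, of 1 l] l by simp
  have sub: "J_all \<subseteq> ?I" by (rule subset_add_form)
  have "0 + 1 * l \<in> ?I" using hom_ideal_J_all unfolding hom_ideal_def by blast
  then have l_in: "l \<in> ?I" by simp
  show ?thesis
  proof (cases "\<forall>i. \<exists>n. var i ^ n \<in> ?I")
    case True
    then obtain N where N: "\<And>i. var i ^ N i \<in> ?I" using choice[OF True] by blast
    define M where "M = N 0 + N 1 + N 2"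
    have "N i \<le> M" for i using exhaust3[of i] by (auto simp: M_def)
    then have vM: "var i ^ M \<in> ?I" for i
    proof -
      have "var i ^ (M - N i) * var i ^ N i \<in> ?I"
        using I N[of i] unfolding hom_ideal_def by blast
      then show ?thesis using \<open>N i \<le> M\<close> by (simp flip: power_add)
    qed
    have "misses l (3 * int M + 1)"
      unfolding misses_def
    proof (intro allI impI)
      fix n and f :: "'k poly3" assume n: "3 * int M + 1 \<le> n" and f: "form n f"
      have "0 \<le> n" using n by simp
      then obtain k where k: "n = int k" by (metis nonneg_int_cases)
      have "f \<in> ?I" using form_in_hom_ideal_of_powers[OF I vM f] n by simp
      then obtain a h where ah: "a \<in> J_all" "f = a + h * l" by blast
      have B: "form (n - 1) (hpart (n - 1) h)" by (rule form_hpart)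
      have "hom_part k (h * l) = l * hpart (n - 1) h"
        using hpart_mult[OF l, of n h] k by (simp add: hpart_def mult.commute)
      then have "f = hom_part k a + l * hpart (n - 1) h"
        using hom_part_form[OF f, of k] k ah(2) by (simp add: hom_part_add)
      then have "f - l * hpart (n - 1) h \<in> J n" using hom_part_J_all[OF ah(1), of k] k by simp
      then show "\<exists>q. form (n - 1) q \<and> f - l * q \<in> J n" using B by blast
    qed
    then show ?thesis by blast
  next
    case False
    then obtain i where "\<And>n. var i ^ n \<notin> ?I" by blast
    moreover have "(0 :: int) < 1" by simp
    ultimately obtain p where "proj_prime p" "?I \<subseteq> p"
      using homogeneous_prime_avoiding[OF I form_var] by blast
    then show ?thesis using sub l_in by blast
  qed
qed

text \<open>If every line of the family met the zero locus, the locus would have many points, and the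
  forms vanishing at more and more of them would give long chains of subspaces between \<open>J n\<close> and the
  space of all forms.\<close>

lemma missing_line_exists:
  assumes inf: "infinite (UNIV :: 'k set)"
    and bounded: "\<And>n. n \<ge> n1 \<Longrightarrow> int (P.dim (forms n :: 'k poly3 set)) \<le> int (P.dim (J n)) + T"
  shows "\<exists>c n0. misses (line c) n0"
proof (rule ccontr)
  assume "\<not> ?thesis"
  then have "\<forall>c. \<exists>p. proj_prime p \<and> J_all \<subseteq> p \<and> line c \<in> p"
    using misses_or_prime[OF form_line] by blast
  then obtain q where q: "\<And>c. proj_prime (q c)" "\<And>c. J_all \<subseteq> q c" "\<And>c. line c \<in> q c" by metis
  have "\<exists>c :: nat \<Rightarrow> 'k. \<forall>j. \<forall>i<j. line (c j) \<notin> q (c i)"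
  proof (rule dependent_wellorder_choice[where P = "\<lambda>c j r. \<forall>i<j. line r \<notin> q (c i)"])
    fix j :: nat and c :: "nat \<Rightarrow> 'k"
    have "finite (\<Union>i<j. {r. line r \<in> q (c i)})" using finite_lines q(1) by auto
    then obtain r where "r \<notin> (\<Union>i<j. {r. line r \<in> q (c i)})" using inf ex_new_if_finite by blast
    then show "\<exists>r. \<forall>i<j. line r \<notin> q (c i)" by auto
  qed auto
  then obtain c :: "nat \<Rightarrow> 'k" where c: "\<And>i j. i < j \<Longrightarrow> line (c j) \<notin> q (c i)" by blast
  have "\<exists>i. var i \<notin> q (c j)" for j using prime_var[OF q(1)] .
  then obtain y where y: "\<And>j. var (y j) \<notin> q (c j)" by metis
  \<comment> \<open>One chain step more than the codimension admits, in a degree to which the bound applies.\<close>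
  define N where "N = nat T + 1"
  define M where "M = N + nat n1"
  \<comment> \<open>\<open>E i\<close> vanishes at the points with an index greater than \<open>i\<close> but not at the \<open>i\<close>-th one, and so enlarges \<open>V i\<close>.\<close>
  define V where "V i = {f. form (int M) f \<and> (\<forall>k. i \<le> k \<and> k < N \<longrightarrow> f \<in> q (c k))}" for i
  define E where "E i = (\<Prod>j\<in>{i<..<N}. line (c j)) * var (y i) ^ (M - (N - 1 - i))" for i
  have Vsub: "P.subspace (V i)" for i
    unfolding V_def P.subspace_def pscale_def
    using q(1) by (auto intro: form_add form_const_mult prime_add prime_multL prime_zero)
  have Vfin: "fin_span pscale (V i)" for i
    by (rule P.fin_span_mono[OF fin_span_forms[of "int M"]]) (auto simp: V_def)
  have step: "P.dim (V i) < P.dim (V (Suc i))" if "i < N" for i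
  proof -
    have "form (\<Sum>j\<in>{i<..<N}. 1) (\<Prod>j\<in>{i<..<N}. line (c j))"
      by (intro form_prod form_line) auto
    moreover have "(\<Sum>j\<in>{i<..<N}. 1 :: int) = int (N - 1 - i)" by simp
    ultimately have "form (int (N - 1 - i) + int (M - (N - 1 - i)) * 1) (E i)"
      unfolding E_def using form_mult[OF _ form_power[OF form_var]] by metis
    moreover have "int (N - 1 - i) + int (M - (N - 1 - i)) * 1 = int M"
      by (simp add: M_def)
    ultimately have E: "form (int M) (E i)" by simp
    have "E i \<in> q (c k)" if "Suc i \<le> k" "k < N" for k
    proof -
      have "(\<Prod>j\<in>{i<..<N}. line (c j)) = line (c k) * (\<Prod>j\<in>{i<..<N} - {k}. line (c j))"
        using that by (intro prod.remove) auto
      then have "E i = line (c k) * ((\<Prod>j\<in>{i<..<N} - {k}. line (c j)) * var (y i) ^ (M - (N - 1 - i)))"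
        by (simp add: E_def mult.assoc)
      then show ?thesis using prime_multR[OF q(1) q(3)] by simp
    qed
    then have "E i \<in> V (Suc i)" using E by (auto simp: V_def)
    moreover have "E i \<notin> q (c i)"
      unfolding E_def using prime_cases[OF q(1)] prime_power[OF q(1) y] prime_prod[OF q(1), of "{i<..<N}"] c
      by (metis finite_greaterThanLessThan greaterThanLessThan_iff)
    then have "E i \<notin> V i" using that by (auto simp: V_def)
    moreover have "V i \<subseteq> V (Suc i)" by (auto simp: V_def)
    ultimately show ?thesis
      using P.subspace_eq_if_dim_ge[OF Vfin Vsub, of i "Suc i"] by (metis not_le)
  qed
  have "J (int M) \<subseteq> V 0" using J_forms J_sub_J_all q(2) by (fastforce simp: V_def)
  then have J0: "P.dim (J (int M)) \<le> P.dim (V 0)" by (rule P.dim_mono_span[OF Vfin])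
  have "i \<le> N \<Longrightarrow> P.dim (J (int M)) + i \<le> P.dim (V i)" for i
  proof (induction i)
    case 0 then show ?case using J0 by simp
  next
    case (Suc i) then show ?case using step[of i] by auto
  qed
  from this[of N] have "P.dim (J (int M)) + N \<le> P.dim (V N)" by simp
  also have "P.dim (V N) \<le> P.dim (forms (int M) :: 'k poly3 set)"
    by (rule P.dim_mono_span[OF fin_span_forms]) (auto simp: V_def)
  finally have "P.dim (J (int M)) + N \<le> P.dim (forms (int M) :: 'k poly3 set)" .
  moreover have "n1 \<le> int M" "T < int N" by (simp_all add: M_def N_def)
  ultimately show False using bounded[of "int M"] by linarith
qed

definition codim_J :: "int \<Rightarrow> nat" where
  "codim_J n = P.dim (forms n :: 'k poly3 set) - P.dim (J n)"

text \<open>If \<open>W\<close> contains \<open>J (n + 1)\<close>, multiplication by \<open>l\<close> maps the forms of degree \<open>n\<close> onto the forms of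
  degree \<open>n + 1\<close> modulo \<open>W\<close>. If \<open>V\<close> and \<open>W\<close> have the same codimension, it is therefore injective modulo \<open>V\<close>.\<close>

lemma misses_multiplication:
  assumes l: "form 1 l" and m: "misses l n0" "n + 1 \<ge> n0"
    and V: "P.subspace V" "V \<subseteq> forms n" "\<And>f. f \<in> V \<Longrightarrow> l * f \<in> W"
    and W: "P.subspace W" "W \<subseteq> forms (n + 1)" "J (n + 1) \<subseteq> W"
  shows "P.dim (forms (n + 1) :: 'k poly3 set) + P.dim V \<le> P.dim (forms n :: 'k poly3 set) + P.dim W"
    and "P.dim (forms n :: 'k poly3 set) + P.dim W \<le> P.dim (forms (n + 1) :: 'k poly3 set) + P.dim V \<Longrightarrow>
      form n f \<Longrightarrow> l * f \<in> W \<Longrightarrow> f \<in> V"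
proof -
  let ?L = "{f. form n f \<and> l * f \<in> W}" and ?U = "{l * f + g | f g. form n f \<and> g \<in> W}"
  have "?U = forms (n + 1)"
  proof
    show "?U \<subseteq> forms (n + 1)" using subspace_sums_forms[OF l W(1,2)] by blast
    show "forms (n + 1) \<subseteq> ?U"
    proof
      fix f :: "'k poly3" assume "f \<in> forms (n + 1)"
      then obtain q where q: "form n q" "f - l * q \<in> J (n + 1)" using m by (force simp: misses_def)
      have "f = l * q + (f - l * q)" by simp
      then show "f \<in> ?U" using q W(3) by blast
    qed
  qed
  then have d: "P.dim (forms n :: 'k poly3 set) + P.dim W = P.dim (forms (n + 1) :: 'k poly3 set) + P.dim ?L"
    using dim_multiplication[OF l W(1,2)] by simp
  have VL: "V \<subseteq> ?L" using V by blast
  have fL: "fin_span pscale ?L" by (rule P.fin_span_mono[OF fin_span_forms[of n]]) auto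
  have "P.dim V \<le> P.dim ?L" by (rule P.dim_mono_span[OF fL VL])
  then show "P.dim (forms (n + 1) :: 'k poly3 set) + P.dim V \<le> P.dim (forms n :: 'k poly3 set) + P.dim W"
    using d by linarith
  assume "P.dim (forms n :: 'k poly3 set) + P.dim W \<le> P.dim (forms (n + 1) :: 'k poly3 set) + P.dim V"
  then have "V = ?L" using d by (intro P.subspace_eq_if_dim_ge[OF fL V(1) VL]) linarith
  then show "form n f \<Longrightarrow> l * f \<in> W \<Longrightarrow> f \<in> V" by blast
qed

lemma misses_step:
  assumes l: "form 1 l" and m: "misses l n0" "n + 1 \<ge> n0"
  shows "codim_J (n + 1) \<le> codim_J n \<and>
    (codim_J (n + 1) = codim_J n \<longrightarrow> (\<forall>f. form n f \<longrightarrow> l * f \<in> J (n + 1) \<longrightarrow> f \<in> J n))"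
proof -
  have "l * f \<in> J (n + 1)" if "f \<in> J n" for f using J_mult[OF that l] by (simp add: add.commute)
  note mult = misses_multiplication[OF l m subspace_J J_forms this subspace_J J_forms subset_refl]
  show ?thesis
    using mult(1) mult(2) dim_J_le[of n] dim_J_le[of "n + 1"] unfolding codim_J_def by auto
qed

text \<open>The codimension of \<open>J n\<close> does not increase from \<open>n0\<close> on, so it becomes constant once it has reached
  its minimum.\<close>

lemma misses_stable:
  assumes l: "form 1 l" and m: "misses l n0"
  shows "\<exists>n2\<ge>n0. \<forall>n\<ge>n2. codim_J n = codim_J n2 \<and> (\<forall>f. form n f \<longrightarrow> l * f \<in> J (n + 1) \<longrightarrow> f \<in> J n)"
proof -
  obtain n2 where n2: "n2 \<ge> n0" "\<And>n. n \<ge> n0 \<Longrightarrow> codim_J n2 \<le> codim_J n"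
    using ex_has_least_nat[of "\<lambda>n. n \<ge> n0" n0 codim_J] by auto
  have eq: "codim_J n = codim_J n2" if "n \<ge> n2" for n
    using that
  proof (induction n rule: int_ge_induct)
    case (step i)
    then show ?case using misses_step[OF l m, of i] n2(1) n2(2)[of "i + 1"] by auto
  qed simp
  show ?thesis
  proof (intro exI[of _ n2] conjI allI impI n2(1) eq)
    fix n f assume "n2 \<le> n" "form n f" "l * f \<in> J (n + 1)"
    then show "f \<in> J n" using misses_step[OF l m, of n] eq[of n] eq[of "n + 1"] n2(1) by auto
  qed
qed

end

section \<open>Powers of the variables\<close>

lemma lookup_shift:
  fixes f :: "'k::field poly3"
  shows "lookup (single a c * f) (a + m) = c * lookup f m"
proof -
  have "single a c * f = (\<Sum>n\<in>keys f. single (a + n) (c * lookup f n))"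
    by (subst (1) sum_of_singles[of f]) (simp add: sum_distrib_left mult_single)
  then have "lookup (single a c * f) (a + m) =
      (\<Sum>n\<in>keys f. if n = m then c * lookup f n else 0)"
    by (auto simp: lookup_sum lookup_single when_def intro!: sum.cong)
  also have "\<dots> = c * lookup f m" by (auto simp: in_keys_iff)
  finally show ?thesis .
qed

lemma keys_var_power_mult:
  fixes f :: "'k::field poly3"
  assumes "m \<in> keys (var i ^ n * f)" shows "n \<le> lookup m i"
proof -
  obtain b where "m = single i n + b"
    using assms keys_mult[of "var i ^ n" f] by (auto simp: var_power)
  then show ?thesis by (simp add: lookup_add)
qed

text \<open>Membership in an ideal generated by powers of variables is decided monomial by monomial.\<close>

lemma monomial_ideal:
  fixes f :: "'k::field poly3"
  assumes "\<And>m. m \<in> keys f \<Longrightarrow> n \<le> lookup m i \<or> n \<le> lookup m j"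
  shows "\<exists>a b. f = var i ^ n * a + var j ^ n * b"
proof -
  have "\<exists>a b. (\<Sum>m\<in>M. single m (lookup f m)) = var i ^ n * a + var j ^ n * b"
    if "finite M" "M \<subseteq> keys f" for M
    using that
  proof (induction M rule: finite_induct)
    case empty
    show ?case by (intro exI[of _ 0]) simp
  next
    case (insert m M)
    then obtain a b where ab: "(\<Sum>m\<in>M. single m (lookup f m)) = var i ^ n * a + var j ^ n * b"
      by auto
    have "n \<le> lookup m i \<or> n \<le> lookup m j" using insert.prems assms by auto
    then obtain a' b' where "single m (lookup f m) = var i ^ n * a' + var j ^ n * b'"
      using single_split[of n m _ "lookup f m"]
      by (metis add.left_neutral add.right_neutral mult.commute mult_zero_right)
    then have "(\<Sum>m\<in>insert m M. single m (lookup f m))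
        = var i ^ n * (a' + a) + var j ^ n * (b' + b)"
      using ab insert.hyps by (simp add: algebra_simps)
    then show ?case by blast
  qed
  from this[of "keys f"] show ?thesis using sum_of_singles[of f] by simp
qed

text \<open>A monomial of \<open>\<alpha>\<close> times a power of the \<open>k\<close>-th variable has the exponents of \<open>\<alpha>\<close> at \<open>i\<close> and \<open>j\<close>.\<close>

lemma var_power_colon:
  fixes \<alpha> :: "'k::field poly3"
  assumes "i \<noteq> k" "j \<noteq> k" and eq: "var k ^ n * \<alpha> = var i ^ n * a + var j ^ n * b"
  shows "\<exists>a b. \<alpha> = var i ^ n * a + var j ^ n * b"
proof (rule monomial_ideal)
  fix m assume "m \<in> keys \<alpha>"
  then have "lookup (var k ^ n * \<alpha>) (single k n + m) \<noteq> 0"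
    by (simp add: var_power lookup_shift in_keys_iff)
  then have "single k n + m \<in> keys (var i ^ n * a) \<union> keys (var j ^ n * b)"
    using keys_add[of "var i ^ n * a" "var j ^ n * b"] unfolding eq by (auto simp: in_keys_iff)
  then have "n \<le> lookup (single k n + m) i \<or> n \<le> lookup (single k n + m) j"
    using keys_var_power_mult by blast
  then show "n \<le> lookup m i \<or> n \<le> lookup m j"
    using assms(1,2) by (auto simp: lookup_add lookup_single when_def)
qed

lemma var_power_dvd_cancel:
  fixes f :: "'k::field poly3"
  assumes "i \<noteq> j" "var i ^ n dvd var j ^ n * f" shows "var i ^ n dvd f"
proof -
  obtain a where "var j ^ n * f = var i ^ n * a" using assms(2) by (rule dvdE)
  then have "var j ^ n * f = var i ^ n * a + var i ^ n * 0" by simp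
  then obtain a b where "f = var i ^ n * a + var i ^ n * b" using var_power_colon[of i j i] assms(1) by blast
  then show ?thesis by (simp flip: distrib_left)
qed

section \<open>Bounds for the codimensions\<close>

context syz_triple
begin

text \<open>From this degree on, all spaces of forms in the rank formulas have the polynomial dimension.\<close>

definition large :: int where
  "large = \<bar>d1\<bar> + \<bar>d2\<bar> + \<bar>d3\<bar> + \<bar>e\<bar> + \<bar>sigma\<bar>"

text \<open>The sum of the codimensions of \<open>J\<close> and \<open>K\<close> in large degrees.\<close>

definition Q :: int where
  "Q = e\<^sup>2 - e * sigma + d1 * d2 + d1 * d3 + d2 * d3"

definition codim_K :: "int \<Rightarrow> nat" where
  "codim_K m = P.dim (forms m :: 'k poly3 set) - P.dim (K m)"

lemma codim_J_K:
  assumes "n \<ge> large" shows "int (codim_J n) + int (codim_K (n + e - sigma)) = Q"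
proof -
  have "n \<ge> -2" "n - d1 \<ge> -2" "n - d2 \<ge> -2" "n - d3 \<ge> -2" "n - e \<ge> -2" "n + e - sigma \<ge> -2"
    using assms unfolding large_def by linarith+
  then show ?thesis
    using codim_J_plus_codim_K[of n] dim_J_le[of n] dim_K_le[of "n + e - sigma"]
    unfolding codim_J_def codim_K_def Q_def by (simp add: of_nat_diff)
qed

lemma cross_eq_diff: "cross_eq A B C g \<Longrightarrow> cross_eq A' B' C' g' \<Longrightarrow> cross_eq (A - A') (B - B') (C - C') (g - g')"
  unfolding cross_eq_def by (auto simp: algebra_simps)

lemma codim_J_le_Q: "n \<ge> large \<Longrightarrow> int (codim_J n) \<le> Q"
  using codim_J_K[of n] by linarith

lemma missing_line:
  assumes "infinite (UNIV :: 'k set)" shows "\<exists>c n0. misses (line c) n0"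
proof (rule missing_line_exists[OF assms])
  fix n assume "n \<ge> large"
  then show "int (P.dim (forms n :: 'k poly3 set)) \<le> int (P.dim (J n)) + Q"
    using codim_J_le_Q[of n] dim_J_le[of n] unfolding codim_J_def by linarith
qed

text \<open>Taking homogeneous parts of \<open>A\<close>, \<open>B\<close>, \<open>C\<close> preserves the equation, and \<open>g F \<bullet> (A, B, C) = 0\<close> makes them
  a syzygy.\<close>

lemma K_from_cross:
  assumes c: "cross_eq A B C g" and g: "form m g" shows "g \<in> K m"
proof -
  let ?n = "m + sigma - e"
  let ?A = "hpart (?n - d1) A" and ?B = "hpart (?n - d2) B" and ?C = "hpart (?n - d3) C"
  have gF: "form (m + d1) (g * F1)" "form (m + d2) (g * F2)" "form (m + d3) (g * F3)"
    using form_mult[OF g] form_F by auto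
  have "v * ?C - w * ?B = hpart (m + d1) (v * C - w * B)"
    using hpart_mult[OF form_s(2), of "m + d1" C] hpart_mult[OF form_s(3), of "m + d1" B]
    by (simp add: hpart_diff sigma_def algebra_simps)
  moreover have "w * ?A - u * ?C = hpart (m + d2) (w * A - u * C)"
    using hpart_mult[OF form_s(3), of "m + d2" A] hpart_mult[OF form_s(1), of "m + d2" C]
    by (simp add: hpart_diff sigma_def algebra_simps)
  moreover have "u * ?B - v * ?A = hpart (m + d3) (u * B - v * A)"
    using hpart_mult[OF form_s(1), of "m + d3" B] hpart_mult[OF form_s(2), of "m + d3" A]
    by (simp add: hpart_diff sigma_def algebra_simps)
  ultimately have c': "cross_eq ?A ?B ?C g"
    using c hpart_form gF unfolding cross_eq_def by metis
  show ?thesis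
  proof (cases "g = 0")
    case True then show ?thesis using P.subspace_0[OF subspace_K] by simp
  next
    case False
    have "g * (?A * F1 + ?B * F2 + ?C * F3) = 0"
      using c' unfolding cross_eq_def by Groebner_Basis.algebra
    then have "(?A, ?B, ?C) \<in> Syz ?n"
      using False form_hpart by (auto simp: Syz_def)
    then show ?thesis using c' g unfolding K_def by blast
  qed
qed

lemma koszul_identities:
  fixes X Y Z :: "'a::comm_ring_1"
  shows "Y * a - X * a' = \<alpha> * t \<Longrightarrow> Z * a - X * a'' = \<beta> * t \<Longrightarrow> Z * a' - Y * a'' = \<gamma> * t \<Longrightarrow>
      (Z * \<alpha> - Y * \<beta> + X * \<gamma>) * t = 0"
    and "Z * \<alpha> - Y * \<beta> + X * \<gamma> = 0 \<Longrightarrow> Z * \<alpha> = X * (- \<gamma>) + Y * \<beta>"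
    and "Y * a - X * a' = (X * p + Y * q) * t \<Longrightarrow> Y * (a - q * t) = X * (a' + p * t)"
    and "a - q * t = X * b \<Longrightarrow> a' - q * t' = X * b' \<Longrightarrow> t * a' - t' * a = X * g * h \<Longrightarrow>
      X * (t * b' - t' * b) = X * (g * h)"
proof -
  assume e: "Y * a - X * a' = \<alpha> * t" "Z * a - X * a'' = \<beta> * t" "Z * a' - Y * a'' = \<gamma> * t"
  have "(Z * \<alpha> - Y * \<beta> + X * \<gamma>) * t = Z * (\<alpha> * t) - Y * (\<beta> * t) + X * (\<gamma> * t)"
    by (simp add: algebra_simps)
  also have "\<dots> = 0" unfolding e[symmetric] by (simp add: algebra_simps)
  finally show "(Z * \<alpha> - Y * \<beta> + X * \<gamma>) * t = 0" .
next
  assume e: "Z * \<alpha> - Y * \<beta> + X * \<gamma> = 0"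
  have "Z * \<alpha> = (Z * \<alpha> - Y * \<beta> + X * \<gamma>) + (X * (- \<gamma>) + Y * \<beta>)" by (simp add: algebra_simps)
  then show "Z * \<alpha> = X * (- \<gamma>) + Y * \<beta>" unfolding e by simp
next
  assume e: "Y * a - X * a' = (X * p + Y * q) * t"
  have "Y * (a - q * t) = (Y * a - X * a') - Y * q * t + X * a'" by (simp add: algebra_simps)
  also have "\<dots> = X * (a' + p * t)" unfolding e by (simp add: algebra_simps)
  finally show "Y * (a - q * t) = X * (a' + p * t)" .
next
  assume e: "a - q * t = X * b" "a' - q * t' = X * b'" "t * a' - t' * a = X * g * h"
  have "X * (t * b' - t' * b) = t * (X * b') - t' * (X * b)" by (simp add: algebra_simps)
  also have "\<dots> = t * a' - t' * a" unfolding e(1,2)[symmetric] by (simp add: algebra_simps)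
  finally show "X * (t * b' - t' * b) = X * (g * h)" using e(3) by (simp add: mult.assoc)
qed

text \<open>The vanishing of a Koszul cohomology group: local solutions of \<open>s \<times> s' = g F\<close> over the three
  charts of the plane can be corrected by multiples of \<open>s\<close> so that they agree.\<close>

lemma K_saturated:
  assumes g: "form m g" and K: "\<And>i. \<exists>n. var i ^ N * g \<in> K n"
  shows "g \<in> K m"
proof -
  have "\<exists>A B C. cross_eq A B C (var i ^ N * g)" for i using K[of i] unfolding K_def by blast
  then obtain A B C where ABC: "\<And>i. cross_eq (A i) (B i) (C i) (var i ^ N * g)" by metis
  let ?X = "var 0 ^ N :: 'k poly3" and ?Y = "var 1 ^ N :: 'k poly3" and ?Z = "var 2 ^ N :: 'k poly3"
  have al: "\<exists>\<alpha>. var j ^ N * A i - var i ^ N * A j = \<alpha> * u \<and> var j ^ N * B i - var i ^ N * B j = \<alpha> * v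
    \<and> var j ^ N * C i - var i ^ N * C j = \<alpha> * w" for i j
  proof (rule cross_eq_0)
    have "cross_eq (var j ^ N * A i) (var j ^ N * B i) (var j ^ N * C i) (var j ^ N * (var i ^ N * g))"
      "cross_eq (var i ^ N * A j) (var i ^ N * B j) (var i ^ N * C j) (var i ^ N * (var j ^ N * g))"
      using cross_eq_mult[OF ABC] by blast+
    then show "cross_eq (var j ^ N * A i - var i ^ N * A j) (var j ^ N * B i - var i ^ N * B j)
        (var j ^ N * C i - var i ^ N * C j) 0"
      using cross_eq_diff[of "var j ^ N * A i" "var j ^ N * B i" "var j ^ N * C i" "var j ^ N * (var i ^ N * g)"
        "var i ^ N * A j" "var i ^ N * B j" "var i ^ N * C j" "var i ^ N * (var j ^ N * g)"]
      by (simp add: mult.left_commute)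
  qed
  \<comment> \<open>\<open>\<alpha>\<close>, \<open>\<beta>\<close>, \<open>\<gamma>\<close> are the differences of the local solutions on the overlaps of the charts\<close>
  obtain \<alpha> where a: "?Y * A 0 - ?X * A 1 = \<alpha> * u" "?Y * B 0 - ?X * B 1 = \<alpha> * v" "?Y * C 0 - ?X * C 1 = \<alpha> * w"
    using al[of 1 0] by blast
  obtain \<beta> where b: "?Z * A 0 - ?X * A 2 = \<beta> * u" "?Z * B 0 - ?X * B 2 = \<beta> * v" "?Z * C 0 - ?X * C 2 = \<beta> * w"
    using al[of 2 0] by blast
  obtain \<gamma> where c: "?Z * A 1 - ?Y * A 2 = \<gamma> * u" "?Z * B 1 - ?Y * B 2 = \<gamma> * v" "?Z * C 1 - ?Y * C 2 = \<gamma> * w"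
    using al[of 2 1] by blast
  have "(?Z * \<alpha> - ?Y * \<beta> + ?X * \<gamma>) * u = 0" by (rule koszul_identities(1)[OF a(1) b(1) c(1)])
  moreover have "(?Z * \<alpha> - ?Y * \<beta> + ?X * \<gamma>) * v = 0" by (rule koszul_identities(1)[OF a(2) b(2) c(2)])
  moreover have "(?Z * \<alpha> - ?Y * \<beta> + ?X * \<gamma>) * w = 0" by (rule koszul_identities(1)[OF a(3) b(3) c(3)])
  ultimately have "?Z * \<alpha> - ?Y * \<beta> + ?X * \<gamma> = 0" using s_nonzero by auto
  then have "?Z * \<alpha> = ?X * (- \<gamma>) + ?Y * \<beta>" by (rule koszul_identities(2))
  \<comment> \<open>the cocycle condition makes the difference on the first overlap a coboundary\<close>
  moreover have "(0 :: 3) \<noteq> 2" "(1 :: 3) \<noteq> 2" by simp_all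
  ultimately obtain p q where pq: "\<alpha> = ?X * p + ?Y * q"
    using var_power_colon by blast
  have "?Y * (A 0 - q * u) = ?X * (A 1 + p * u)" "?Y * (B 0 - q * v) = ?X * (B 1 + p * v)"
    "?Y * (C 0 - q * w) = ?X * (C 1 + p * w)"
    by (rule koszul_identities(3)[OF a(1)[unfolded pq]] koszul_identities(3)[OF a(2)[unfolded pq]]
        koszul_identities(3)[OF a(3)[unfolded pq]])+
  then have "?X dvd A 0 - q * u" "?X dvd B 0 - q * v" "?X dvd C 0 - q * w"
    using var_power_dvd_cancel[of 0 1 N] by (metis dvd_triv_left zero_neq_one)+
  then obtain A' B' C' where A': "A 0 - q * u = ?X * A'" "B 0 - q * v = ?X * B'" "C 0 - q * w = ?X * C'"
    by (auto elim!: dvdE)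
  have X: "?X \<noteq> 0" by simp
  have "?X * (v * C' - w * B') = ?X * (g * F1)" "?X * (w * A' - u * C') = ?X * (g * F2)"
    "?X * (u * B' - v * A') = ?X * (g * F3)"
    using koszul_identities(4)[OF A'(2,3)] koszul_identities(4)[OF A'(3,1)]
      koszul_identities(4)[OF A'(1,2)] ABC[of 0] unfolding cross_eq_def by blast+
  then have "cross_eq A' B' C' g" by (simp only: cross_eq_def mult_left_cancel[OF X] simp_thms)
  then show ?thesis using K_from_cross g by blast
qed

lemma J_dual_sub_K: "form_triple.J u v w (e - d1) (e - d2) (e - d3) n \<subseteq> K n"
proof
  interpret D: syz_triple u v w "e - d1" "e - d2" "e - d3" F1 F2 F3 e by (rule dual)
  fix f assume "f \<in> D.J n"
  then obtain A B C where f: "f = A * u + B * v + C * w" "form (n - (e - d1)) A" "form (n - (e - d2)) B"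
    "form (n - (e - d3)) C" by (auto simp: D.J_def)
  have "A * u \<in> K n" "B * v \<in> K n" "C * w \<in> K n"
    using K_mult[OF koszul_in_K(1) f(2)] K_mult[OF koszul_in_K(2) f(3)] K_mult[OF koszul_in_K(3) f(4)] by auto
  then show "f \<in> K n" using f(1) P.subspace_add[OF subspace_K] by metis
qed

text \<open>A line that misses the zero locus of \<open>s\<close> also misses \<open>Z\<close>, as \<open>K\<close> contains the entries of \<open>s\<close>. The
  codimension of \<open>K\<close> is constant in large degrees because that of \<open>J\<close> is, so multiplication by the line is
  injective modulo \<open>K\<close> there.\<close>

lemma codim_K_stable:
  assumes inf: "infinite (UNIV :: 'k set)"
  shows "\<exists>l n0. form 1 l \<and> (\<forall>n\<ge>n0. \<forall>f. form n f \<longrightarrow> l * f \<in> K (n + 1) \<longrightarrow> f \<in> K n)"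
proof -
  interpret D: syz_triple u v w "e - d1" "e - d2" "e - d3" F1 F2 F3 e by (rule dual)
  obtain c n0 where m: "D.misses (line c) n0" using D.missing_line[OF inf] by blast
  obtain c' n0' where m': "misses (line c') n0'" using missing_line[OF inf] by blast
  obtain n2 where n2: "n2 \<ge> n0'" "\<And>n. n \<ge> n2 \<Longrightarrow> codim_J n = codim_J n2"
    using misses_stable[OF form_line m'] by blast
  \<comment> \<open>Degree \<open>n\<close> of \<open>K\<close> belongs to degree \<open>n - e + sigma\<close> of \<open>J\<close>.\<close>
  define n3 where "n3 = max n0 (max n2 large + e - sigma)"
  have "f \<in> K n" if n: "n \<ge> n3" and f: "form n f" "line c * f \<in> K (n + 1)" for n f
  proof -
    have a: "n - e + sigma \<ge> large" "n - e + sigma \<ge> n2" "n + 1 - e + sigma \<ge> large" "n + 1 - e + sigma \<ge> n2"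
      and "n0 \<le> n + 1"
      using n unfolding n3_def by linarith+
    have "codim_K n = codim_K (n + 1)"
      using codim_J_K[OF a(1)] codim_J_K[OF a(3)] n2(2)[OF a(2)] n2(2)[OF a(4)] by simp
    then have "P.dim (forms n :: 'k poly3 set) + P.dim (K (n + 1)) \<le> P.dim (forms (n + 1) :: 'k poly3 set) + P.dim (K n)"
      using dim_K_le[of n] dim_K_le[of "n + 1"] unfolding codim_K_def by linarith
    moreover have "line c * f \<in> K (n + 1)" if "f \<in> K n" for f
      using K_mult[OF that form_line] by (simp add: add.commute)
    ultimately show ?thesis
      using D.misses_multiplication(2)[OF form_line m \<open>n0 \<le> n + 1\<close> subspace_K K_forms _ subspace_K K_forms J_dual_sub_K]
        f by blast
  qed
  then show ?thesis using form_line by blast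
qed

text \<open>As \<open>K\<close> is saturated, injectivity of multiplication by the line descends from large degrees to all
  degrees: if \<open>l * f\<close> lies in \<open>K\<close>, so do the products of \<open>f\<close> with large powers of the variables.\<close>

lemma codim_K_mono:
  assumes inf: "infinite (UNIV :: 'k set)" and mn: "m \<le> n"
  shows "codim_K m \<le> codim_K n"
proof -
  obtain l n0 where l: "form 1 l" and st: "\<And>n f. n \<ge> n0 \<Longrightarrow> form n f \<Longrightarrow> l * f \<in> K (n + 1) \<Longrightarrow> f \<in> K n"
    using codim_K_stable[OF inf] by blast
  have inj: "f \<in> K n" if f: "form n f" "l * f \<in> K (n + 1)" for n f
  proof (rule K_saturated[OF f(1), where N = "nat (n0 - n)"])
    fix i
    let ?x = "var i ^ nat (n0 - n) :: 'k poly3"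
    have x: "form (int (nat (n0 - n)) * 1) ?x" by (rule form_power) simp
    have "?x * (l * f) \<in> K (int (nat (n0 - n)) * 1 + (n + 1))" by (rule K_mult[OF f(2) x])
    then have "l * (?x * f) \<in> K (int (nat (n0 - n)) + n + 1)" by (simp add: algebra_simps)
    moreover have "form (int (nat (n0 - n)) + n) (?x * f)" using form_mult[OF x f(1)] by simp
    moreover have "int (nat (n0 - n)) + n \<ge> n0" by linarith
    ultimately have "?x * f \<in> K (int (nat (n0 - n)) + n)" using st by blast
    then show "\<exists>n. ?x * f \<in> K n" by blast
  qed
  have step: "codim_K n \<le> codim_K (n + 1)" for n
  proof -
    let ?L = "{f. form n f \<and> l * f \<in> K (n + 1)}"
    let ?U = "{l * f + g | f g. form n f \<and> g \<in> K (n + 1)}"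
    have "P.dim ?U \<le> P.dim (forms (n + 1) :: 'k poly3 set)"
      by (rule P.dim_mono_span[OF fin_span_forms conjunct2[OF subspace_sums_forms[OF l subspace_K K_forms]]])
    moreover have "P.dim ?L \<le> P.dim (K n)" using inj by (intro P.dim_mono_span[OF fin_span_K]) blast
    ultimately show ?thesis
      using dim_multiplication[OF l subspace_K K_forms, of n] dim_K_le[of n] dim_K_le[of "n + 1"]
      unfolding codim_K_def by linarith
  qed
  show ?thesis using mn
    by (induction n rule: int_ge_induct) (auto intro: order_trans[OF _ step])
qed

text \<open>In degree \<open>2 * e - sigma - 1\<close> the space \<open>K\<close> comes from syzygies of total degree \<open>e - 1\<close>, which vanish, so its
  codimension there is the dimension of the space of all forms; the codimension in large degrees is no
  smaller.\<close>

lemma codim_J_upper: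
  assumes inf: "infinite (UNIV :: 'k set)" and min: "\<And>n. n < e \<Longrightarrow> Syz n \<subseteq> {(0, 0, 0)}"
    and D: "2 * e - sigma > 0"
  shows "\<exists>n0. \<forall>n\<ge>n0. 2 * int (codim_J n) \<le> 2 * Q - (2 * e - sigma) * (2 * e - sigma + 1)"
proof (intro exI allI impI)
  fix n assume n: "n \<ge> max large (e - 1)"
  let ?D = "2 * e - sigma - 1"
  have "K ?D \<subseteq> {0}"
  proof
    fix g assume "g \<in> K ?D"
    then obtain A B C where "(A, B, C) \<in> Syz (e - 1)" "cross_eq A B C g" by (auto simp: K_def)
    then have "cross_eq 0 0 0 g" using min[of "e - 1"] by auto
    then show "g \<in> {0}" using F_nonzero by (auto simp: cross_eq_def)
  qed
  then have "P.dim (K ?D) = 0" using P.dim_eq_0_iff_span[OF fin_span_K] by blast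
  then have "2 * int (codim_K ?D) = ?D * ?D + 3 * ?D + 2"
    using dim_forms[where 'k='k, of ?D] D by (simp add: codim_K_def algebra_simps)
  moreover have "codim_K ?D \<le> codim_K (n + e - sigma)"
    using n by (intro codim_K_mono[OF inf]) auto
  moreover have "int (codim_J n) + int (codim_K (n + e - sigma)) = Q" using codim_J_K n by simp
  moreover have "?D * ?D + 3 * ?D + 2 = (2 * e - sigma) * (2 * e - sigma + 1)" by (simp add: algebra_simps)
  ultimately show "2 * int (codim_J n) \<le> 2 * Q - (2 * e - sigma) * (2 * e - sigma + 1)" by linarith
qed

end

section \<open>A complete intersection inside K\<close>

lemma prime_elem_form_degree_pos:
  assumes p: "prime_elem \<pi>" and f: "form d \<pi>"
  shows "0 < d"
proof -
  have "\<pi> \<noteq> 0" using p by auto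
  then have "0 \<le> d" using form_neg[OF f] by (meson not_le)
  moreover have "d \<noteq> 0"
  proof
    assume "d = 0"
    then obtain c where "\<pi> = const c" using f form_degree_0_const by blast
    then have "\<pi> dvd 1" using const_dvd_1 \<open>\<pi> \<noteq> 0\<close> by auto
    then show False using p by (simp add: prime_elem_def)
  qed
  ultimately show ?thesis by simp
qed

text \<open>Otherwise two different variables would be constant multiples of \<open>\<pi>\<close>.\<close>

lemma prime_elem_form_not_all_vars:
  fixes \<pi> :: "'k::field poly3"
  assumes p: "prime_elem \<pi>" and f: "form d \<pi>"
  shows "\<exists>i. \<not> \<pi> dvd var i"
proof (rule ccontr)
  assume "\<not> (\<exists>i. \<not> \<pi> dvd var i)"
  then have dv: "\<pi> dvd var i" for i by blast
  have ex: "\<exists>a. a \<noteq> 0 \<and> var i = \<pi> * const a" for i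
  proof -
    obtain g where g: "var i = \<pi> * g" using dv[of i] by (rule dvdE)
    have "g \<noteq> 0" "\<pi> \<noteq> 0" using var_neq_0[of i] g by auto
    have "form 1 (\<pi> * g)" by (metis form_var g)
    then have fg: "form (1 - d) g" using form_quotient f \<open>\<pi> \<noteq> 0\<close> by blast
    have "0 \<le> 1 - d" using form_neg[OF fg] \<open>g \<noteq> 0\<close> by (meson not_le)
    then have "1 - d = 0" using prime_elem_form_degree_pos[OF p f] by linarith
    then have "form 0 g" using fg by simp
    then show ?thesis using g \<open>g \<noteq> 0\<close> form_degree_0_const by (metis const_eq_0_iff)
  qed
  obtain a where a: "a \<noteq> 0" "var 0 = \<pi> * const a" using ex by blast
  obtain b where b: "b \<noteq> 0" "var 1 = \<pi> * const b" using ex by blast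
  have "const b * var 0 = const a * (var 1 :: 'k poly3)" unfolding a(2) b(2) by (simp add: algebra_simps)
  then have "single (single 0 1) b = (single (single 1 1) a :: 'k poly3)"
    by (simp add: const_def var_def mult_single)
  then have "lookup (single (single (0::3) (1::nat)) b) (single 0 1)
    = lookup (single (single (1::3) (1::nat)) a) (single 0 1)" by (simp only:)
  moreover have "single (1::3) (1::nat) \<noteq> single 0 1"
    by (metis lookup_single_eq lookup_single_not_eq one_neq_zero)
  ultimately show False using b(1) by (simp add: lookup_single when_def)
qed

lemma principal_proj_prime:
  fixes \<pi> :: "'k::field poly3"
  assumes p: "prime_elem \<pi>" and f: "form d \<pi>"
  shows "proj_prime {f. \<pi> dvd f}"
proof -
  have "\<pi> \<noteq> 0" using p by auto
  then have "d \<ge> 0" using form_neg[OF f] by (meson not_le)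
  then obtain k where k: "d = int k" by (metis nonneg_int_cases)
  have "\<pi> dvd hom_part n f" if dv: "\<pi> dvd f" for f n
  proof -
    obtain g where "f = \<pi> * g" using dv by (rule dvdE)
    then show ?thesis using hom_part_form_mult[of k \<pi> n g] f k by auto
  qed
  moreover have "\<not> \<pi> dvd 1" using p by (simp add: prime_elem_def)
  moreover have "\<pi> dvd f \<or> \<pi> dvd g" if "\<pi> dvd f * g" for f g using p that by (simp add: prime_elem_def)
  ultimately show ?thesis
    using prime_elem_form_not_all_vars[OF p f] by (simp add: proj_prime_def)
qed

lemma not_primitive3_prime:
  fixes F G H :: "'k::field poly3"
  assumes "\<not> primitive3 F G H" "F \<noteq> 0 \<or> G \<noteq> 0 \<or> H \<noteq> 0"
  shows "\<exists>\<pi>. prime_elem \<pi> \<and> \<pi> dvd F \<and> \<pi> dvd G \<and> \<pi> dvd H"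
proof -
  obtain p where p: "p dvd F" "p dvd G" "p dvd H" "\<not> p dvd 1" using assms(1) by (auto simp: primitive3_def)
  then have "p \<noteq> 0" using assms(2) by auto
  from prime_divisor_exists3[OF this p(4)] obtain \<pi> where "prime_elem \<pi>" "\<pi> dvd p" by (elim exE conjE)
  then show ?thesis using p by (meson dvd_trans)
qed

text \<open>Only the finitely many primes \<open>\<pi>\<close> dividing \<open>v\<close> matter. Choose a line that none of them divides. If \<open>\<pi>\<close>
  divides \<open>w\<close>, it does not divide \<open>u\<close>, and so it divides the combination for no scalar; otherwise it does
  so for at most one.\<close>

lemma coprime_combination:
  fixes u v w :: "'k::field poly3"
  assumes inf: "infinite (UNIV :: 'k set)"
    and v: "form d v" "v \<noteq> 0"
    and uw: "\<And>\<pi>. prime_elem \<pi> \<Longrightarrow> \<pi> dvd v \<Longrightarrow> \<not> \<pi> dvd u \<or> \<not> \<pi> dvd w"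
  shows "\<exists>c s. primitive3 (u + const s * (line c ^ n * w)) v 0"
proof -
  obtain P where P: "finite P" "\<And>\<pi>. \<pi> \<in> P \<Longrightarrow> prime_elem \<pi> \<and> \<pi> dvd v"
    "\<And>q. prime_elem q \<Longrightarrow> q dvd v \<Longrightarrow> \<exists>\<pi>\<in>P. \<pi> dvd q"
    using finitely_many_primes_dividing[OF v(2)] by metis
  have "finite {c. \<pi> dvd line c}" if \<pi>: "\<pi> \<in> P" for \<pi>
  proof -
    obtain e where "form e \<pi>" using form_dvd[OF v conjunct2[OF P(2)[OF \<pi>]]] by (elim exE)
    then show ?thesis using finite_lines[OF principal_proj_prime] P(2)[OF \<pi>] by auto
  qed
  then have "finite (\<Union>\<pi>\<in>P. {c. \<pi> dvd line c})" using P(1) by blast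
  then obtain c where c: "\<And>\<pi>. \<pi> \<in> P \<Longrightarrow> \<not> \<pi> dvd line c"
    using ex_new_if_finite[OF inf] by blast
  have "finite {s. \<pi> dvd u + const s * (line c ^ n * w)}" if \<pi>: "\<pi> \<in> P" for \<pi>
  proof (cases "\<pi> dvd w")
    case True
    have "\<not> \<pi> dvd u" using uw[OF conjunct1[OF P(2)[OF \<pi>]] conjunct2[OF P(2)[OF \<pi>]]] True by simp
    moreover have "\<pi> dvd const s * (line c ^ n * w)" for s using True by simp
    ultimately have "{s. \<pi> dvd u + const s * (line c ^ n * w)} = {}"
      using dvd_add_left_iff by auto
    then show ?thesis by simp
  next
    case False
    have pr: "prime_elem \<pi>" by (rule conjunct1[OF P(2)[OF \<pi>]])
    have nd: "\<not> \<pi> dvd line c ^ n * w"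
      using False c[OF \<pi>] pr by (meson prime_elem_dvd_multD prime_elem_dvd_power)
    have "s = t" if st: "\<pi> dvd u + const s * (line c ^ n * w)" "\<pi> dvd u + const t * (line c ^ n * w)" for s t
    proof (rule ccontr)
      assume "s \<noteq> t"
      have "const s = const (s - t) + const t" by (simp flip: const_add)
      then have "(u + const s * (line c ^ n * w)) - (u + const t * (line c ^ n * w)) = const (s - t) * (line c ^ n * w)"
        by (simp add: algebra_simps)
      then have "\<pi> dvd const (s - t) * (line c ^ n * w)" using st by (metis dvd_diff)
      then have "\<pi> dvd const (s - t)" using nd pr by (meson prime_elem_dvd_multD)
      moreover have "const (s - t) dvd 1" using \<open>s \<noteq> t\<close> by (intro const_dvd_1) simp
      ultimately have "\<pi> dvd 1" by (rule dvd_trans)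
      then show False using pr by (simp add: prime_elem_def)
    qed
    then have "{s. \<pi> dvd u + const s * (line c ^ n * w)} \<subseteq> {SOME s. \<pi> dvd u + const s * (line c ^ n * w)}"
      by (auto intro: someI2)
    then show ?thesis by (rule finite_subset) simp
  qed
  then have "finite (\<Union>\<pi>\<in>P. {s. \<pi> dvd u + const s * (line c ^ n * w)})" using P(1) by blast
  then obtain s where s: "\<And>\<pi>. \<pi> \<in> P \<Longrightarrow> \<not> \<pi> dvd u + const s * (line c ^ n * w)"
    using ex_new_if_finite[OF inf] by blast
  have "primitive3 v (u + const s * (line c ^ n * w)) 0"
  proof (rule ccontr)
    assume "\<not> ?thesis"
    from not_primitive3_prime[OF this disjI1[OF v(2)]]
    obtain q where q: "prime_elem q" "q dvd v" "q dvd u + const s * (line c ^ n * w)"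
      by (elim exE conjE)
    obtain \<pi> where "\<pi> \<in> P" "\<pi> dvd q" using P(3)[OF q(1,2)] by (elim bexE)
    then show False using s dvd_trans[OF _ q(3)] by blast
  qed
  then show ?thesis by (auto simp: primitive3_def)
qed

context syz_triple
begin

text \<open>Since \<open>w\<close> has the least degree and \<open>u\<close> the greatest among the entries of \<open>s\<close>, suitable multiples of \<open>w\<close> can
  be added to \<open>u\<close>, and can replace \<open>v\<close> if \<open>v = 0\<close>, such that \<open>K\<close> contains two forms of degrees \<open>e - d1\<close>
  and \<open>e - d2\<close> without common factor. As in Bezout's theorem their ideal has codimension at most
  \<open>(e - d1) * (e - d2)\<close>.\<close>

lemma codim_J_lower:
  assumes inf: "infinite (UNIV :: 'k set)" and F1: "F1 \<noteq> 0" and d: "d1 \<le> d2" "d2 \<le> d3"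
  shows "\<exists>n0. \<forall>n\<ge>n0. Q - (e - d1) * (e - d2) \<le> int (codim_J n)"
proof -
  define v' where "v' = (if v \<noteq> 0 then v else var 0 ^ nat (d3 - d2) * w)"
  have vw: "v \<noteq> 0 \<or> w \<noteq> 0" using s_nonzero rel F1 by auto
  have v'0: "v' \<noteq> 0" using vw by (auto simp: v'_def)
  have "form (int (nat (d3 - d2)) * 1) (var 0 ^ nat (d3 - d2) :: 'k poly3)" by (rule form_power) simp
  then have x_form: "form (d3 - d2) (var 0 ^ nat (d3 - d2) :: 'k poly3)" using d by simp
  have v'K: "v' \<in> K (e - d2)"
    using koszul_in_K(2) K_mult[OF koszul_in_K(3) x_form] by (auto simp: v'_def)
  then have v'_form: "form (e - d2) v'" using K_forms by blast
  have prime_uw: "\<not> \<pi> dvd u \<or> \<not> \<pi> dvd w" if "prime_elem \<pi>" "\<pi> dvd v'" for \<pi>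
  proof (rule ccontr)
    assume "\<not> ?thesis"
    moreover have "\<pi> dvd v" using that by (cases "v = 0") (auto simp: v'_def)
    ultimately have "\<pi> dvd 1" using prim_s by (auto simp: primitive3_def)
    then show False using that by (simp add: prime_elem_def)
  qed
  obtain c s where prim: "primitive3 (u + const s * (line c ^ nat (d3 - d1) * w)) v' 0"
    using coprime_combination[OF inf v'_form v'0 prime_uw] by blast
  define u' where "u' = u + const s * (line c ^ nat (d3 - d1) * w)"
  have "form (int (nat (d3 - d1)) * 1) (line c ^ nat (d3 - d1))" by (rule form_power[OF form_line])
  then have "form (d3 - d1) (const s * line c ^ nat (d3 - d1))" using d by (intro form_const_mult) simp
  then have "const s * line c ^ nat (d3 - d1) * w \<in> K (e - d1)" using K_mult[OF koszul_in_K(3)] by force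
  then have u'K: "u' \<in> K (e - d1)"
    using P.subspace_add[OF subspace_K koszul_in_K(1)] by (simp add: u'_def mult.assoc)
  then have u'_form: "form (e - d1) u'" using K_forms by blast
  have prim': "primitive3 u' v' 0" using prim by (simp add: u'_def)
  have prim'': "primitive3 v' (- u') 0" using prim' by (simp add: primitive3_def)
  \<comment> \<open>Two forms are a triple with third entry \<open>0\<close>; assigning the degree \<open>2 * e - d1 - d2\<close> to it makes the
    Koszul relation of the two forms a syzygy as required.\<close>
  interpret C: syz_triple u' v' 0 "e - d1" "e - d2" "2 * e - d1 - d2" v' "- u'" 0 "2 * e - d1 - d2"
    using u'_form v'_form prim' prim''
    by unfold_locales (auto intro: form_uminus simp: algebra_simps)
  have CQ: "C.Q = (e - d1) * (e - d2)"
    unfolding C.Q_def C.sigma_def by (simp add: power2_eq_square algebra_simps)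
  have CK: "C.J m \<subseteq> K m" for m
  proof
    fix f assume "f \<in> C.J m"
    then obtain A B where f: "f = A * u' + B * v'" "form (m - (e - d1)) A" "form (m - (e - d2)) B"
      by (auto simp: C.J_def)
    have "A * u' \<in> K m" "B * v' \<in> K m" using K_mult[OF u'K f(2)] K_mult[OF v'K f(3)] by auto
    then show "f \<in> K m" using f(1) P.subspace_add[OF subspace_K] by metis
  qed
  show ?thesis
  proof (intro exI allI impI)
    fix n assume n: "n \<ge> max large (C.large - e + sigma)"
    let ?m = "n + e - sigma"
    have "int (C.codim_J ?m) \<le> (e - d1) * (e - d2)" using C.codim_J_le_Q[of ?m] n CQ by simp
    moreover have "codim_K ?m \<le> C.codim_J ?m"
      using P.dim_mono_span[OF fin_span_K CK, of ?m] unfolding codim_K_def C.codim_J_def by linarith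
    moreover have "int (codim_J n) + int (codim_K ?m) = Q" using codim_J_K n by simp
    ultimately show "Q - (e - d1) * (e - d2) \<le> int (codim_J n)" by linarith
  qed
qed

end

section \<open>Stalks and sections on the projective plane\<close>

lemma prime_of_Point: "proj_prime P \<Longrightarrow> prime_of (Point P) = P"
  using Point_inverse by blast

lemma nonzero_outside: "g \<notin> prime_of p \<Longrightarrow> g \<noteq> 0"
  using prime_zero[OF proj_prime_prime_of] by blast

lemma one_outside [simp]: "1 \<notin> prime_of p"
  by (rule prime_one[OF proj_prime_prime_of])

lemma Fract_add_outside:
  assumes "g \<notin> prime_of p" "g' \<notin> prime_of p"
  shows "Fract f g + Fract f' g' = Fract (f * g' + f' * g) (g * g')"
  using nonzero_outside[OF assms(1)] nonzero_outside[OF assms(2)] by simp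

lemma form_nonneg: "form d f \<Longrightarrow> f \<noteq> 0 \<Longrightarrow> \<exists>k. d = int k"
  using form_neg by (metis nonneg_int_cases not_le)

lemma outside_mult: "f \<notin> prime_of p \<Longrightarrow> g \<notin> prime_of p \<Longrightarrow> f * g \<notin> prime_of p"
  using prime_cases[OF proj_prime_prime_of] by blast

lemma open_nonvanishing:
  assumes "form d h" shows "open {q. h \<notin> prime_of q}"
  unfolding open_proj_plane_def using assms by (intro exI[of _ "{h}"]) auto

lemma open_basis:
  assumes "open V" "p \<in> V"
  shows "\<exists>h d. form d h \<and> h \<notin> prime_of p \<and> {q. h \<notin> prime_of q} \<subseteq> V"
  using assms unfolding open_proj_plane_def by blast

lemma Fract_add_same: "c \<noteq> 0 \<Longrightarrow> Fract a c + Fract b c = Fract (a + b) c"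
  by (simp add: eq_fract algebra_simps)

lemma Fract_zero [simp]: "Fract 0 c = 0"
  by (metis Zero_fract_def eq_fract(2) eq_fract(3) mult_zero_left fract_collapse(1))

locale plane_triple = form_triple Fa Fb Fc "int a" "int b" "int c"
  for Fa Fb Fc :: "'k::field poly3" and a b c :: nat
begin

abbreviation I :: "'k proj_plane \<Rightarrow> 'k poly3 fract set" where
  "I p \<equiv> I_stalk a b c Fa Fb Fc p"

abbreviation lifts :: "('k proj_plane \<Rightarrow> 'k poly3 fract) set" where
  "lifts \<equiv> OT_lifts a b c Fa Fb Fc"

abbreviation null_lifts :: "('k proj_plane \<Rightarrow> 'k poly3 fract) set" where
  "null_lifts \<equiv> OT_null a b c Fa Fb Fc"

text \<open>Bring the three fractions to a common denominator.\<close>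

lemma I_iff: "x \<in> I p \<longleftrightarrow> (\<exists>d f g. f \<in> J d \<and> form d g \<and> g \<notin> prime_of p \<and> x = Fract f g)"
proof
  assume "x \<in> I p"
  then obtain f1 g1 e1 f2 g2 e2 f3 g3 e3 where
    x: "x = emb Fa * Fract f1 g1 + emb Fb * Fract f2 g2 + emb Fc * Fract f3 g3"
    and f: "form (- int a + e1) f1" "form (- int b + e2) f2" "form (- int c + e3) f3"
    and g: "form e1 g1" "form e2 g2" "form e3 g3"
    and n: "g1 \<notin> prime_of p" "g2 \<notin> prime_of p" "g3 \<notin> prime_of p"
    unfolding I_stalk_def O_stalk_def by blast
  let ?f = "(f1 * (g2 * g3)) * Fa + (f2 * (g1 * g3)) * Fb + (f3 * (g1 * g2)) * Fc"
  have "g1 \<noteq> 0" "g2 \<noteq> 0" "g3 \<noteq> 0" using n nonzero_outside by blast+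
  then have "x = Fract ?f (g1 * (g2 * g3))" unfolding x by (simp add: eq_fract algebra_simps)
  moreover have "form (e1 + (e2 + e3) - int a) (f1 * (g2 * g3))"
    "form (e1 + (e2 + e3) - int b) (f2 * (g1 * g3))" "form (e1 + (e2 + e3) - int c) (f3 * (g1 * g2))"
    using form_mult[OF f(1) form_mult[OF g(2) g(3)]] form_mult[OF f(2) form_mult[OF g(1) g(3)]]
      form_mult[OF f(3) form_mult[OF g(1) g(2)]] by (simp_all add: algebra_simps)
  then have "?f \<in> J (e1 + (e2 + e3))" unfolding J_def by blast
  moreover have "form (e1 + (e2 + e3)) (g1 * (g2 * g3))" by (intro form_mult g)
  moreover have "g1 * (g2 * g3) \<notin> prime_of p" by (intro outside_mult n)
  ultimately show "\<exists>d f g. f \<in> J d \<and> form d g \<and> g \<notin> prime_of p \<and> x = Fract f g" by blast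
next
  assume "\<exists>d f g. f \<in> J d \<and> form d g \<and> g \<notin> prime_of p \<and> x = Fract f g"
  then obtain d A B C g where A: "form (d - int a) A" "form (d - int b) B" "form (d - int c) C"
    and g: "form d g" "g \<notin> prime_of p" and x: "x = Fract (A * Fa + B * Fb + C * Fc) g"
    by (auto simp: J_def)
  have "x = emb Fa * Fract A g + emb Fb * Fract B g + emb Fc * Fract C g"
    using nonzero_outside[OF g(2)] unfolding x by (simp add: eq_fract algebra_simps)
  moreover have "Fract A g \<in> O_stalk (- int a) p" "Fract B g \<in> O_stalk (- int b) p" "Fract C g \<in> O_stalk (- int c) p"
    using A g unfolding O_stalk_def by (auto simp: algebra_simps)
  ultimately show "x \<in> I p" unfolding I_stalk_def by blast
qed

lemma I_zero: "0 \<in> I p"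
  unfolding I_iff using P.subspace_0[OF subspace_J] prime_one[OF proj_prime_prime_of] form_1 Fract_zero by metis

lemma I_add:
  assumes "x \<in> I p" "y \<in> I p" shows "x + y \<in> I p"
proof -
  obtain d f g d' f' g' where x: "f \<in> J d" "form d g" "g \<notin> prime_of p" "x = Fract f g"
    and y: "f' \<in> J d'" "form d' g'" "g' \<notin> prime_of p" "y = Fract f' g'"
    using assms by (auto simp: I_iff)
  have "x + y = Fract (g' * f + g * f') (g * g')"
    using Fract_add_outside[OF x(3) y(3), of f f'] unfolding x(4) y(4) by (simp add: mult.commute)
  moreover have "g' * f \<in> J (d + d')" "g * f' \<in> J (d + d')"
    using J_mult[OF x(1) y(2)] J_mult[OF y(1) x(2)] by (simp_all add: add.commute)
  then have "g' * f + g * f' \<in> J (d + d')" by (rule P.subspace_add[OF subspace_J])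
  ultimately show ?thesis using form_mult[OF x(2) y(2)] outside_mult[OF x(3) y(3)] unfolding I_iff by blast
qed

lemma I_mult:
  assumes "x \<in> I p" "y \<in> O_stalk 0 p" shows "y * x \<in> I p"
proof -
  obtain d f g where x: "f \<in> J d" "form d g" "g \<notin> prime_of p" "x = Fract f g"
    using assms(1) by (auto simp: I_iff)
  obtain e h k where y: "form e h" "form e k" "k \<notin> prime_of p" "y = Fract h k"
    using assms(2) by (auto simp: O_stalk_def)
  have "y * x = Fract (h * f) (k * g)" by (simp add: x y)
  then show ?thesis
    using J_mult[OF x(1) y(1)] form_mult[OF y(2) x(2)] outside_mult[OF y(3) x(3)] unfolding I_iff by blast
qed

lemma O_stalk_Fract: "form d f \<Longrightarrow> form d g \<Longrightarrow> g \<notin> prime_of p \<Longrightarrow> Fract f g \<in> O_stalk 0 p"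
  unfolding O_stalk_def by force

lemma I_uminus: "x \<in> I p \<Longrightarrow> - x \<in> I p"
proof -
  assume x: "x \<in> I p"
  have "Fract (- 1) 1 \<in> O_stalk 0 p"
    by (rule O_stalk_Fract[of 0]) (auto intro: form_uminus)
  from I_mult[OF x this] show ?thesis by (simp add: One_fract_def[symmetric] flip: minus_fract)
qed

lemma I_diff: "x \<in> I p \<Longrightarrow> y \<in> I p \<Longrightarrow> x - y \<in> I p"
  using I_add[of x p "- y"] I_uminus[of y p] by simp

lemma I_sub_O_stalk: "x \<in> I p \<Longrightarrow> x \<in> O_stalk 0 p"
  using J_forms O_stalk_Fract unfolding I_iff by blast

lemma O_stalk_add: "x \<in> O_stalk 0 p \<Longrightarrow> y \<in> O_stalk 0 p \<Longrightarrow> x + y \<in> O_stalk 0 p"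
proof -
  assume "x \<in> O_stalk 0 p" "y \<in> O_stalk 0 p"
  then obtain e h k e' h' k' where x: "form e h" "form e k" "k \<notin> prime_of p" "x = Fract h k"
    and y: "form e' h'" "form e' k'" "k' \<notin> prime_of p" "y = Fract h' k'" by (auto simp: O_stalk_def)
  have "x + y = Fract (h * k' + h' * k) (k * k')" using Fract_add_outside[OF x(3) y(3)] x(4) y(4) by simp
  moreover have "form (e + e') (h * k' + h' * k)"
    using form_mult[OF x(1) y(2)] form_mult[OF y(1) x(2)] by (auto intro: form_add simp: add.commute)
  ultimately show ?thesis using O_stalk_Fract form_mult[OF x(2) y(2)] outside_mult[OF x(3) y(3)] by metis
qed

text \<open>Away from \<open>T\<close> some homogeneous element of \<open>J\<close> is invertible in the local ring.\<close>

lemma I_eq_O_stalk: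
  assumes "\<not> J_all \<subseteq> prime_of p" "x \<in> O_stalk 0 p" shows "x \<in> I p"
proof -
  obtain h where h: "h \<in> J_all" "h \<notin> prime_of p" using assms(1) by blast
  obtain d where d: "hom_part d h \<notin> prime_of p"
    using top_part_outside[OF proj_prime_hom_ideal[OF proj_prime_prime_of] h(2)] by blast
  have hJ: "hom_part d h \<in> J (int d)" by (rule hom_part_J_all[OF h(1)])
  obtain e f g where x: "form e f" "form e g" "g \<notin> prime_of p" "x = Fract f g"
    using assms(2) by (auto simp: O_stalk_def)
  have "x = Fract (f * hom_part d h) (g * hom_part d h)"
    using nonzero_outside[OF d] nonzero_outside[OF x(3)] by (simp add: x eq_fract)
  then show ?thesis
    using J_mult[OF hJ x(1)] form_mult[OF x(2) form_hom_part] outside_mult[OF x(3) d] unfolding I_iff by blast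
qed

text \<open>Modulo the ideal sheaf, \<open>s\<close> is a single fraction on the basic open neighbourhood \<open>h \<noteq> 0\<close> of \<open>p\<close>.\<close>

definition fraction_near :: "('k proj_plane \<Rightarrow> 'k poly3 fract) \<Rightarrow> 'k proj_plane \<Rightarrow> bool" where
  "fraction_near s p \<longleftrightarrow>
    (\<exists>h e f g d. form e h \<and> h \<notin> prime_of p \<and> form d f \<and> form d g \<and>
       (\<forall>q. h \<notin> prime_of q \<longrightarrow> g \<notin> prime_of q \<and> s q - Fract f g \<in> I q))"

lemma fraction_nearI:
  assumes "form e h" "h \<notin> prime_of p" "form d f" "form d g"
    and "\<And>q. h \<notin> prime_of q \<Longrightarrow> g \<notin> prime_of q \<and> s q - Fract f g \<in> I q"
  shows "fraction_near s p"
  using assms unfolding fraction_near_def by blast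

lemma fraction_nearE:
  assumes "fraction_near s p"
  obtains e h d f g where "form e h" "h \<notin> prime_of p" "form d f" "form d g"
    "\<And>q. h \<notin> prime_of q \<Longrightarrow> g \<notin> prime_of q \<and> s q - Fract f g \<in> I q"
  using assms unfolding fraction_near_def by blast

lemma OT_lifts_iff: "s \<in> lifts \<longleftrightarrow> (\<forall>p. fraction_near s p)"
proof
  assume s: "s \<in> lifts"
  show "\<forall>p. fraction_near s p"
  proof
    fix p
    obtain V \<sigma> where V: "open V" "p \<in> V" "\<sigma> \<in> O_sections 0 V" "\<And>q. q \<in> V \<Longrightarrow> s q - \<sigma> q \<in> I q"
      using s unfolding OT_lifts_def by blast
    obtain W f g d where W: "open W" "p \<in> W" "W \<subseteq> V" "form d f" "form d g"
      "\<And>q. q \<in> W \<Longrightarrow> g \<notin> prime_of q \<and> \<sigma> q = Fract f g"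
      using V(2,3) unfolding O_sections_def by auto
    obtain h e where h: "form e h" "h \<notin> prime_of p" "{q. h \<notin> prime_of q} \<subseteq> W"
      using open_basis[OF W(1,2)] by blast
    have "g \<notin> prime_of q \<and> s q - Fract f g \<in> I q" if "h \<notin> prime_of q" for q
      using that h(3) W(3,6) V(4) by (metis (mono_tags, lifting) mem_Collect_eq subsetD)
    then show "fraction_near s p" by (rule fraction_nearI[OF h(1,2) W(4,5)])
  qed
next
  assume R: "\<forall>p. fraction_near s p"
  show "s \<in> lifts"
    unfolding OT_lifts_def
  proof (intro CollectI allI)
    fix p
    obtain e h d f g where h: "form e h" "h \<notin> prime_of p" "form d f" "form d g"
      "\<And>q. h \<notin> prime_of q \<Longrightarrow> g \<notin> prime_of q \<and> s q - Fract f g \<in> I q"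
      using spec[OF R, of p] unfolding fraction_near_def by blast
    let ?V = "{q. h \<notin> prime_of q}"
    let ?\<sigma> = "\<lambda>q. if q \<in> ?V then Fract f g else 0"
    have V: "open ?V" "p \<in> ?V" using open_nonvanishing h by auto
    have "?\<sigma> \<in> O_sections 0 ?V"
    proof -
      have "open ?V \<and> ?V \<subseteq> ?V \<and> form (0 + d) f \<and> form d g \<and> (\<forall>q\<in>?V. g \<notin> prime_of q \<and> ?\<sigma> q = Fract f g)"
        using V h by auto
      then show ?thesis unfolding O_sections_def by (intro CollectI conjI ballI) (blast, simp)
    qed
    moreover have "\<forall>q\<in>?V. s q - ?\<sigma> q \<in> I q" using h(5) by auto
    ultimately show "\<exists>V \<sigma>. open V \<and> p \<in> V \<and> \<sigma> \<in> O_sections 0 V \<and> (\<forall>q\<in>V. s q - \<sigma> q \<in> I q)"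
      using V by blast
  qed
qed

end

interpretation sec: vector_space "scale_sec :: 'k::field \<Rightarrow> _"
  by (rule vector_space_scale_sec)

interpretation sec: vsp "scale_sec :: 'k::field \<Rightarrow> _" ..

interpretation Psec: vector_space_pair "pscale :: 'k::field \<Rightarrow> _" "scale_sec :: 'k::field \<Rightarrow> _" ..

context plane_triple
begin

lemma subspace_null: "sec.subspace (null_lifts)"
proof -
  have "emb (const k) * x \<in> I p" if "x \<in> I p" for k x p
    using that by (intro I_mult O_stalk_Fract[of 0]) auto
  then show ?thesis
    by (auto simp: sec.subspace_def OT_null_def scale_sec_def I_zero intro: I_add)
qed

lemma null_sub_lifts: "null_lifts \<subseteq> lifts"
proof
  fix s assume s: "s \<in> null_lifts"
  show "s \<in> lifts"
    unfolding OT_lifts_iff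
  proof
    fix p
    show "fraction_near s p"
      by (rule fraction_nearI[of 0 1 _ 0 0 1]) (use s in \<open>auto simp: OT_null_def\<close>)
  qed
qed

lemma subspace_lifts: "sec.subspace (lifts)"
  unfolding sec.subspace_def
proof (intro conjI ballI allI)
  show "0 \<in> lifts"
    using null_sub_lifts sec.subspace_0[OF subspace_null] by blast
next
  fix s t assume st: "s \<in> lifts" "t \<in> lifts"
  show "s + t \<in> lifts"
    unfolding OT_lifts_iff
  proof
    fix p
    obtain h e f g d where h: "form e h" "h \<notin> prime_of p" "form d f" "form d g"
      "\<And>q. h \<notin> prime_of q \<Longrightarrow> g \<notin> prime_of q \<and> s q - Fract f g \<in> I q"
      using st(1) fraction_nearE unfolding OT_lifts_iff by metis
    obtain h' e' f' g' d' where h': "form e' h'" "h' \<notin> prime_of p" "form d' f'" "form d' g'"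
      "\<And>q. h' \<notin> prime_of q \<Longrightarrow> g' \<notin> prime_of q \<and> t q - Fract f' g' \<in> I q"
      using st(2) fraction_nearE unfolding OT_lifts_iff by metis
    have "g * g' \<notin> prime_of q \<and> (s + t) q - Fract (f * g' + f' * g) (g * g') \<in> I q"
      if q: "h * h' \<notin> prime_of q" for q
    proof -
      have "h \<notin> prime_of q" "h' \<notin> prime_of q"
        using q prime_multL[OF proj_prime_prime_of] prime_multR[OF proj_prime_prime_of] by blast+
      then have g: "g \<notin> prime_of q" "g' \<notin> prime_of q"
        and st: "s q - Fract f g \<in> I q" "t q - Fract f' g' \<in> I q" using h h' by blast+
      have eq: "(s q - Fract f g) + (t q - Fract f' g') = (s + t) q - Fract (f * g' + f' * g) (g * g')"
        unfolding Fract_add_outside[OF g, symmetric] by (simp add: algebra_simps del: add_fract)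
      show ?thesis using I_add[OF st] outside_mult[OF g] unfolding eq by blast
    qed
    moreover have "form (d + d') (f * g' + f' * g)"
      using form_mult[OF h(3) h'(4)] form_mult[OF h'(3) h(4)] by (auto intro: form_add simp: add.commute)
    ultimately show "fraction_near (s + t) p"
      using fraction_nearI[OF form_mult[OF h(1) h'(1)] outside_mult[OF h(2) h'(2)] _ form_mult[OF h(4) h'(4)]]
      by blast
  qed
next
  fix k s assume s: "s \<in> lifts"
  show "scale_sec k s \<in> lifts"
    unfolding OT_lifts_iff
  proof
    fix p
    obtain h e f g d where h: "form e h" "h \<notin> prime_of p" "form d f" "form d g"
      "\<And>q. h \<notin> prime_of q \<Longrightarrow> g \<notin> prime_of q \<and> s q - Fract f g \<in> I q"
      using s fraction_nearE unfolding OT_lifts_iff by metis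
    have "g \<notin> prime_of q \<and> scale_sec k s q - Fract (const k * f) g \<in> I q" if "h \<notin> prime_of q" for q
    proof -
      have "emb (const k) * (s q - Fract f g) \<in> I q"
        using h(5)[OF that] by (intro I_mult O_stalk_Fract[of 0]) auto
      then show ?thesis using h(5)[OF that] by (simp add: scale_sec_def right_diff_distrib)
    qed
    then show "fraction_near (scale_sec k s) p"
      by (rule fraction_nearI[OF h(1,2) form_const_mult[OF h(3)] h(4)])
  qed
qed

text \<open>A prime that contains both the forms and the line would contain a large power of every variable.\<close>

lemma misses_not_subset:
  assumes "misses l n0" and "l \<in> prime_of p" shows "\<not> J_all \<subseteq> prime_of p"
proof
  assume J: "J_all \<subseteq> prime_of p"
  obtain i where i: "var i \<notin> prime_of p" using prime_var[OF proj_prime_prime_of] by blast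
  let ?n = "nat (max n0 0)"
  have "form (int ?n * 1) (var i ^ ?n)" by (rule form_power) simp
  then have "form (int ?n) (var i ^ ?n)" by simp
  then obtain q where "var i ^ ?n - l * q \<in> J (int ?n)"
    using assms(1) unfolding misses_def by (metis int_nat_eq max.cobounded1 max.cobounded2)
  then have "var i ^ ?n - l * q \<in> prime_of p" using J J_sub_J_all by blast
  then have "var i ^ ?n - l * q + l * q \<in> prime_of p"
    using prime_add[OF proj_prime_prime_of] prime_multR[OF proj_prime_prime_of assms(2)] by blast
  then show False using prime_power[OF proj_prime_prime_of i] by simp
qed

end

section \<open>The degree of T is the stable codimension\<close>

context plane_triple
begin

lemma Fract_in_I: "f \<in> J d \<Longrightarrow> form d g \<Longrightarrow> g \<notin> prime_of p \<Longrightarrow> Fract f g \<in> I p"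
  unfolding I_iff by blast

lemma power_outside: "l \<notin> prime_of p \<Longrightarrow> l ^ n \<notin> prime_of p"
  by (rule prime_power[OF proj_prime_prime_of])

text \<open>If \<open>f / l ^ n\<close> vanishes in every stalk of \<open>O_T\<close>, the ideal of all \<open>h\<close> with \<open>h * f \<in> J\<close> lies in no
  homogeneous prime that avoids \<open>l\<close>, so it contains a power of \<open>l\<close>.\<close>

lemma locally_in_J:
  assumes l: "form 1 l" and f: "form (int n) f"
    and loc: "\<And>p. l \<notin> prime_of p \<Longrightarrow> Fract f (l ^ n) \<in> I p"
  shows "\<exists>k. l ^ k * f \<in> J_all"
proof -
  let ?A = "{h. h * f \<in> J_all}"
  have "hom_ideal ?A"
    unfolding hom_ideal_def
  proof (intro conjI ballI allI)
    show "0 \<in> ?A" using hom_ideal_J_all by (simp add: hom_ideal_def)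
  next
    fix g h assume "g \<in> ?A" "h \<in> ?A"
    then show "g + h \<in> ?A" using hom_ideal_J_all by (simp add: hom_ideal_def distrib_right)
  next
    fix g h assume "h \<in> ?A"
    then show "g * h \<in> ?A" using hom_ideal_J_all by (simp add: hom_ideal_def mult.assoc)
  next
    fix h d assume "h \<in> ?A"
    then have "hom_part (d + n) (f * h) \<in> J_all" using hom_ideal_J_all by (simp add: hom_ideal_def mult.commute)
    then show "hom_part d h \<in> ?A" using hom_part_form_mult[OF f, of "d + n" h] by (simp add: mult.commute)
  qed
  show ?thesis
  proof (rule ccontr)
    assume "\<not> ?thesis"
    then have "l ^ k \<notin> ?A" for k by simp
    then obtain P where P: "proj_prime P" "?A \<subseteq> P" "l \<notin> P"
      using homogeneous_prime_avoiding[OF \<open>hom_ideal ?A\<close> l] by auto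
    then have pt: "prime_of (Point P) = P" by (simp add: prime_of_Point)
    then have "Fract f (l ^ n) \<in> I (Point P)" using loc P by simp
    then obtain d j g where g: "j \<in> J d" "form d g" "g \<notin> P" "Fract f (l ^ n) = Fract j g"
      unfolding I_iff pt by blast
    have "l ^ n \<noteq> 0" "g \<noteq> 0" using power_outside[of l "Point P" n] nonzero_outside P g pt by metis+
    then have "g * f = l ^ n * j" using g(4) by (simp add: eq_fract algebra_simps)
    moreover have "l ^ n * j \<in> J_all" using g(1) J_sub_J_all hom_ideal_J_all unfolding hom_ideal_def by blast
    ultimately have "g \<in> ?A" by simp
    then show False using P g by blast
  qed
qed

text \<open>In large degrees every form is \<open>l\<close> times a form, modulo \<open>J\<close>; iterate this.\<close>

lemma descend:
  assumes m: "misses l n0" and n: "n \<ge> n0" and l: "form 1 l"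
  shows "form (n + int k) g \<Longrightarrow> \<exists>f. form n f \<and> g - l ^ k * f \<in> J (n + int k)"
proof (induction k arbitrary: g)
  case 0
  then show ?case using P.subspace_0[OF subspace_J] by (intro exI[of _ g]) simp
next
  case (Suc k)
  have "n0 \<le> n + int (Suc k)" using n by simp
  then obtain q where q: "form (n + int (Suc k) - 1) q" "g - l * q \<in> J (n + int (Suc k))"
    using m Suc.prems unfolding misses_def by blast
  then obtain f where f: "form n f" "q - l ^ k * f \<in> J (n + int k)"
    using Suc.IH[of q] by (auto simp: algebra_simps)
  have "l * (q - l ^ k * f) \<in> J (1 + (n + int k))" by (rule J_mult[OF f(2) l])
  then have "l * (q - l ^ k * f) \<in> J (n + int (Suc k))" by (simp add: algebra_simps)
  from P.subspace_add[OF subspace_J q(2) this] have "g - l ^ Suc k * f \<in> J (n + int (Suc k))"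
    by (simp add: algebra_simps)
  then show ?case using f by blast
qed

text \<open>On the finite scheme \<open>T\<close> a form \<open>h\<close> is nilpotent wherever it vanishes: the spaces
  \<open>J + h ^ i S\<close> of forms of a fixed large degree form a descending chain, whose length is bounded by the
  codimension of \<open>J\<close>, so that two successive ones agree.\<close>

lemma nilpotent_where_zero:
  assumes l: "form 1 l" and h: "form (int E) h" "E > 0"
    and stable: "\<And>n. n \<ge> n2 \<Longrightarrow> codim_J n = t"
  shows "\<exists>i. \<forall>q. l \<notin> prime_of q \<longrightarrow> h \<in> prime_of q \<longrightarrow> Fract (h ^ i) (l ^ (E * i)) \<in> I q"
proof -
  \<comment> \<open>More than \<open>t\<close> steps, and a degree that is large enough for the codimension to be \<open>t\<close>.\<close>
  define R where "R = nat n2 + t + 1"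
  define M where "M = E * R"
  have "R \<le> M" using h(2) by (simp add: M_def)
  then have "int M \<ge> n2" by (simp add: R_def)
  then have cod: "codim_J (int M) = t" by (rule stable)
  define W where "W i = {h ^ i * k + g | k g. form (int (M - E * i)) k \<and> g \<in> J (int M)}" for i
  have Wsub: "P.subspace (W i)" "W i \<subseteq> forms (int M)" if "i \<le> R" for i
  proof -
    have "E * i \<le> M" using that by (simp add: M_def)
    then have e: "int (M - E * i) + int i * int E = int M" by (simp add: of_nat_diff algebra_simps)
    have hi: "form (int i * int E) (h ^ i)" by (rule form_power[OF h(1)])
    have JM: "J (int M) \<subseteq> forms (int (M - E * i) + int i * int E)" unfolding e by (rule J_forms)
    show "P.subspace (W i)" "W i \<subseteq> forms (int M)"
      using subspace_sums_forms[OF hi subspace_J JM] unfolding W_def e by auto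
  qed
  have Wfin: "fin_span pscale (W i)" if "i \<le> R" for i
    using P.fin_span_mono[OF fin_span_forms Wsub(2)[OF that]] .
  have JW: "J (int M) \<subseteq> W i" for i
  proof
    fix g assume "g \<in> J (int M)"
    then have "g = h ^ i * 0 + g \<and> form (int (M - E * i)) 0 \<and> g \<in> J (int M)" by simp
    then show "g \<in> W i" unfolding W_def by blast
  qed
  have WW: "W (Suc i) \<subseteq> W i" if "Suc i \<le> R" for i
  proof
    fix x assume "x \<in> W (Suc i)"
    then obtain k g where x: "x = h ^ Suc i * k + g" "form (int (M - E * Suc i)) k" "g \<in> J (int M)"
      unfolding W_def by blast
    have "E * Suc i \<le> M" unfolding M_def using that by (rule mult_le_mono2)
    then have "int E + int (M - E * Suc i) = int (M - E * i)" by (simp add: of_nat_diff algebra_simps)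
    then have "form (int (M - E * i)) (h * k)" using form_mult[OF h(1) x(2)] by simp
    moreover have "x = h ^ i * (h * k) + g" using x(1) by (simp add: mult.assoc mult.left_commute)
    ultimately show "x \<in> W i" using x(3) unfolding W_def by blast
  qed
  have "\<exists>i<R. W i \<subseteq> W (Suc i)"
  proof (rule ccontr)
    assume no: "\<not> ?thesis"
    have step: "P.dim (W (Suc i)) < P.dim (W i)" if "i < R" for i
    proof (rule ccontr)
      assume "\<not> ?thesis"
      then have "W (Suc i) = W i"
        using P.subspace_eq_if_dim_ge[OF Wfin Wsub(1) WW] that by simp
      then show False using no that by blast
    qed
    have "i \<le> R \<Longrightarrow> P.dim (W i) + i \<le> P.dim (W 0)" for i
    proof (induction i)
      case (Suc i) then show ?case using step[of i] by auto
    qed simp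
    from this[of R] have "P.dim (W R) + R \<le> P.dim (W 0)" by simp
    moreover have "P.dim (J (int M)) \<le> P.dim (W R)" by (rule P.dim_mono_span[OF Wfin JW]) simp
    moreover have "P.dim (W 0) \<le> P.dim (forms (int M) :: 'k poly3 set)"
      by (rule P.dim_mono_span[OF fin_span_forms Wsub(2)]) simp
    ultimately show False using cod unfolding codim_J_def R_def by linarith
  qed
  then obtain i where i: "i < R" "W i \<subseteq> W (Suc i)" by blast
  let ?l = "l ^ (M - E * i)"
  have "E * Suc i \<le> M" unfolding M_def by (rule mult_le_mono2) (use i in simp)
  have lf: "form (int (M - E * i)) ?l" using form_power[OF l, of "M - E * i"] by simp
  then have "h ^ i * ?l + 0 \<in> W i" using P.subspace_0[OF subspace_J] unfolding W_def by blast
  then obtain k g where k: "h ^ i * ?l + 0 = h ^ Suc i * k + g" "form (int (M - E * Suc i)) k" "g \<in> J (int M)"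
    using i(2) unfolding W_def by blast
  have kk: "h ^ i * (?l - h * k) = g" using k(1) by (simp add: algebra_simps)
  have "int E + int (M - E * Suc i) = int (M - E * i)"
    using \<open>E * Suc i \<le> M\<close> by (simp add: of_nat_diff algebra_simps)
  then have hk: "form (int (M - E * i)) (h * k)" using form_mult[OF h(1) k(2)] by simp
  have "Fract (h ^ i) (l ^ (E * i)) \<in> I q" if q: "l \<notin> prime_of q" "h \<in> prime_of q" for q
  proof -
    have out: "?l - h * k \<notin> prime_of q"
    proof
      assume "?l - h * k \<in> prime_of q"
      then have "?l - h * k + h * k \<in> prime_of q"
        using prime_add[OF proj_prime_prime_of] prime_multR[OF proj_prime_prime_of q(2)] by blast
      then show False using power_outside[OF q(1)] by simp
    qed
    have "Fract (h ^ i) (l ^ (E * i)) = Fract (h ^ i * (?l - h * k)) (l ^ (E * i) * (?l - h * k))"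
      using nonzero_outside[OF out] nonzero_outside[OF power_outside[OF q(1)]] by (simp add: eq_fract)
    also have "\<dots> = Fract g (l ^ (E * i) * (?l - h * k))" unfolding kk ..
    also have "\<dots> \<in> I q"
    proof (rule Fract_in_I[OF k(3)])
      have "form (int (E * i)) (l ^ (E * i))" using form_power[OF l, of "E * i"] by simp
      from form_mult[OF this form_diff[OF lf hk]]
      have "form (int (E * i) + int (M - E * i)) (l ^ (E * i) * (?l - h * k))" .
      moreover have "int (E * i) + int (M - E * i) = int M" using \<open>E * Suc i \<le> M\<close> by (simp add: of_nat_diff)
      ultimately show "form (int M) (l ^ (E * i) * (?l - h * k))" by simp
      show "l ^ (E * i) * (?l - h * k) \<notin> prime_of q" by (rule outside_mult[OF power_outside[OF q(1)] out])
    qed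
    finally show ?thesis .
  qed
  then show ?thesis by blast
qed

lemma lift_in_O_stalk:
  assumes "s \<in> lifts" shows "s q \<in> O_stalk 0 q"
proof -
  obtain h d f g where h: "h \<notin> prime_of q" "form d f" "form d g"
    "\<And>q. h \<notin> prime_of q \<Longrightarrow> g \<notin> prime_of q \<and> s q - Fract f g \<in> I q"
    using assms fraction_nearE unfolding OT_lifts_iff by metis
  have "(s q - Fract f g) + Fract f g \<in> O_stalk 0 q"
    using h(1) h(4)[of q] by (intro O_stalk_add I_sub_O_stalk O_stalk_Fract[OF h(2,3)]) auto
  then show ?thesis by simp
qed

text \<open>Every section of \<open>O_T\<close> is a fraction with a power of \<open>l\<close> as denominator. Such a fraction exists
  for \<open>h\<close> times the section as soon as \<open>h\<close> lies in a certain homogeneous ideal, and this ideal lies in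
  no homogeneous prime \<open>p\<close> that avoids \<open>l\<close>, as the section is a fraction near \<open>p\<close>.\<close>

lemma global_fraction:
  assumes l: "form 1 l" and stable: "\<And>n. n \<ge> n2 \<Longrightarrow> codim_J n = t"
    and s: "s \<in> lifts"
  shows "\<exists>N f. form (int N) f \<and> (\<forall>q. l \<notin> prime_of q \<longrightarrow> s q - Fract f (l ^ N) \<in> I q)"
proof -
  \<comment> \<open>the forms \<open>h\<close> of degree \<open>d\<close> for which \<open>h / l ^ d\<close> times the section is a fraction as desired\<close>
  define B where "B d = {h. form (int d) h \<and> (\<exists>N f. form (int N) f \<and>
      (\<forall>q. l \<notin> prime_of q \<longrightarrow> Fract h (l ^ d) * s q - Fract f (l ^ N) \<in> I q))}" for d
  have lp: "form (int n) (l ^ n)" for n using form_power[OF l, of n] by simp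
  have BI: "h \<in> B d" if "form (int d) h" "form (int N) f"
    "\<And>q. l \<notin> prime_of q \<Longrightarrow> Fract h (l ^ d) * s q - Fract f (l ^ N) \<in> I q" for d h N f
    using that unfolding B_def by blast
  have B0: "0 \<in> B d" for d by (rule BI[of _ _ 0 0]) (auto simp: I_zero)
  have Badd: "h + h' \<in> B d" if hh: "h \<in> B d" "h' \<in> B d" for h h' d
  proof -
    obtain N f where f: "form (int d) h" "form (int N) f"
      "\<And>q. l \<notin> prime_of q \<Longrightarrow> Fract h (l ^ d) * s q - Fract f (l ^ N) \<in> I q"
      using hh(1) unfolding B_def by blast
    obtain N' f' where f': "form (int d) h'" "form (int N') f'"
      "\<And>q. l \<notin> prime_of q \<Longrightarrow> Fract h' (l ^ d) * s q - Fract f' (l ^ N') \<in> I q"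
      using hh(2) unfolding B_def by blast
    show ?thesis
    proof (rule BI)
      show "form (int d) (h + h')" by (rule form_add[OF f(1) f'(1)])
      show "form (int (N + N')) (f * l ^ N' + f' * l ^ N)"
        using form_mult[OF f(2) lp[of N']] form_mult[OF f'(2) lp[of N]]
        by (auto intro: form_add simp: add.commute)
      fix q assume q: "l \<notin> prime_of q"
      have "Fract (h + h') (l ^ d) = Fract h (l ^ d) + Fract h' (l ^ d)"
        using Fract_add_same[OF nonzero_outside[OF power_outside[OF q]]] by simp
      moreover have "Fract (f * l ^ N' + f' * l ^ N) (l ^ (N + N')) = Fract f (l ^ N) + Fract f' (l ^ N')"
        using Fract_add_outside[OF power_outside[OF q] power_outside[OF q], of f N f' N'] by (simp add: power_add)
      ultimately have "Fract (h + h') (l ^ d) * s q - Fract (f * l ^ N' + f' * l ^ N) (l ^ (N + N'))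
        = (Fract h (l ^ d) * s q - Fract f (l ^ N)) + (Fract h' (l ^ d) * s q - Fract f' (l ^ N'))"
        by (simp only: algebra_simps)
      then show "Fract (h + h') (l ^ d) * s q - Fract (f * l ^ N' + f' * l ^ N) (l ^ (N + N')) \<in> I q"
        using I_add[OF f(3)[OF q] f'(3)[OF q]] by simp
    qed
  qed
  have Bmult: "k * h \<in> B (e + d)" if hk: "form (int e) k" "h \<in> B d" for k h e d
  proof -
    obtain N f where f: "form (int d) h" "form (int N) f"
      "\<And>q. l \<notin> prime_of q \<Longrightarrow> Fract h (l ^ d) * s q - Fract f (l ^ N) \<in> I q"
      using hk(2) unfolding B_def by blast
    show ?thesis
    proof (rule BI)
      show "form (int (e + d)) (k * h)" using form_mult[OF hk(1) f(1)] by simp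
      show "form (int (e + N)) (k * f)" using form_mult[OF hk(1) f(2)] by simp
      fix q assume q: "l \<notin> prime_of q"
      have "Fract k (l ^ e) * (Fract h (l ^ d) * s q - Fract f (l ^ N)) \<in> I q"
        by (rule I_mult[OF f(3)[OF q] O_stalk_Fract[OF hk(1) lp power_outside[OF q]]])
      then show "Fract (k * h) (l ^ (e + d)) * s q - Fract (k * f) (l ^ (e + N)) \<in> I q"
        by (simp add: right_diff_distrib power_add flip: mult.assoc)
    qed
  qed
  define A where "A = {h. \<forall>d. hom_part d h \<in> B d}"
  have Bsum: "(\<Sum>i\<in>S. f i) \<in> B d" if "\<And>i. i \<in> S \<Longrightarrow> f i \<in> B d" for f and S :: "nat set" and d
    using that by (induction S rule: infinite_finite_induct) (auto simp: B0 intro: Badd)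
  have BA: "x \<in> A" if x: "x \<in> B m" for x m
  proof -
    have "form (int m) x" using x unfolding B_def by blast
    then show ?thesis using x B0 hom_part_form[of "int m" x] unfolding A_def by auto
  qed
  have "hom_ideal A"
    unfolding hom_ideal_def
  proof (intro conjI ballI allI)
    show "0 \<in> A" by (simp add: A_def B0)
  next
    fix g h assume "g \<in> A" "h \<in> A"
    then show "g + h \<in> A" by (simp add: A_def hom_part_add Badd)
  next
    fix g h assume h: "h \<in> A"
    have "hom_part i g * hom_part (d - i) h \<in> B d" if "i \<le> d" for i d
      using Bmult[OF form_hom_part, of "hom_part (d - i) h" "d - i" i g] h that by (simp add: A_def)
    then show "g * h \<in> A" unfolding A_def
      by (intro CollectI allI, subst hom_part_mult, intro Bsum) auto
  next
    fix h d assume "h \<in> A"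
    then show "hom_part d h \<in> A" by (simp add: A_def B0 hom_part_form[OF form_hom_part])
  qed
  have "\<exists>M. l ^ M \<in> A"
  proof (rule ccontr)
    assume "\<not> ?thesis"
    then obtain P where P: "proj_prime P" "A \<subseteq> P" "l \<notin> P"
      using homogeneous_prime_avoiding[OF \<open>hom_ideal A\<close> l] by auto
    then have pt: "prime_of (Point P) = P" by (simp add: prime_of_Point)
    obtain h0 e f g d where h0: "form e h0" "h0 \<notin> P" "form d f" "form d g"
      "\<And>q. h0 \<notin> prime_of q \<Longrightarrow> g \<notin> prime_of q \<and> s q - Fract f g \<in> I q"
      using spec[OF s[unfolded OT_lifts_iff], of "Point P"] unfolding fraction_near_def pt by blast
    have g: "g \<notin> P" using h0(2,5) pt by metis
    obtain e' where e': "e = int e'" using form_nonneg[OF h0(1)] h0(2) pt nonzero_outside by metis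
    obtain d' where d': "d = int d'" using form_nonneg[OF h0(4)] g pt nonzero_outside by metis
    \<comment> \<open>The factor \<open>l\<close> makes the degree of \<open>h\<close> positive.\<close>
    define h where "h = h0 * l"
    have h: "form (int (e' + 1)) h" "h \<notin> P"
      using form_mult[OF h0(1) l] e' outside_mult[of h0 "Point P" l] h0 P pt by (auto simp: h_def add.commute)
    have hloc: "g \<notin> prime_of q \<and> s q - Fract f g \<in> I q" if "h \<notin> prime_of q" for q
      using that h0(5) prime_multR[OF proj_prime_prime_of] unfolding h_def by blast
    let ?E = "e' + 1"
    obtain i where i: "\<And>q. l \<notin> prime_of q \<Longrightarrow> h \<in> prime_of q \<Longrightarrow> Fract (h ^ i) (l ^ (?E * i)) \<in> I q"
      using nilpotent_where_zero[OF l h(1) _ stable] by auto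
    have hi: "form (int (?E * i)) (h ^ i)" using form_power[OF h(1), of i]
      by (simp only: of_nat_mult mult.commute)
    have "h ^ i * g \<in> B (?E * i + d')"
    proof (rule BI)
      show "form (int (?E * i + d')) (h ^ i * g)" using form_mult[OF hi h0(4)] d' by simp
      show "form (int (?E * i + d')) (h ^ i * f)" using form_mult[OF hi h0(3)] d' by simp
      fix q assume q: "l \<notin> prime_of q"
      let ?u = "Fract (h ^ i) (l ^ (?E * i))" and ?g = "Fract g (l ^ d')" and ?f = "Fract f (l ^ d')"
      have st: "?u \<in> O_stalk 0 q" "?g \<in> O_stalk 0 q" "?f \<in> O_stalk 0 q"
        using O_stalk_Fract[OF hi lp] O_stalk_Fract[OF _ lp[of d']] power_outside[OF q] h0(3,4) d' by auto
      have eq: "Fract (h ^ i * g) (l ^ (?E * i + d')) * s q - Fract (h ^ i * f) (l ^ (?E * i + d'))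
         = ?u * (?g * s q - ?f)"
        by (simp add: right_diff_distrib power_add flip: mult.assoc)
      have "?u * (?g * s q - ?f) \<in> I q"
      proof (cases "h \<in> prime_of q")
        case True
        have "s q * (?g * ?u) - ?f * ?u \<in> I q"
          by (intro I_diff I_mult i[OF q True] lift_in_O_stalk[OF s] st)
        then show ?thesis by (simp add: algebra_simps del: mult_fract)
      next
        case False
        then have g: "g \<notin> prime_of q" and sq: "s q - Fract f g \<in> I q" using hloc by auto
        have "?g * Fract f g = ?f"
          using nonzero_outside[OF g] nonzero_outside[OF power_outside[OF q, of d']] by (simp add: eq_fract)
        then have "?g * (s q - Fract f g) = ?g * s q - ?f" by (simp only: right_diff_distrib)
        then have "?u * (?g * s q - ?f) = ?u * (?g * (s q - Fract f g))" by (simp only:)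
        also have "\<dots> \<in> I q" by (intro I_mult sq st)
        finally show ?thesis .
      qed
      then show "Fract (h ^ i * g) (l ^ (?E * i + d')) * s q - Fract (h ^ i * f) (l ^ (?E * i + d')) \<in> I q"
        unfolding eq .
    qed
    then have "h ^ i * g \<in> A" by (rule BA)
    then have "h ^ i * g \<in> P" using P(2) by blast
    then show False using prime_cases[OF P(1)] prime_power[OF P(1) h(2)] g by blast
  qed
  then obtain M where "l ^ M \<in> A" by blast
  then have "l ^ M \<in> B M" using hom_part_form[OF lp[of M], of M] unfolding A_def by (metis (mono_tags) mem_Collect_eq)
  then obtain N f where N: "form (int N) f"
    "\<And>q. l \<notin> prime_of q \<Longrightarrow> Fract (l ^ M) (l ^ M) * s q - Fract f (l ^ N) \<in> I q" unfolding B_def by blast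
  have "s q - Fract f (l ^ N) \<in> I q" if "l \<notin> prime_of q" for q
  proof -
    have "Fract (l ^ M) (l ^ M) = 1"
      using nonzero_outside[OF power_outside[OF that, of M]] by (simp add: One_fract_def eq_fract)
    then show ?thesis using N(2)[OF that] by simp
  qed
  then show ?thesis using N(1) by blast
qed

text \<open>Sending a form \<open>f\<close> of a large degree \<open>n\<close> to the section \<open>f / l ^ n\<close> identifies the forms modulo \<open>J n\<close> with
  the sections of \<open>O_T\<close>. The support of \<open>T\<close> avoids the line, so the value \<open>0\<close> on the line is as good as any
  other.\<close>

theorem h0_OT_eq_codim:
  assumes l: "form 1 l" and m: "misses l n0"
  shows "\<exists>n2. \<forall>n\<ge>n2. h0_OT a b c Fa Fb Fc = codim_J n"
proof -
  obtain n2 where n2: "n2 \<ge> n0" "\<And>n. n \<ge> n2 \<Longrightarrow> codim_J n = codim_J n2"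
    "\<And>n f. n \<ge> n2 \<Longrightarrow> form n f \<Longrightarrow> l * f \<in> J (n + 1) \<Longrightarrow> f \<in> J n"
    using misses_stable[OF l m] by blast
  define n where "n = nat n2"
  have nn: "int n \<ge> n2" "int n \<ge> n0" using n2(1) by (simp_all add: n_def)
  have lp: "form (int k) (l ^ k)" for k using form_power[OF l, of k] by simp
  define \<phi> where "\<phi> f = (\<lambda>q. if l \<in> prime_of q then 0 else Fract f (l ^ n))" for f
  have stalk: "x \<in> I q" if "l \<in> prime_of q" "x \<in> O_stalk 0 q" for x q
    by (rule I_eq_O_stalk[OF misses_not_subset[OF m that(1)] that(2)])
  have cancel: "f \<in> J (int n)" if "form (int n) f" "l ^ k * f \<in> J (int n + int k)" for f k
    using that(2)
  proof (induction k)
    case (Suc k)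
    have "form (int n + int k) (l ^ k * f)" using form_mult[OF lp that(1)] by (simp add: add.commute)
    moreover have "l * (l ^ k * f) \<in> J (int n + int k + 1)" using Suc.prems by (simp add: algebra_simps)
    ultimately show ?case using Suc.IH n2(3)[of "int n + int k"] nn by simp
  qed simp
  have ker: "{f \<in> forms (int n). \<phi> f \<in> null_lifts} = J (int n)"
  proof (intro Set.set_eqI iffI)
    fix f assume "f \<in> {f \<in> forms (int n). \<phi> f \<in> null_lifts}"
    then have f: "form (int n) f" and null: "\<And>q. \<phi> f q \<in> I q" by (auto simp: OT_null_def)
    have "Fract f (l ^ n) \<in> I q" if "l \<notin> prime_of q" for q using null[of q] that by (simp add: \<phi>_def)
    then obtain k where k: "l ^ k * f \<in> J_all" using locally_in_J[OF l f] by blast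
    have "form (int n + int k) (l ^ k * f)" using form_mult[OF lp f] by (simp add: add.commute)
    then show "f \<in> J (int n)" using cancel[OF f] form_J_all k by blast
  next
    fix f assume f: "f \<in> J (int n)"
    then have "\<phi> f q \<in> I q" for q using Fract_in_I[OF f lp power_outside] by (simp add: \<phi>_def I_zero)
    then show "f \<in> {f \<in> forms (int n). \<phi> f \<in> null_lifts}" using f J_forms by (auto simp: OT_null_def)
  qed
  have into: "\<phi> f \<in> lifts" if f: "form (int n) f" for f
    unfolding OT_lifts_iff
  proof
    fix p
    show "fraction_near (\<phi> f) p"
    proof (cases "l \<in> prime_of p")
      case False
      show ?thesis
        by (rule fraction_nearI[OF l False f lp[of n]]) (use power_outside[of l _ n] I_zero in \<open>auto simp: \<phi>_def\<close>)
    next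
      case True
      then have "\<not> J_all \<subseteq> prime_of p" using misses_not_subset[OF m] by blast
      then obtain h0 where h0: "h0 \<in> J_all" "h0 \<notin> prime_of p" by blast
      obtain d where d: "hom_part d h0 \<notin> prime_of p"
        using top_part_outside[OF proj_prime_hom_ideal[OF proj_prime_prime_of] h0(2)] by blast
      have hJ: "hom_part d h0 \<in> J_all" using hom_part_J_all[OF h0(1)] J_sub_J_all by blast
      have "1 \<notin> prime_of q \<and> \<phi> f q - Fract 0 1 \<in> I q" if "hom_part d h0 \<notin> prime_of q" for q
      proof -
        have "\<phi> f q \<in> O_stalk 0 q"
          using O_stalk_Fract[OF f lp power_outside] I_sub_O_stalk[OF I_zero] by (simp add: \<phi>_def)
        then show ?thesis using I_eq_O_stalk[of q "\<phi> f q"] hJ that by auto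
      qed
      then show ?thesis by (rule fraction_nearI[OF form_hom_part d form_0 form_1])
    qed
  qed
  have onto: "\<exists>f\<in>forms (int n). s - \<phi> f \<in> null_lifts" if s: "s \<in> lifts" for s
  proof -
    obtain N f where f: "form (int N) f" "\<And>q. l \<notin> prime_of q \<Longrightarrow> s q - Fract f (l ^ N) \<in> I q"
      using global_fraction[OF l n2(2) s] by blast
    have "form (int n + int N) (l ^ n * f)" using form_mult[OF lp f(1)] by simp
    then obtain f' where f': "form (int n) f'" "l ^ n * f - l ^ N * f' \<in> J (int n + int N)"
      using descend[OF m nn(2) l] by blast
    have "(s - \<phi> f') q \<in> I q" for q
    proof (cases "l \<in> prime_of q")
      case True
      then show ?thesis using stalk[OF True lift_in_O_stalk[OF s]] by (simp add: \<phi>_def)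
    next
      case False
      note nz = nonzero_outside[OF power_outside[OF False]]
      have "Fract f (l ^ N) - Fract f' (l ^ n) = Fract (l ^ n * f - l ^ N * f') (l ^ n * l ^ N)"
        using nz by (simp add: eq_fract algebra_simps)
      also have "\<dots> \<in> I q"
        using Fract_in_I[OF f'(2)] form_mult[OF lp lp] outside_mult[OF power_outside[OF False] power_outside[OF False]]
        by blast
      finally have "(s q - Fract f (l ^ N)) + (Fract f (l ^ N) - Fract f' (l ^ n)) \<in> I q"
        by (rule I_add[OF f(2)[OF False]])
      moreover have "(s q - Fract f (l ^ N)) + (Fract f (l ^ N) - Fract f' (l ^ n)) = s q - Fract f' (l ^ n)"
        by (simp only: add_diff_eq diff_add_cancel)
      ultimately have "s q - Fract f' (l ^ n) \<in> I q" by (simp only:)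
      then show ?thesis using False by (simp add: \<phi>_def)
    qed
    then show ?thesis using f'(1) by (intro bexI[of _ f']) (auto simp: OT_null_def)
  qed
  let ?P = "\<lambda>C. sec.subspace C \<and> C \<inter> null_lifts = {0} \<and>
     {x + y | x y. x \<in> C \<and> y \<in> null_lifts} = lifts"
  define C where "C = (SOME C. ?P C)"
  have "\<exists>C. ?P C" by (rule sec.complement_exists[OF subspace_null subspace_lifts null_sub_lifts])
  then have C: "?P C" unfolding C_def by (rule someI_ex)
  have "P.dim (forms (int n) :: 'k poly3 set) = sec.dim C + P.dim {f \<in> forms (int n). \<phi> f \<in> null_lifts}"
  proof (rule Psec.dim_complement_of_image[OF subspace_forms fin_span_forms])
    fix f g :: "'k poly3"
    have "Fract (f + g) (l ^ n) = Fract f (l ^ n) + Fract g (l ^ n)" if "l \<notin> prime_of q" for q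
      using Fract_add_same[OF nonzero_outside[OF power_outside[OF that]], of f n g] by simp
    then show "\<phi> (f + g) = \<phi> f + \<phi> g" by (auto simp: \<phi>_def fun_eq_iff)
    fix k
    show "\<phi> (pscale k f) = scale_sec k (\<phi> f)" by (auto simp: \<phi>_def fun_eq_iff pscale_def scale_sec_def)
  qed (use C subspace_null into onto in auto)
  then have "sec.dim C = codim_J (int n)" unfolding ker codim_J_def by simp
  moreover have "h0_OT a b c Fa Fb Fc = sec.dim C" unfolding h0_OT_def dim_quot_def C_def ..
  ultimately show ?thesis using n2(2) nn(1) by metis
qed

end

section \<open>Codimension two means no common factor\<close>

lemma closed_iff_vanishing:
  "closed Y \<longleftrightarrow> (\<exists>A. (\<forall>f\<in>A. \<exists>d. form d f) \<and> Y = {p. A \<subseteq> prime_of p})"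
proof -
  have "closed Y \<longleftrightarrow> (\<exists>A. (\<forall>f\<in>A. \<exists>d. form d f) \<and> - Y = {p. \<not> A \<subseteq> prime_of p})"
    by (simp add: closed_def open_proj_plane_def)
  moreover have "- Y = {p. \<not> A \<subseteq> prime_of p} \<longleftrightarrow> Y = {p. A \<subseteq> prime_of p}" for A by blast
  ultimately show ?thesis by simp
qed

text \<open>The point given by the principal ideal of \<open>\<pi>\<close> is generic on the curve.\<close>

lemma curve_irreducible:
  fixes \<pi> :: "'k::field poly3"
  assumes p: "prime_elem \<pi>" and f: "form d \<pi>"
  shows "closed {q. \<pi> \<in> prime_of q}" "irreducible_set {q. \<pi> \<in> prime_of q}"
    "prime_of (Point {f. \<pi> dvd f}) = {f. \<pi> dvd f}"
proof -
  let ?V = "{q. \<pi> \<in> prime_of q}"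
  show cl: "closed ?V" unfolding closed_iff_vanishing using f by (intro exI[of _ "{\<pi>}"]) auto
  show pt: "prime_of (Point {f. \<pi> dvd f}) = {f. \<pi> dvd f}"
    by (rule prime_of_Point[OF principal_proj_prime[OF p f]])
  have gen: "?V \<subseteq> A" if A: "closed A" "Point {f. \<pi> dvd f} \<in> A" for A
  proof
    fix q assume "q \<in> ?V"
    then have "{f. \<pi> dvd f} \<subseteq> prime_of q"
      using prime_multR[OF proj_prime_prime_of] by (auto elim!: dvdE)
    then show "q \<in> A" using A pt unfolding closed_iff_vanishing by auto
  qed
  have "Point {f. \<pi> dvd f} \<in> ?V" using pt by simp
  then show "irreducible_set ?V" unfolding irreducible_set_def using gen by blast
qed

text \<open>A closed irreducible set strictly between a curve and the plane would be contained in the zero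
  locus of a form; take one of least degree, and divide it by the equation of the curve.\<close>

lemma irr_codim_curve:
  fixes \<pi> :: "'k::field poly3"
  assumes p: "prime_elem \<pi>" and f: "form d \<pi>"
  shows "irr_codim {q. \<pi> \<in> prime_of q} \<le> 1"
  unfolding irr_codim_def
proof (rule Sup_least)
  let ?V = "{q. \<pi> \<in> prime_of q}"
  let ?\<eta> = "Point {f. \<pi> dvd f}"
  fix x assume "x \<in> {enat n | n. \<exists>Y. Y 0 = ?V \<and> (\<forall>i\<le>n. closed (Y i) \<and> irreducible_set (Y i)) \<and>
                          (\<forall>i<n. Y i \<subset> Y (Suc i))}"
  then obtain n Y where x: "x = enat n" and Y: "Y 0 = ?V" "\<And>i. i \<le> n \<Longrightarrow> closed (Y i) \<and> irreducible_set (Y i)"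
    "\<And>i. i < n \<Longrightarrow> Y i \<subset> Y (Suc i)" by blast
  have "n \<le> 1"
  proof (rule ccontr)
    assume "\<not> n \<le> 1"
    then have n: "0 < n" "1 < n" by auto
    let ?Y = "Y 1"
    have Y1: "closed ?Y" "irreducible_set ?Y" "?V \<subset> ?Y" "?Y \<subset> Y 2"
      using Y(2)[of 1] Y(3)[OF n(1)] Y(3)[OF n(2)] Y(1) n by (auto simp: numeral_2_eq_2)
    obtain A where A: "\<forall>f\<in>A. \<exists>d. form d f" "?Y = {q. A \<subseteq> prime_of q}"
      using Y1(1) unfolding closed_iff_vanishing by blast
    let ?Q = "\<lambda>k. \<exists>g. g \<noteq> 0 \<and> form (int k) g \<and> ?Y \<subseteq> {q. g \<in> prime_of q}"
    have "\<exists>g\<in>A. g \<noteq> 0"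
    proof (rule ccontr)
      assume "\<not> ?thesis"
      then have "A \<subseteq> prime_of q" for q :: "'k proj_plane" using prime_zero[OF proj_prime_prime_of, of q] by auto
      then have "?Y = UNIV" using A(2) by auto
      then show False using Y1(4) by blast
    qed
    then obtain g where "g \<in> A" "g \<noteq> 0" by blast
    moreover from this obtain k where "form (int k) g" using A(1) form_nonneg by metis
    ultimately have "?Q k" using A(2) by auto
    then have least: "?Q (LEAST k. ?Q k)" by (rule LeastI)
    then obtain g where g: "g \<noteq> 0" "form (int (LEAST k. ?Q k)) g" "?Y \<subseteq> {q. g \<in> prime_of q}" by blast
    have "?\<eta> \<in> ?Y" using Y1(3) curve_irreducible(3)[OF p f] by auto
    then have "\<pi> dvd g" using g(3) curve_irreducible(3)[OF p f] by auto
    then obtain h where h: "g = \<pi> * h" by (rule dvdE)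
    have "h \<noteq> 0" "\<pi> \<noteq> 0" using g(1) h by auto
    have hf: "form (int (LEAST k. ?Q k) - d) h" using form_quotient[OF _ f \<open>\<pi> \<noteq> 0\<close>] g(2) h by blast
    then obtain k where k: "int (LEAST k. ?Q k) - d = int k" using form_nonneg \<open>h \<noteq> 0\<close> by blast
    have "k < (LEAST k. ?Q k)" using k prime_elem_form_degree_pos[OF p f] by linarith
    then have "\<not> ?Q k" by (rule not_less_Least)
    then have "\<not> ?Y \<subseteq> {q. h \<in> prime_of q}" using \<open>h \<noteq> 0\<close> hf k by auto
    moreover have "?Y \<subseteq> ?V \<union> {q. h \<in> prime_of q}"
      using g(3) h prime_cases[OF proj_prime_prime_of] by blast
    moreover have "closed ?V" "closed {q. h \<in> prime_of q}"
      using curve_irreducible(1)[OF p f] hf unfolding closed_iff_vanishing[of "{q. h \<in> prime_of q}"]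
      by (auto intro!: exI[of _ "{h}"])
    ultimately have "?Y \<subseteq> ?V" using Y1(2) unfolding irreducible_set_def by blast
    then show False using Y1(3) by blast
  qed
  then show "x \<le> 1" by (simp add: x one_enat_def)
qed

context plane_triple
begin

text \<open>A common prime factor would put a whole curve into the support of \<open>T\<close>.\<close>

lemma qci_primitive:
  assumes "qci a b c Fa Fb Fc" shows "primitive3 Fa Fb Fc"
proof (rule ccontr)
  assume not: "\<not> primitive3 Fa Fb Fc"
  have F: "Fa \<noteq> 0" using assms by (simp add: qci_def)
  from not_primitive3_prime[OF not disjI1[OF F]]
  obtain \<pi> where \<pi>: "prime_elem \<pi>" "\<pi> dvd Fa" "\<pi> dvd Fb" "\<pi> dvd Fc"
    by (elim exE conjE)
  obtain d where d: "form d \<pi>" using form_dvd[OF form_F(1) F \<pi>(2)] by (elim exE)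
  let ?V = "{q. \<pi> \<in> prime_of q}"
  have "?V \<subseteq> T_support a b c Fa Fb Fc"
  proof
    fix q assume q: "q \<in> ?V"
    have "f \<in> prime_of q" if "\<pi> dvd f" for f using that q prime_multR[OF proj_prime_prime_of] by (auto elim!: dvdE)
    then have Jq: "J_all \<subseteq> prime_of q"
      using J_all_subset[OF proj_prime_hom_ideal[OF proj_prime_prime_of]] \<pi>(2-4) by blast
    have "1 \<notin> I q"
    proof
      assume "1 \<in> I q"
      then obtain e f g where "f \<in> J e" "g \<notin> prime_of q" "1 = Fract f g" unfolding I_iff by blast
      then show False using Jq J_sub_J_all nonzero_outside[of g q] by (auto simp: One_fract_def eq_fract)
    qed
    moreover have "1 \<in> O_stalk 0 q" using O_stalk_Fract[of 0 1 1 q] by (simp add: One_fract_def)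
    ultimately show "q \<in> T_support a b c Fa Fb Fc" unfolding T_support_def by blast
  qed
  then have "codim (T_support a b c Fa Fb Fc) \<le> irr_codim ?V"
    unfolding codim_def using curve_irreducible[OF \<pi>(1) d] by (intro INF_lower) auto
  also have "\<dots> \<le> 1" by (rule irr_codim_curve[OF \<pi>(1) d])
  finally have "(2 :: enat) \<le> 1" using assms by (simp add: qci_def)
  then show False by simp
qed

end

section \<open>Global sections of O(n) and of E(m)\<close>

text \<open>A section is a constant family, as the generic point lies in every nonempty open set. The ideal
  of all \<open>h\<close> for which \<open>h\<close> times the constant is a polynomial is contained in no point of the plane. It thus
  contains powers of two different variables, and these have no common factor.\<close>

lemma O_sections_UNIV:
  fixes s :: "'k::field proj_plane \<Rightarrow> 'k poly3 fract"
  shows "s \<in> O_sections n UNIV \<longleftrightarrow> (\<exists>f. form n f \<and> s = (\<lambda>_. emb f))"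
proof
  assume "\<exists>f. form n f \<and> s = (\<lambda>_. emb f)"
  then obtain f where f: "form n f" "s = (\<lambda>_. emb f)" by blast
  have "\<exists>V f g d. open V \<and> p \<in> V \<and> V \<subseteq> UNIV \<and> form (n + d) f \<and> form d g \<and>
      (\<forall>q\<in>V. g \<notin> prime_of q \<and> s q = Fract f g)" for p
    using f by (intro exI[of _ UNIV] exI[of _ f] exI[of _ 1] exI[of _ 0]) auto
  then show "s \<in> O_sections n UNIV" unfolding O_sections_def by blast
next
  assume s: "s \<in> O_sections n UNIV"
  let ?\<eta> = "Point {0} :: 'k proj_plane"
  have eta: "prime_of ?\<eta> = {0}" by (rule prime_of_Point[OF proj_prime_zero])
  have loc: "\<exists>f g d. form (n + d) f \<and> form d g \<and> g \<notin> prime_of p \<and> s p = Fract f g \<and> s ?\<eta> = Fract f g" for p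
  proof -
    obtain V f g d where V: "open V" "p \<in> V" "form (n + d) f" "form d g"
      "\<And>q. q \<in> V \<Longrightarrow> g \<notin> prime_of q \<and> s q = Fract f g"
      using s unfolding O_sections_def by blast
    obtain h e where h: "h \<notin> prime_of p" "{q. h \<notin> prime_of q} \<subseteq> V" using open_basis[OF V(1,2)] by blast
    have "?\<eta> \<in> V" using h nonzero_outside[OF h(1)] eta by auto
    then show ?thesis using V by blast
  qed
  then have const: "s p = s ?\<eta>" for p by metis
  obtain f0 g0 d0 where f0: "form (n + d0) f0" "form d0 g0" "g0 \<noteq> 0" "s ?\<eta> = Fract f0 g0"
    using loc[of ?\<eta>] eta by auto
  let ?A = "{h. g0 dvd f0 * h}"
  have "hom_ideal ?A"
    unfolding hom_ideal_def
  proof (intro conjI ballI allI)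
    show "0 \<in> ?A" by simp
  next
    fix g h assume "g \<in> ?A" "h \<in> ?A" then show "g + h \<in> ?A" by (simp add: distrib_left)
  next
    fix g h assume "h \<in> ?A"
    then have "g0 dvd (f0 * h) * g" by simp
    then show "g * h \<in> ?A" by (simp add: mult.assoc mult.commute[of g])
  next
    fix h k assume "h \<in> ?A"
    then obtain q where q: "f0 * h = g0 * q" by (auto elim: dvdE)
    have "f0 * hom_part k h = hpart (int k + (n + d0)) (f0 * h)"
      using hpart_mult[OF f0(1), of "int k + (n + d0)" h] by (simp add: hpart_def)
    also have "\<dots> = g0 * hpart (int k + n) q"
      unfolding q using hpart_mult[OF f0(2), of "int k + (n + d0)" q] by simp
    finally show "hom_part k h \<in> ?A" by simp
  qed
  have "\<exists>N. var i ^ N \<in> ?A" for i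
  proof (rule ccontr)
    assume "\<not> ?thesis"
    moreover have "(0 :: int) < 1" by simp
    ultimately obtain P where P: "proj_prime P" "?A \<subseteq> P"
      using homogeneous_prime_avoiding[OF \<open>hom_ideal ?A\<close> form_var] by blast
    obtain f g d where "g \<notin> prime_of (Point P)" "s ?\<eta> = Fract f g" using loc[of "Point P"] by blast
    then have g: "g \<notin> P" "Fract f0 g0 = Fract f g" "g \<noteq> 0"
      using prime_of_Point[OF P(1)] nonzero_outside f0(4) by auto
    then have "f0 * g = g0 * f" using f0(3) by (simp add: eq_fract mult.commute)
    then have "g \<in> ?A" by simp
    then show False using P(2) g(1) by blast
  qed
  then obtain N where N: "\<And>i. var i ^ N i \<in> ?A" by metis
  let ?M = "N 0 + N 1"
  have "g0 dvd f0 * var 0 ^ ?M" "g0 dvd f0 * var 1 ^ ?M"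
  proof -
    have "g0 dvd (f0 * var 0 ^ N 0) * var 0 ^ N 1" "g0 dvd (f0 * var 1 ^ N 1) * var 1 ^ N 0"
      using N[of 0] N[of 1] by simp_all
    then show "g0 dvd f0 * var 0 ^ ?M" "g0 dvd f0 * var 1 ^ ?M"
      by (simp_all only: power_add mult.assoc mult.commute[of "var 1 ^ N 0"])
  qed
  then obtain k0 k1 where k: "f0 * var 0 ^ ?M = g0 * k0" "f0 * var 1 ^ ?M = g0 * k1" by (elim dvdE)
  have "g0 * (var 1 ^ ?M * k0) = var 1 ^ ?M * (f0 * var 0 ^ ?M)" using k(1) by (simp add: mult.left_commute)
  also have "\<dots> = g0 * (var 0 ^ ?M * k1)" using k(2) by (simp add: mult.left_commute mult.commute)
  finally have "var 1 ^ ?M * k0 = var 0 ^ ?M * k1" using f0(3) by simp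
  then have "var 0 ^ ?M dvd var 1 ^ ?M * k0" by (rule dvdI)
  then have "var 0 ^ ?M dvd k0" by (rule var_power_dvd_cancel[OF zero_neq_one])
  then obtain f where f: "k0 = var 0 ^ ?M * f" by (rule dvdE)
  have X: "var 0 ^ ?M \<noteq> (0 :: 'k poly3)" by simp
  have "var 0 ^ ?M * f0 = f0 * var 0 ^ ?M" by (rule mult.commute)
  also have "\<dots> = var 0 ^ ?M * (g0 * f)" unfolding k(1) f by (rule mult.left_commute)
  finally have f0f: "f0 = g0 * f" by (simp only: mult_left_cancel[OF X])
  then have "form n f" using form_quotient[of "n + d0" g0 f d0] f0 by simp
  moreover have "s ?\<eta> = emb f" unfolding f0(4) f0f using f0(3) by (simp add: eq_fract mult.commute)
  then have "s = (\<lambda>_. emb f)" using const by auto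
  ultimately show "\<exists>f. form n f \<and> s = (\<lambda>_. emb f)" by blast
qed

lemma emb_inject [simp]: "emb f = emb g \<longleftrightarrow> f = g"
  by (simp add: eq_fract)

lemma emb_eq_0 [simp]: "emb f = 0 \<longleftrightarrow> f = 0"
  using emb_inject[of f 0] unfolding Fract_zero .

interpretation sec3: vector_space "scale_sec3 :: 'k::field \<Rightarrow> _"
  by (rule vector_space_scale_sec3)

interpretation P3sec3: vector_space_pair "pscale3 :: 'k::field \<Rightarrow> _" "scale_sec3 :: 'k::field \<Rightarrow> _" ..

context plane_triple
begin

lemma h0_E_eq_dim_Syz: "h0_E a b c Fa Fb Fc m = P3.dim (Syz (m + int c))"
proof -
  define \<psi> where "\<psi> t = (case t of (A, B, C) \<Rightarrow>
    ((\<lambda>_. emb A, \<lambda>_. emb B, \<lambda>_. emb C) :: 'k sec3))" for t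
  have rel: "emb Fa * emb A + emb Fb * emb B + emb Fc * emb C = 0 \<longleftrightarrow> A * Fa + B * Fb + C * Fc = 0" for A B C
    by (simp add: mult.commute)
  have "E_sections a b c Fa Fb Fc m UNIV = \<psi> ` Syz (m + int c)"
  proof (intro Set.set_eqI iffI)
    fix x assume "x \<in> E_sections a b c Fa Fb Fc m UNIV"
    then obtain A B C where A: "form (int c - int a + m) A" "form (int c - int b + m) B" "form m C"
      "x = (\<lambda>_. emb A, \<lambda>_. emb B, \<lambda>_. emb C)" "emb Fa * emb A + emb Fb * emb B + emb Fc * emb C = 0"
      unfolding E_sections_def O_sections_UNIV by auto
    then have "(A, B, C) \<in> Syz (m + int c)" unfolding rel by (simp add: Syz_def algebra_simps)
    then show "x \<in> \<psi> ` Syz (m + int c)" using A(4) by (auto simp: \<psi>_def intro!: image_eqI)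
  next
    fix x assume "x \<in> \<psi> ` Syz (m + int c)"
    then obtain A B C where A: "(A, B, C) \<in> Syz (m + int c)" "x = \<psi> (A, B, C)" by auto
    then have "emb Fa * emb A + emb Fb * emb B + emb Fc * emb C = 0" unfolding rel by (simp add: Syz_def)
    then show "x \<in> E_sections a b c Fa Fb Fc m UNIV"
      using A unfolding E_sections_def O_sections_UNIV \<psi>_def Syz_def by (auto simp: algebra_simps)
  qed
  moreover have "sec3.dim (\<psi> ` Syz (m + int c)) = P3.dim (Syz (m + int c))"
  proof (rule conjunct1[OF P3sec3.dim_injective_image[OF subspace_Syz fin_span_Syz]])
    fix s t :: "'k poly3 \<times> 'k poly3 \<times> 'k poly3" and k
    show "\<psi> (s + t) = \<psi> s + \<psi> t" by (cases s; cases t) (auto simp: \<psi>_def fun_eq_iff)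
    show "\<psi> (pscale3 k s) = scale_sec3 k (\<psi> s)"
      by (cases s) (auto simp: \<psi>_def scale_sec3_def scale_sec_def pscale3_def pscale_def fun_eq_iff)
    show "\<psi> s = 0 \<Longrightarrow> s = 0" by (cases s) (auto simp: \<psi>_def zero_prod_def fun_eq_iff)
  qed
  ultimately show ?thesis by (simp add: h0_E_def)
qed

lemma h0_E_nonzero_iff: "h0_E a b c Fa Fb Fc m \<noteq> 0 \<longleftrightarrow> \<not> Syz (m + int c) \<subseteq> {(0, 0, 0)}"
  unfolding h0_E_eq_dim_Syz P3.dim_eq_0_iff_span[OF fin_span_Syz] zero_prod_def ..

text \<open>The least element exists: the Koszul syzygy \<open>(Fb, - Fa, 0)\<close> occurs for \<open>m = a + b - c\<close>, and no
  syzygy has a total degree below all of \<open>a\<close>, \<open>b\<close> and \<open>c\<close>.\<close>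

lemma least_twist:
  assumes F: "Fa \<noteq> 0" and r: "r = (LEAST m. h0_E a b c Fa Fb Fc m \<noteq> 0)"
  shows "\<not> Syz (r + int c) \<subseteq> {(0, 0, 0)}" "\<And>n. n < r + int c \<Longrightarrow> Syz n \<subseteq> {(0, 0, 0)}"
proof -
  let ?P = "\<lambda>m. h0_E a b c Fa Fb Fc m \<noteq> 0"
  have lower: "- int c \<le> m" if Pm: "?P m" for m
  proof -
    obtain A B C where A: "(A, B, C) \<in> Syz (m + int c)" "(A, B, C) \<noteq> (0, 0, 0)"
      using Pm unfolding h0_E_nonzero_iff by auto
    then have "A \<noteq> 0 \<or> B \<noteq> 0 \<or> C \<noteq> 0" by auto
    then have "0 \<le> m + int c - int a \<or> 0 \<le> m + int c - int b \<or> 0 \<le> m + int c - int c"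
      using A(1) form_neg unfolding Syz_def by (metis (mono_tags, lifting) case_prodD mem_Collect_eq not_le)
    then show ?thesis by linarith
  qed
  have koszul: "?P (int a + int b - int c)"
  proof -
    have "(Fb, - Fa, 0) \<in> Syz (int a + int b - int c + int c)"
      using form_F by (auto simp: Syz_def algebra_simps intro: form_uminus)
    then show ?thesis unfolding h0_E_nonzero_iff using F by auto
  qed
  define k where "k = (LEAST k. ?P (int k - int c))"
  have ex: "?P (int (nat (int a + int b)) - int c)" using koszul by simp
  then have k: "?P (int k - int c)" unfolding k_def by (rule LeastI)
  have kle: "int k - int c \<le> m" if "?P m" for m
  proof -
    have "?P (int (nat (m + int c)) - int c)" using that lower[OF that] by simp
    then have "k \<le> nat (m + int c)" unfolding k_def by (rule Least_le)
    then show ?thesis using lower[OF that] by linarith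
  qed
  have rk: "r = int k - int c" unfolding r by (rule Least_equality) (use k kle in auto)
  show "\<not> Syz (r + int c) \<subseteq> {(0, 0, 0)}" using k unfolding h0_E_nonzero_iff rk .
  fix n assume "n < r + int c"
  then have "\<not> ?P (n - int c)" using kle[of "n - int c"] rk by fastforce
  then show "Syz n \<subseteq> {(0, 0, 0)}" unfolding h0_E_nonzero_iff by simp
qed

text \<open>Dividing by a common prime factor would lower the total degree.\<close>

lemma least_syzygy_primitive:
  assumes s: "(u, v, w) \<in> Syz e" "(u, v, w) \<noteq> (0, 0, 0)"
    and min: "\<And>n. n < e \<Longrightarrow> Syz n \<subseteq> {(0, 0, 0)}"
  shows "primitive3 u v w"
proof (rule ccontr)
  assume not: "\<not> ?thesis"
  have nz: "u \<noteq> 0 \<or> v \<noteq> 0 \<or> w \<noteq> 0" using s(2) by auto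
  from not_primitive3_prime[OF not nz]
  obtain \<pi> where \<pi>: "prime_elem \<pi>" "\<pi> dvd u" "\<pi> dvd v" "\<pi> dvd w"
    by (elim exE conjE)
  have uvw: "form (e - int a) u" "form (e - int b) v" "form (e - int c) w" "u * Fa + v * Fb + w * Fc = 0"
    using s(1) by (auto simp: Syz_def)
  obtain d where d: "form d \<pi>" using nz form_dvd[OF uvw(1)] form_dvd[OF uvw(2)] form_dvd[OF uvw(3)] \<pi>(2-4) by blast
  have p0: "\<pi> \<noteq> 0" using \<pi>(1) by auto
  obtain u' v' w' where q: "u = \<pi> * u'" "v = \<pi> * v'" "w = \<pi> * w'" using \<pi>(2-4) by (elim dvdE)
  have "form (e - int a - d) u'" "form (e - int b - d) v'" "form (e - int c - d) w'"
    using form_quotient[OF _ d p0] uvw q by blast+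
  then have "form (e - d - int a) u'" "form (e - d - int b) v'" "form (e - d - int c) w'"
    by (simp_all add: algebra_simps)
  moreover have "\<pi> * (u' * Fa + v' * Fb + w' * Fc) = 0" using uvw(4) q by (simp add: algebra_simps)
  then have "u' * Fa + v' * Fb + w' * Fc = 0" using p0 by simp
  ultimately have "(u', v', w') \<in> Syz (e - d)" by (simp add: Syz_def)
  then have "(u', v', w') = (0, 0, 0)" using min[of "e - d"] prime_elem_form_degree_pos[OF \<pi>(1) d] by auto
  then show False using q s(2) by simp
qed

end

section \<open>The bounds\<close>

text \<open>Otherwise \<open>1\<close> plus the product of all \<open>X - a\<close> would have no root.\<close>

lemma alg_closed_infinite: "infinite (UNIV :: 'k::alg_closed_field set)"
proof
  assume fin: "finite (UNIV :: 'k set)"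
  let ?p = "\<Prod>a\<in>(UNIV :: 'k set). [:- a, 1:]"
  have "degree ?p = (\<Sum>a\<in>(UNIV :: 'k set). degree [:- a, 1:])"
    by (rule degree_prod_eq_sum_degree) auto
  also have "\<dots> = card (UNIV :: 'k set)" by simp
  finally have "degree ?p > 0" using fin by (simp add: card_gt_0_iff)
  then have "degree (?p + 1) > 0" by (subst degree_add_eq_left) auto
  then obtain x where "poly (?p + 1) x = 0" using alg_closed_imp_poly_has_root by blast
  moreover have "poly ?p x = 0" using fin by (simp add: poly_prod)
  ultimately show False by simp
qed

theorem theorem6:
  fixes Fa Fb Fc :: "'k::alg_closed_field poly3"
    and a b c t :: nat and r :: int
  assumes "a \<le> b" and "b \<le> c"
    and "qci a b c Fa Fb Fc"
    and "t = h0_OT a b c Fa Fb Fc"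
    and "r = (LEAST m. h0_E a b c Fa Fb Fc m \<noteq> 0)"
  shows "(int c * (int a + int b - int c - r) \<le> int t \<and>
          int t \<le> r^2 + r * (int c - int a - int b) + int a * int b) \<and>
         (2 * r > int a + int b - int c \<longrightarrow>
          real t \<le> of_int (r * (int c - int a - int b) + int a * int b + r^2) -
            of_int ((int c - int a - int b + 2 * r + 1) * (int c - int a - int b + 2 * r)) / 2)"
proof -
  have F: "Fa \<noteq> 0" "form (int a) Fa" "form (int b) Fb" "form (int c) Fc"
    using assms(3) by (simp_all add: qci_def)
  interpret T: plane_triple Fa Fb Fc a b c by unfold_locales (use F in auto)
  define e where "e = r + int c"
  have e1: "\<not> T.Syz e \<subseteq> {(0, 0, 0)}" and min: "\<And>n. n < e \<Longrightarrow> T.Syz n \<subseteq> {(0, 0, 0)}"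
    using T.least_twist[OF F(1) assms(5)] by (simp_all add: e_def)
  then obtain u v w where s: "(u, v, w) \<in> T.Syz e" "(u, v, w) \<noteq> (0, 0, 0)" by auto
  interpret S: syz_triple Fa Fb Fc "int a" "int b" "int c" u v w e
    using s(1) T.qci_primitive[OF assms(3)] T.least_syzygy_primitive[OF s min]
    by unfold_locales (auto simp: T.Syz_def)
  have inf: "infinite (UNIV :: 'k set)" by (rule alg_closed_infinite)
  obtain k n0 where line: "T.misses (line k) n0" using S.missing_line[OF inf] by blast
  obtain n2 where n2: "\<And>n. n \<ge> n2 \<Longrightarrow> t = T.codim_J n"
    using T.h0_OT_eq_codim[OF form_line line] assms(4) by metis
  have Q: "S.Q = r^2 + r * (int c - int a - int b) + int a * int b"
    unfolding S.Q_def S.sigma_def by (simp add: e_def power2_eq_square algebra_simps)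
  have upper: "int t \<le> S.Q"
    using S.codim_J_le_Q[of "max n2 S.large"] n2[of "max n2 S.large"] by simp
  obtain n3 where n3: "\<forall>n\<ge>n3. S.Q - (e - int a) * (e - int b) \<le> int (T.codim_J n)"
    using S.codim_J_lower[OF inf F(1)] assms(1,2) by auto
  have "S.Q - (e - int a) * (e - int b) = int c * (int a + int b - int c - r)"
    unfolding Q by (simp add: e_def power2_eq_square algebra_simps)
  then have lower: "int c * (int a + int b - int c - r) \<le> int t"
    using n3[rule_format, of "max n2 n3"] n2[of "max n2 n3"] by simp
  have "real t \<le> of_int (r * (int c - int a - int b) + int a * int b + r^2) -
            of_int ((int c - int a - int b + 2 * r + 1) * (int c - int a - int b + 2 * r)) / 2"
    if pos: "2 * r > int a + int b - int c"
  proof -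
    have D: "2 * e - S.sigma = int c - int a - int b + 2 * r" unfolding S.sigma_def by (simp add: e_def)
    obtain n4 where n4: "\<forall>n\<ge>n4. 2 * int (T.codim_J n) \<le> 2 * S.Q - (2 * e - S.sigma) * (2 * e - S.sigma + 1)"
      using S.codim_J_upper[OF inf min] pos D by auto
    have "2 * int t \<le> 2 * (r * (int c - int a - int b) + int a * int b + r^2)
        - (int c - int a - int b + 2 * r + 1) * (int c - int a - int b + 2 * r)"
      using n4[rule_format, of "max n2 n4"] n2[of "max n2 n4"] unfolding D Q by (simp add: mult.commute add.commute)
    then have "real_of_int (2 * int t) \<le> real_of_int (2 * (r * (int c - int a - int b) + int a * int b + r^2)
        - (int c - int a - int b + 2 * r + 1) * (int c - int a - int b + 2 * r))"
      by (rule of_int_le_iff[THEN iffD2])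
    then show ?thesis unfolding of_int_diff[of "2 * _"] of_int_mult[of 2] by simp
  qed
  then show ?thesis using lower upper unfolding Q by blast
qed

end
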